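(* Let $N\ge2$ and let $A=[A(i,j)]_{i,j=1}^N$ be an essential $N\times N$ matrix with entries in $\{0,1\}$. Then the zeta function $\zeta_{D_A}(z)$ of the Markov-Dyck shift $D_A$ is given by $$\zeta_{D_A}(z)=\frac{\zeta({C^A}^{\infty},z)}{\det\bigl(I_N-\operatorname{diag}[f_1^A(z^2),\dots,f_N^A(z^2)]\,zA\bigr)^2},$$ where $$\zeta({C^A}^{\infty},z)=\prod_{\{j_1,\dots,j_k\}\subset\{1,2,\dots,N\}}\zeta\bigl(C^A[\{j_1,\dots,j_k\}]^{\infty},z\bigr)^{(-1)^{k+1}},$$ the product running over all nonempty subsets $\{j_1,\dots,j_k\}$ (with $k$ elements, $1\le k\le N$) of $\{1,2,\dots,N\}$; the zeta function $\zeta(C^A[\{j_1,\dots,j_k\}]^{\infty},z)$ is given by $$\zeta\bigl(C^A[\{j_1,\dots,j_k\}]^{\infty},z\bigr)=\frac{1}{1-g_{C^A[\{j_1,\dots,j_k\}]}(z)},\qquad g_{C^A[\{j_1,\dots,j_k\}]}(z)=z^2\sum_{i=1}^N A(i,j_1)\cdots A(i,j_k)f_i^A(z^2),$$ and the functions $f_i^A$, $i=1,\dots,N$, satisfy the relations $$f_i^A(z)=1+z f_i^A(z)\sum_{j=1}^N A(j,i)f_j^A(z).$$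
   Context: A matrix is essential if it has no zero row and no zero column. Markov-Dyck shift. Let $\mathcal O_A$ be the Cuntz-Krieger algebra, i.e. the universal $C^*$-algebra generated by partial isometries $t_1,\dots,t_N$ subject to $\sum_{j=1}^N t_jt_j^*=1$ and $t_i^*t_i=\sum_{j=1}^N A(i,j)t_jt_j^*$ for $i=1,\dots,N$. Let $\Sigma^-=\{\alpha_1,\dots,\alpha_N\}$, $\Sigma^+=\{\beta_1,\dots,\beta_N\}$, $\Sigma=\Sigma^-\cup\Sigma^+$ (disjoint), $\varphi_A(\alpha_i)=t_i^*$, $\varphi_A(\beta_i)=t_i$. A word $\gamma_1\cdots\gamma_n$ over $\Sigma$ is forbidden if $\varphi_A(\gamma_1)\cdots\varphi_A(\gamma_n)=0$ in $\mathcal O_A$. $D_A\subset\Sigma^{\mathbb Z}$ is the subshift of all bi-infinite sequences containing no forbidden word; a word is admissible in $D_A$ if it appears in some element of $D_A$. Zeta functions. For a shift-invariant set $C\subset\Sigma^{\mathbb Z}$, $P_n(C)$ is the set of $x\in C$ with $\sigma^n(x)=x$ ($\sigma$ the left shift), and $\zeta(C,z)=\exp\bigl(\sum_{n\ge1}|P_n(C)|z^n/n\bigr)$; $\zeta_{D_A}(z)=\zeta(D_A,z)$. Identities are understood as identities of formal power series in $z$. Dyck words. For $n\ge1$, $C_n^A$ is the set of words $w=(w_1,\dots,w_{2n})$ over $\Sigma$ admissible in $D_A$ such that every prefix contains at least as many symbols from $\Sigma^-$ as from $\Sigma^+$, and $w$ contains equally many symbols from $\Sigma^-$ and $\Sigma^+$.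 For $1\le i\le N$, $C_n^A(i)=\{w\in C_n^A: (\alpha_i,w_1,\dots,w_{2n},\beta_i)\in C_{n+1}^A\}$, $c_n^A(i)=|C_n^A(i)|$; $C_0^A(i)$ consists of the empty word and $c_0^A(i)=1$. $f_i^A(z)=\sum_{n\ge0}c_n^A(i)z^n$ (the relations in the claim determine these power series uniquely). For a nonempty subset $J=\{j_1,\dots,j_k\}\subset\{1,\dots,N\}$, $C^A[J]$ is the set of all words $(\alpha_i,w_1,\dots,w_{2n-2},\beta_i)$ with $n\ge1$, $1\le i\le N$, $A(i,j_1)=\cdots=A(i,j_k)=1$ and $(w_1,\dots,w_{2n-2})\in C_{n-1}^A(i)$. $C^A[J]^{\infty}\subset\Sigma^{\mathbb Z}$ is the set of all two-sided sequences that are free concatenations of words of $C^A[J]$. Finally ${C^A}^{\infty}=\bigcup_{J}C^A[J]^{\infty}$, the union over all nonempty $J\subset\{1,\dots,N\}$. *)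

theory Defs
  imports "HOL-Analysis.Analysis" "HOL-Library.Poly_Mapping"
begin

section \<open>The free unital *-algebra on the generators\<close>

text \<open>The index set \<open>{1,\<dots>,N}\<close> is a finite type \<open>'n\<close> with \<open>CARD('n) = N\<close>.
  \<open>Alpha i\<close>, \<open>Beta i\<close> are the symbols of \<open>\<Sigma>\<^sup>-\<close>, \<open>\<Sigma>\<^sup>+\<close>.\<close>

datatype 'n letter = Alpha 'n | Beta 'n

datatype 'a free_monoid = FM "'a list"

instantiation free_monoid :: (type) monoid_add
begin
definition zero_free_monoid :: "'a free_monoid" where "0 = FM []"
fun plus_free_monoid :: "'a free_monoid \<Rightarrow> 'a free_monoid \<Rightarrow> 'a free_monoid" where
  "FM u + FM v = FM (u @ v)"
instance
proof
  fix a b c :: "'a free_monoid"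
  show "a + b + c = a + (b + c)" by (cases a; cases b; cases c) simp
  show "0 + a = a" "a + 0 = a" by (cases a; simp add: zero_free_monoid_def)+
qed
end

text \<open>The monoid algebra over \<open>\<complex>\<close> of the free monoid over \<open>\<Sigma>\<close> is the free unital *-algebra on
  generators \<open>t\<^sub>i\<close>: the letter \<open>Beta i\<close> is \<open>t\<^sub>i\<close> and the letter \<open>Alpha i\<close> is its adjoint.\<close>

type_synonym 'n free_star_algebra = "'n letter free_monoid \<Rightarrow>\<^sub>0 complex"

fun adj_letter :: "'n letter \<Rightarrow> 'n letter" where
  "adj_letter (Alpha i) = Beta i"
| "adj_letter (Beta i) = Alpha i"

fun adj_word :: "'n letter free_monoid \<Rightarrow> 'n letter free_monoid" where
  "adj_word (FM w) = FM (rev (map adj_letter w))"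

text \<open>As \<open>adj_word\<close> is an involution, \<open>map_key\<close> (pullback of coefficients) is also the push-forward.\<close>

definition adj :: "'n free_star_algebra \<Rightarrow> 'n free_star_algebra" where
  "adj x = Poly_Mapping.map_key adj_word (Poly_Mapping.map cnj x)"

definition scal :: "complex \<Rightarrow> 'n free_star_algebra \<Rightarrow> 'n free_star_algebra" where
  "scal c x = Poly_Mapping.map ((*) c) x"

definition gen :: "'n \<Rightarrow> 'n free_star_algebra" where
  "gen i = Poly_Mapping.single (FM [Beta i]) 1"

lemma adj_letter_invol [simp]: "adj_letter (adj_letter a) = a"
  by (cases a) auto

lemma adj_word_invol [simp]: "adj_word (adj_word w) = w"
  by (cases w) (simp add: rev_map o_def)

lemma inj_adj_word: "inj adj_word"
  by (metis adj_word_invol injI)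

lemma adj_single: "adj (Poly_Mapping.single w c) = Poly_Mapping.single (adj_word w) (cnj c)"
  unfolding adj_def
  by (metis adj_word_invol complex_cnj_zero inj_adj_word map_key_single map_single)

lemma adj_gen: "adj (gen i) = Poly_Mapping.single (FM [Alpha i]) 1"
  by (simp add: gen_def adj_single)

section \<open>The Cuntz-Krieger algebra\<close>

definition cstar_seminorm :: "('n free_star_algebra \<Rightarrow> real) \<Rightarrow> bool" where
  "cstar_seminorm p \<longleftrightarrow>
     (\<forall>x. 0 \<le> p x) \<and>
     (\<forall>x y. p (x + y) \<le> p x + p y) \<and>
     (\<forall>c x. p (scal c x) = cmod c * p x) \<and>
     (\<forall>x y. p (x * y) \<le> p x * p y) \<and>
     (\<forall>x. p (adj x * x) = (p x)\<^sup>2)"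

definition ck_relations :: "nat^'n^'n \<Rightarrow> 'n::finite free_star_algebra set" where
  "ck_relations A =
     {gen i * adj (gen i) * gen i - gen i | i. True}
     \<union> {(\<Sum>j\<in>UNIV. gen j * adj (gen j)) - 1}
     \<union> {adj (gen i) * gen i - (\<Sum>j\<in>UNIV. of_nat (A $ i $ j) * (gen j * adj (gen j))) | i. True}"

text \<open>The universal C*-algebra \<open>\<O>\<^sub>A\<close> is the Hausdorff completion of the free *-algebra with respect to the
  largest C*-seminorm in which all relations hold, so an element of the free *-algebra is zero in
  \<open>\<O>\<^sub>A\<close> iff its \<open>ck_norm\<close> vanishes. The lemmas \<open>cstar_seminorm_ck_norm\<close>,
  \<open>ck_norm_relations\<close> and \<open>ck_norm_greatest\<close> below confirm that the supremum is this largest seminorm.\<close>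

definition ck_seminorms :: "nat^'n^'n \<Rightarrow> ('n::finite free_star_algebra \<Rightarrow> real) set" where
  "ck_seminorms A = {p. cstar_seminorm p \<and> (\<forall>r\<in>ck_relations A. p r = 0)}"

definition ck_norm :: "nat^'n^'n \<Rightarrow> 'n::finite free_star_algebra \<Rightarrow> real" where
  "ck_norm A x = (SUP p\<in>ck_seminorms A. p x)"

definition ck_zero :: "nat^'n^'n \<Rightarrow> 'n::finite free_star_algebra \<Rightarrow> bool" where
  "ck_zero A x \<longleftrightarrow> ck_norm A x = 0"

lemma zero_in_ck_seminorms: "(\<lambda>_. 0) \<in> ck_seminorms A"
  by (simp add: ck_seminorms_def cstar_seminorm_def)

lemma cstar_seminorm_one:
  fixes p :: "'n free_star_algebra \<Rightarrow> real"
  assumes "cstar_seminorm p" shows "p 1 \<le> 1"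
proof -
  have "adj (1::'n free_star_algebra) = 1"
    using adj_single[of 0 1] by (simp add: zero_free_monoid_def flip: single_one)
  then have "p 1 = (p 1)\<^sup>2"
    using assms unfolding cstar_seminorm_def by (metis mult_1)
  then show ?thesis
    by (metis power2_eq_square mult_cancel_left1 order_refl zero_le_one)
qed

lemma ck_seminorm_gen:
  assumes p: "p \<in> ck_seminorms A"
  shows "p (gen i) \<le> 1" "p (adj (gen i)) \<le> 1"
proof -
  have nn: "\<And>x. 0 \<le> p x" and tri: "\<And>x y. p (x + y) \<le> p x + p y"
    and sub: "\<And>x y. p (x * y) \<le> p x * p y" and cs: "\<And>x. p (adj x * x) = (p x)\<^sup>2"
    using p by (auto simp: ck_seminorms_def cstar_seminorm_def)
  let ?t = "gen i" and ?s = "adj (gen i)"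
  have aa: "adj ?s = ?t" by (simp add: adj_gen adj_single gen_def)
  have ae: "adj (?s * ?t) = ?s * ?t"
    by (simp add: adj_gen gen_def adj_single mult_single)
  have "p (?t * ?s * ?t - ?t) = 0"
    using p by (auto simp: ck_seminorms_def ck_relations_def)
  then have z: "p (?s * (?t * ?s * ?t - ?t)) \<le> 0"
    using sub[of ?s "?t * ?s * ?t - ?t"] by simp
  have "(p (?s * ?t))\<^sup>2 = p ((?s * ?t) * (?s * ?t))"
    using cs[of "?s * ?t"] ae by simp
  also have "(?s * ?t) * (?s * ?t) = ?s * (?t * ?s * ?t - ?t) + ?s * ?t"
    by (simp add: algebra_simps)
  also have "p \<dots> \<le> p (?s * ?t)"
    using tri[of "?s * (?t * ?s * ?t - ?t)" "?s * ?t"] z by simp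
  finally have "p (?s * ?t) \<le> 1"
    using nn[of "?s * ?t"] by (smt (verit) power2_eq_square mult_le_cancel_left2)
  then show 1: "p ?t \<le> 1"
    using cs[of ?t] by (simp add: power2_le_imp_le abs_square_le_1 nn)
  have "(p ?s)\<^sup>2 \<le> p ?t * p ?s" using cs[of ?s] sub[of ?t ?s] aa by simp
  also have "\<dots> \<le> 1 * p ?s" using 1 nn by (intro mult_right_mono) auto
  finally show "p ?s \<le> 1"
    using nn[of ?s] by (smt (verit) power2_eq_square mult_le_cancel_left2)
qed

lemma ck_seminorm_word:
  assumes p: "p \<in> ck_seminorms A"
  shows "p (Poly_Mapping.single (FM w) 1) \<le> 1"
proof (induction w)
  case Nil
  then show ?case
    using cstar_seminorm_one[of p] p by (simp add: ck_seminorms_def flip: zero_free_monoid_def)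
next
  case (Cons a w)
  have nn: "\<And>x. 0 \<le> p x" and sub: "\<And>x y. p (x * y) \<le> p x * p y"
    using p by (auto simp: ck_seminorms_def cstar_seminorm_def)
  have a: "p (Poly_Mapping.single (FM [a]) 1) \<le> 1"
    using ck_seminorm_gen[OF p] by (cases a) (auto simp: gen_def[symmetric] adj_gen)
  have "p (Poly_Mapping.single (FM (a # w)) 1)
      = p (Poly_Mapping.single (FM [a]) 1 * Poly_Mapping.single (FM w) 1)"
    by (simp add: mult_single)
  also have "\<dots> \<le> 1"
    using sub a Cons nn by (meson mult_le_one order_trans)
  finally show ?case .
qed

lemma ck_seminorms_bounded:
  fixes A :: "nat^'n^'n::finite"
  shows "\<exists>b. \<forall>p\<in>ck_seminorms A. p x \<le> b"
proof (induction x rule: Poly_Mapping.update_induct)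
  case const
  have "p 0 = 0" if "p \<in> ck_seminorms A" for p
  proof -
    have "p (scal 0 0) = cmod 0 * p 0"
      using that unfolding ck_seminorms_def cstar_seminorm_def by blast
    moreover have "scal 0 0 = (0 :: 'n free_star_algebra)"
      by (rule poly_mapping_eqI) (simp add: scal_def Poly_Mapping.map.rep_eq)
    ultimately show ?thesis by simp
  qed
  then show ?case by force
next
  case (update f k v)
  obtain w where k: "k = FM w" by (cases k)
  obtain b where b: "\<And>p. p \<in> ck_seminorms A \<Longrightarrow> p f \<le> b"
    using update by blast
  have split: "Poly_Mapping.update k v f = f + Poly_Mapping.single k v"
    using update(1)
    by (intro poly_mapping_eqI)
      (auto simp: lookup_update lookup_add lookup_single when_def in_keys_iff)
  have "p (Poly_Mapping.update k v f) \<le> b + cmod v" if p: "p \<in> ck_seminorms A" for p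
  proof -
    have "Poly_Mapping.single k v = scal v (Poly_Mapping.single k 1)"
      by (simp add: scal_def)
    then have "p (Poly_Mapping.single k v) = cmod v * p (Poly_Mapping.single k 1)"
      using p by (simp add: ck_seminorms_def cstar_seminorm_def)
    also have "\<dots> \<le> cmod v"
      using ck_seminorm_word[OF p, of w] k by (simp add: mult_left_le)
    finally have "p (Poly_Mapping.single k v) \<le> cmod v" .
    moreover have "p (f + Poly_Mapping.single k v) \<le> p f + p (Poly_Mapping.single k v)"
      using p by (simp add: ck_seminorms_def cstar_seminorm_def)
    ultimately show ?thesis using b[OF p] split by simp
  qed
  then show ?case by blast
qed

lemma ck_norm_greatest: "p \<in> ck_seminorms A \<Longrightarrow> p x \<le> ck_norm A x"
  unfolding ck_norm_def
  by (rule cSUP_upper) (use ck_seminorms_bounded[of A x] in \<open>auto simp: bdd_above_def\<close>)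

lemma ck_norm_least: "(\<And>p. p \<in> ck_seminorms A \<Longrightarrow> p x \<le> b) \<Longrightarrow> ck_norm A x \<le> b"
  unfolding ck_norm_def by (rule cSUP_least) (use zero_in_ck_seminorms in auto)

lemma ck_norm_nonneg: "0 \<le> ck_norm A x"
  using ck_norm_greatest[OF zero_in_ck_seminorms] .

lemma ck_norm_relations: "r \<in> ck_relations A \<Longrightarrow> ck_norm A r = 0"
  by (intro antisym ck_norm_nonneg ck_norm_least) (simp add: ck_seminorms_def)

lemma cstar_seminorm_ck_norm:
  fixes A :: "nat^'n^'n::finite"
  shows "cstar_seminorm (ck_norm A)"
  unfolding cstar_seminorm_def
proof (intro conjI allI)
  fix x y :: "'n free_star_algebra" and c
  note D = ck_seminorms_def cstar_seminorm_def
  show "0 \<le> ck_norm A x" by (rule ck_norm_nonneg)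
  show "ck_norm A (x + y) \<le> ck_norm A x + ck_norm A y"
  proof (rule ck_norm_least)
    fix p assume p: "p \<in> ck_seminorms A"
    have "p (x + y) \<le> p x + p y" using p by (simp add: D)
    also have "\<dots> \<le> ck_norm A x + ck_norm A y" using p by (intro add_mono ck_norm_greatest)
    finally show "p (x + y) \<le> ck_norm A x + ck_norm A y" .
  qed
  show "ck_norm A (x * y) \<le> ck_norm A x * ck_norm A y"
  proof (rule ck_norm_least)
    fix p assume p: "p \<in> ck_seminorms A"
    have "p (x * y) \<le> p x * p y" using p by (simp add: D)
    also have "\<dots> \<le> ck_norm A x * ck_norm A y"
      using p by (intro mult_mono ck_norm_greatest ck_norm_nonneg) (auto simp: D)
    finally show "p (x * y) \<le> ck_norm A x * ck_norm A y" .
  qed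
  show "ck_norm A (scal c x) = cmod c * ck_norm A x"
  proof (rule antisym)
    show "ck_norm A (scal c x) \<le> cmod c * ck_norm A x"
    proof (rule ck_norm_least)
      fix p assume p: "p \<in> ck_seminorms A"
      then have "p (scal c x) = cmod c * p x" by (simp add: D)
      then show "p (scal c x) \<le> cmod c * ck_norm A x"
        using ck_norm_greatest[OF p, of x] by (simp add: mult_left_mono)
    qed
    show "cmod c * ck_norm A x \<le> ck_norm A (scal c x)"
    proof (cases "c = 0")
      case True
      then show ?thesis by (simp add: ck_norm_nonneg)
    next
      case False
      have "ck_norm A x \<le> ck_norm A (scal c x) / cmod c"
      proof (rule ck_norm_least)
        fix p assume p: "p \<in> ck_seminorms A"
        then have "p (scal c x) = cmod c * p x" by (simp add: D)
        then show "p x \<le> ck_norm A (scal c x) / cmod c"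
          using ck_norm_greatest[OF p, of "scal c x"] False by (simp add: field_simps)
      qed
      then show ?thesis using False by (simp add: field_simps)
    qed
  qed
  show "ck_norm A (adj x * x) = (ck_norm A x)\<^sup>2"
  proof (rule antisym)
    show "ck_norm A (adj x * x) \<le> (ck_norm A x)\<^sup>2"
    proof (rule ck_norm_least)
      fix p assume p: "p \<in> ck_seminorms A"
      then have "p (adj x * x) = (p x)\<^sup>2" by (simp add: D)
      also have "\<dots> \<le> (ck_norm A x)\<^sup>2"
        using p by (intro power_mono ck_norm_greatest) (auto simp: D)
      finally show "p (adj x * x) \<le> (ck_norm A x)\<^sup>2" .
    qed
    have "ck_norm A x \<le> sqrt (ck_norm A (adj x * x))"
    proof (rule ck_norm_least)
      fix p assume p: "p \<in> ck_seminorms A"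
      then have "(p x)\<^sup>2 \<le> ck_norm A (adj x * x)"
        using ck_norm_greatest[OF p, of "adj x * x"] by (simp add: D)
      then show "p x \<le> sqrt (ck_norm A (adj x * x))" by (rule real_le_rsqrt)
    qed
    then have "(ck_norm A x)\<^sup>2 \<le> (sqrt (ck_norm A (adj x * x)))\<^sup>2"
      by (intro power_mono ck_norm_nonneg)
    then show "(ck_norm A x)\<^sup>2 \<le> ck_norm A (adj x * x)"
      by (simp add: ck_norm_nonneg)
  qed
qed

section \<open>The Markov-Dyck shift\<close>

definition essential :: "nat^'n^'n \<Rightarrow> bool" where
  "essential A \<longleftrightarrow> (\<forall>i. \<exists>j. A $ i $ j \<noteq> 0) \<and> (\<forall>j. \<exists>i. A $ i $ j \<noteq> 0)"

fun phi :: "'n letter \<Rightarrow> 'n free_star_algebra" where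
  "phi (Alpha i) = adj (gen i)"
| "phi (Beta i) = gen i"

definition forbidden :: "nat^'n^'n \<Rightarrow> 'n::finite letter list \<Rightarrow> bool" where
  "forbidden A w \<longleftrightarrow> ck_zero A (prod_list (map phi w))"

definition occurs_in :: "'a list \<Rightarrow> (int \<Rightarrow> 'a) \<Rightarrow> bool" where
  "occurs_in w x \<longleftrightarrow> (\<exists>k. \<forall>m<length w. x (k + int m) = w ! m)"

definition markov_dyck_shift :: "nat^'n^'n \<Rightarrow> (int \<Rightarrow> 'n::finite letter) set" where
  "markov_dyck_shift A = {x. \<forall>w. occurs_in w x \<longrightarrow> \<not> forbidden A w}"

definition admissible :: "nat^'n^'n \<Rightarrow> 'n::finite letter list \<Rightarrow> bool" where
  "admissible A w \<longleftrightarrow> (\<exists>x\<in>markov_dyck_shift A. occurs_in w x)"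

section \<open>Zeta functions\<close>

definition left_shift :: "(int \<Rightarrow> 'a) \<Rightarrow> int \<Rightarrow> 'a" where
  "left_shift x = (\<lambda>k. x (k + 1))"

definition periodic_points :: "nat \<Rightarrow> (int \<Rightarrow> 'a) set \<Rightarrow> (int \<Rightarrow> 'a) set" where
  "periodic_points n C = {x\<in>C. (left_shift ^^ n) x = x}"

definition zeta_fps :: "(int \<Rightarrow> 'a) set \<Rightarrow> real fps" where
  "zeta_fps C = fps_compose (fps_exp 1)
     (Abs_fps (\<lambda>n. if n = 0 then 0 else real (card (periodic_points n C)) / real n))"

section \<open>Dyck words and the associated codes\<close>

definition neg_count :: "'n letter list \<Rightarrow> nat" where
  "neg_count w = length (filter (\<lambda>a. \<exists>i. a = Alpha i) w)"

definition pos_count :: "'n letter list \<Rightarrow> nat" where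
  "pos_count w = length (filter (\<lambda>a. \<exists>i. a = Beta i) w)"

definition dyck_words :: "nat^'n^'n \<Rightarrow> nat \<Rightarrow> 'n::finite letter list set" where
  "dyck_words A n = {w. length w = 2 * n \<and> admissible A w \<and>
     (\<forall>m\<le>length w. pos_count (take m w) \<le> neg_count (take m w)) \<and>
     neg_count w = pos_count w}"

definition dyck_words_at :: "nat^'n^'n \<Rightarrow> nat \<Rightarrow> 'n \<Rightarrow> 'n::finite letter list set" where
  "dyck_words_at A n i = (if n = 0 then {[]}
     else {w \<in> dyck_words A n. Alpha i # w @ [Beta i] \<in> dyck_words A (n + 1)})"

definition dyck_fps :: "nat^'n^'n \<Rightarrow> 'n::finite \<Rightarrow> real fps" where
  "dyck_fps A i = Abs_fps (\<lambda>n. real (card (dyck_words_at A n i)))"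

definition dyck_fps_sq :: "nat^'n^'n \<Rightarrow> 'n::finite \<Rightarrow> real fps" where
  "dyck_fps_sq A i = fps_compose (dyck_fps A i) (fps_X ^ 2)"

definition dyck_code :: "nat^'n^'n \<Rightarrow> 'n set \<Rightarrow> 'n::finite letter list set" where
  "dyck_code A J = {Alpha i # w @ [Beta i] | n i w.
     n \<ge> 1 \<and> (\<forall>j\<in>J. A $ i $ j = 1) \<and> w \<in> dyck_words_at A (n - 1) i}"

text \<open>\<open>s\<close> lists the positions at which consecutive code words begin. For a code of nonempty words,
  such as \<open>dyck_code A J\<close>, strictness of \<open>s\<close> is automatic and makes the blocks
  \<open>[s k, s (k + 1))\<close> cover all of \<open>\<int>\<close>.\<close>

definition bi_infinite_concats :: "'a list set \<Rightarrow> (int \<Rightarrow> 'a) set" where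
  "bi_infinite_concats W =
     {x. \<exists>s::int \<Rightarrow> int. strict_mono s \<and> (\<forall>k. map x [s k..s (k + 1) - 1] \<in> W)}"

definition dyck_code_union :: "nat^'n^'n \<Rightarrow> (int \<Rightarrow> 'n::finite letter) set" where
  "dyck_code_union A = (\<Union>J\<in>{J. J \<noteq> {}}. bi_infinite_concats (dyck_code A J))"

end

theory Submission
  imports Defs
begin

text \<open>A word is nonzero in the Cuntz-Krieger algebra iff its partial isometry on the space of infinite
  paths is nonzero: one direction is the representation on \<open>\<ell>\<^sup>2\<close> of that space, the other multiplies the
  word by \<open>1 = \<Sum>\<^sub>\<mu> t\<^sub>\<mu> t\<^sub>\<mu>\<^sup>*\<close> over long \<open>\<mu>\<close> and reduces. A Dyck word then acts as the identity on the
  paths whose initial vertex is compatible with all its outermost arches.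

  Weigh \<open>Alpha\<close> by \<open>1\<close> and \<open>Beta\<close> by \<open>-1\<close>. The partial sums of a periodic point return to their start,
  decrease or increase over a period. In the first case the point is cut at its minima into arches and
  lies in \<open>C\<^sup>A[{j}]\<^sup>\<infinity>\<close> for some \<open>j\<close>; as \<open>C\<^sup>A[J]\<^sup>\<infinity>\<close> is the intersection of these sets, inclusion-exclusion
  applies. In the second case it is cut at its record minima into blocks \<open>w \<beta>\<^sub>j\<close> that follow the edges of
  \<open>A\<close>, and the third is the mirror image, so both contribute \<open>1 / det (I - diag(f) z A)\<close>. For a coded
  shift with unique cuts, the logarithmic derivative of the zeta function is
  \<open>trace (M' (I - M)\<^sup>-\<^sup>1)\<close> for the matrix \<open>M\<close> of block generating functions, hence the zeta function is
  \<open>1 / det (I - M)\<close>.\<close>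

section \<open>Determinants over formal power series and zeta functions of counting sequences\<close>

text \<open>Orthogonality of the range projections is not among the defining relations; it has to be
  extracted from their sum being 1. That is a statement about positivity, while only a seminorm with
  the C*-identity on the free *-algebra is at hand. The algebra is therefore carried by norm
  estimates, and its whole outcome is the equivalence of \<open>forbidden\<close> with not
  \<open>live\<close>. On the combinatorial side the decisive hypothesis is that a sequence has at
  most one cut set. It is always verified by describing the cuts through the height function alone.
  For arches this description does not mention J, so intersecting the shifts amounts to intersecting
  the sets of blocks. A single vertex j suffices for a whole balanced point for this reason: the
  word of one period acts on some path, every Dyck segment leaves that path unchanged, and so all
  arches of the period are tested against the same initial vertex.\<close>

lemma fps_deriv_prod:
  fixes f :: "'b \<Rightarrow> 'a::comm_ring_1 fps"
  assumes "finite S"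
  shows "fps_deriv (\<Prod>i\<in>S. f i) = (\<Sum>k\<in>S. \<Prod>i\<in>S. if i = k then fps_deriv (f i) else f i)"
  using assms
proof (induction S rule: finite_induct)
  case (insert a S)
  have "(\<Prod>i\<in>S. if i = a then fps_deriv (f i) else f i) = prod f S"
    using insert.hyps by (intro prod.cong) auto
  moreover have "(\<Sum>k\<in>S. \<Prod>i\<in>insert a S. if i = k then fps_deriv (f i) else f i)
      = (\<Sum>k\<in>S. f a * (\<Prod>i\<in>S. if i = k then fps_deriv (f i) else f i))"
    using insert.hyps by (intro sum.cong) auto
  ultimately show ?case
    using insert by (simp add: sum_distrib_left)
qed simp

lemma fps_deriv_det:
  fixes X :: "'a::comm_ring_1 fps^'n^'n"
  shows "fps_deriv (det X)
    = (\<Sum>k\<in>UNIV. det (\<chi> i. if i = k then (\<chi> j. fps_deriv (X $ k $ j)) else X $ i))"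
proof -
  have *: "fps_deriv (of_int (sign p) * (\<Prod>i\<in>UNIV. X $ i $ p i))
      = (\<Sum>k\<in>UNIV. of_int (sign p) *
          (\<Prod>i\<in>UNIV. (\<chi> i. if i = k then (\<chi> j. fps_deriv (X $ k $ j)) else X $ i) $ i $ p i))" for p
  proof -
    have "fps_deriv (\<Prod>i\<in>UNIV. X $ i $ p i)
      = (\<Sum>k\<in>UNIV. \<Prod>i\<in>UNIV. (\<chi> i. if i = k then (\<chi> j. fps_deriv (X $ k $ j)) else X $ i) $ i $ p i)"
      by (subst fps_deriv_prod) (auto intro!: sum.cong prod.cong)
    then show ?thesis by (simp add: sum_distrib_left)
  qed
  show ?thesis
    unfolding det_def fps_deriv_sum *
    by (rule sum.swap)
qed

text \<open>Expand row \<open>k\<close> by linearity: every term with \<open>l \<noteq> k\<close>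
  repeats a row and vanishes.\<close>

lemma det_replace_row:
  fixes X :: "'a::comm_ring_1^'n^'n"
  shows "det (\<chi> i. if i = k then (\<Sum>l\<in>UNIV. c l *s X $ l) else X $ i) = c k * det X"
proof -
  have "det (\<chi> i. if i = k then (\<Sum>l\<in>UNIV. c l *s X $ l) else X $ i)
      = (\<Sum>l\<in>UNIV. c l * det (\<chi> i. if i = k then X $ l else X $ i))"
    by (subst det_linear_row_sum) (simp_all add: det_row_mul)
  also have "\<dots> = (\<Sum>l\<in>UNIV. if l = k then c k * det X else 0)"
  proof (intro sum.cong refl)
    fix l
    have "det (\<chi> i. if i = k then X $ l else X $ i) = 0" if "l \<noteq> k"
      using that by (intro det_identical_rows[of l k]) (auto simp: row_def vec_eq_iff)
    moreover have "(\<chi> i. if i = k then X $ k else X $ i) = X"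
      by (simp add: vec_eq_iff)
    ultimately show "c l * det (\<chi> i. if i = k then X $ l else X $ i) = (if l = k then c k * det X else 0)"
      by auto
  qed
  finally show ?thesis by simp
qed

text \<open>Jacobi's formula, with the logarithmic derivative \<open>Y\<close> of \<open>X\<close> in place of the adjugate.\<close>

lemma fps_deriv_det_eq_trace:
  fixes X Y :: "'a::comm_ring_1 fps^'n^'n"
  assumes "\<And>i j. fps_deriv (X $ i $ j) = (\<Sum>l\<in>UNIV. Y $ i $ l * X $ l $ j)"
  shows "fps_deriv (det X) = trace Y * det X"
proof -
  have "det (\<chi> i. if i = k then (\<chi> j. fps_deriv (X $ k $ j)) else X $ i) = Y $ k $ k * det X" for k
  proof -
    have "(\<chi> j. fps_deriv (X $ k $ j)) = (\<Sum>l\<in>UNIV. Y $ k $ l *s X $ l)"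
      by (simp add: vec_eq_iff assms)
    then show ?thesis by (simp only: det_replace_row[of k "\<lambda>l. Y $ k $ l" X])
  qed
  then show ?thesis
    by (simp add: fps_deriv_det trace_def sum_distrib_right)
qed

text \<open>The equation makes \<open>K\<close> a right inverse of \<open>mat 1 - M\<close>, whereas
  \<open>fps_deriv_det_eq_trace\<close> wants the logarithmic derivative as a left factor. Passing
  to transposes exchanges the two sides, and neither the determinant nor the trace notices.\<close>

lemma fps_deriv_det_one_minus:
  fixes M K :: "'a::comm_ring_1 fps^'n^'n"
  assumes K: "K = mat 1 + M ** K"
  shows "fps_deriv (det (mat 1 - M))
    = - (\<Sum>i\<in>UNIV. \<Sum>j\<in>UNIV. fps_deriv (M $ i $ j) * K $ j $ i) * det (mat 1 - M)"
proof -
  let ?X = "mat 1 - M"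
  let ?D = "\<chi> i j. fps_deriv (M $ i $ j)"
  let ?Y = "transpose (K ** - ?D)"
  have XK: "?X ** K = mat 1"
  proof -
    have "?X ** K = K - M ** K"
      by (simp add: vec_eq_iff matrix_matrix_mult_def mat_def left_diff_distrib sum_subtractf
          if_distrib[where f = "\<lambda>a. a * _"] cong: if_cong)
    then show ?thesis using K by (metis add_diff_cancel_right')
  qed
  have "?X ** (K ** - ?D) = - ?D"
    by (simp add: matrix_mul_assoc XK)
  then have YX: "transpose (- ?D) = ?Y ** transpose ?X"
    by (metis matrix_transpose_mul)
  have "fps_deriv (transpose ?X $ i $ j) = (\<Sum>l\<in>UNIV. ?Y $ i $ l * transpose ?X $ l $ j)" for i j
  proof -
    have "fps_deriv (transpose ?X $ i $ j) = transpose (- ?D) $ i $ j"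
      by (simp add: transpose_def mat_def)
    also have "\<dots> = (?Y ** transpose ?X) $ i $ j"
      using YX by simp
    finally show ?thesis by (simp only: matrix_matrix_mult_def vec_lambda_beta)
  qed
  then have "fps_deriv (det (transpose ?X)) = trace ?Y * det (transpose ?X)"
    by (rule fps_deriv_det_eq_trace)
  moreover have "trace ?Y = - (\<Sum>i\<in>UNIV. \<Sum>j\<in>UNIV. fps_deriv (M $ i $ j) * K $ j $ i)"
    unfolding trace_def transpose_def matrix_matrix_mult_def
    by (subst sum.swap) (simp add: sum_negf mult.commute)
  ultimately show ?thesis by (simp add: det_transpose)
qed

section \<open>Zeta functions attached to arbitrary real counting sequences\<close>

definition zeta_of_counts :: "(nat \<Rightarrow> real) \<Rightarrow> real fps" where
  "zeta_of_counts p = fps_compose (fps_exp 1) (Abs_fps (\<lambda>n. if n = 0 then 0 else p n / real n))"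

lemma zeta_fps_eq: "zeta_fps C = zeta_of_counts (\<lambda>n. real (card (periodic_points n C)))"
  by (simp add: zeta_fps_def zeta_of_counts_def)

lemma zeta_of_counts_cong: "(\<And>n. n > 0 \<Longrightarrow> p n = q n) \<Longrightarrow> zeta_of_counts p = zeta_of_counts q"
  unfolding zeta_of_counts_def by (intro arg_cong[where f = "fps_compose _"]) (auto simp: fps_eq_iff)

text \<open>The logarithmic derivative of \<open>zeta_of_counts p\<close>: the coefficient
  \<open>p n / n\<close> loses its denominator and moves down by one place.\<close>

definition log_counts :: "(nat \<Rightarrow> real) \<Rightarrow> real fps" where
  "log_counts p = Abs_fps (\<lambda>n. p (Suc n))"

lemma zeta_of_counts_nth_0: "fps_nth (zeta_of_counts p) 0 = 1"
  by (simp add: zeta_of_counts_def)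

lemma zeta_of_counts_deriv: "fps_deriv (zeta_of_counts p) = zeta_of_counts p * log_counts p"
proof -
  have "fps_deriv (Abs_fps (\<lambda>n. if n = 0 then 0 else p n / real n)) = log_counts p"
    by (auto simp: fps_eq_iff log_counts_def)
  then show ?thesis
    unfolding zeta_of_counts_def by (subst fps_compose_deriv) simp_all
qed

text \<open>The product has derivative 0 and constant term 1. Identities between zeta functions
  thereby reduce to linear identities between counts.\<close>

lemma zeta_of_counts_mult_eq_1:
  assumes "fps_nth g 0 = 1" and "fps_deriv g = - (log_counts p * g)"
  shows "zeta_of_counts p * g = 1"
proof -
  have "fps_deriv (zeta_of_counts p * g) = 0"
    using assms(2) by (simp add: zeta_of_counts_deriv)
  then have "zeta_of_counts p * g = fps_const (fps_nth (zeta_of_counts p * g) 0)"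
    unfolding fps_deriv_eq_0_iff .
  then show ?thesis
    using assms(1) by (simp add: zeta_of_counts_nth_0)
qed

text \<open>Negative counts occur in the signed sums of inclusion-exclusion, which is why counts are
  real numbers.\<close>

lemma zeta_of_counts_uminus: "zeta_of_counts (\<lambda>n. - p n) = inverse (zeta_of_counts p)"
proof -
  have "log_counts (\<lambda>n. - p n) = - log_counts p"
    by (simp add: log_counts_def fps_eq_iff)
  then have "zeta_of_counts p * zeta_of_counts (\<lambda>n. - p n) = 1"
    by (intro zeta_of_counts_mult_eq_1) (simp_all add: zeta_of_counts_nth_0 zeta_of_counts_deriv)
  then show ?thesis
    by (metis fps_inverse_unique mult.commute)
qed

lemma zeta_of_counts_add:
  "zeta_of_counts (\<lambda>n. p n + q n) = zeta_of_counts p * zeta_of_counts q"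
proof -
  have [simp]: "log_counts (\<lambda>n. - p n) = - log_counts p" for p
    by (simp add: log_counts_def fps_eq_iff)
  have "log_counts (\<lambda>n. p n + q n) = log_counts p + log_counts q"
    by (simp add: log_counts_def fps_eq_iff)
  then have "zeta_of_counts (\<lambda>n. p n + q n) * (zeta_of_counts (\<lambda>n. - p n) * zeta_of_counts (\<lambda>n. - q n)) = 1"
    by (intro zeta_of_counts_mult_eq_1)
      (simp_all add: zeta_of_counts_nth_0 zeta_of_counts_deriv algebra_simps)
  moreover have "inverse p * p = 1" if "fps_nth p 0 = 1" for p :: "real fps"
    using that by (simp add: inverse_mult_eq_1)
  ultimately show ?thesis
    unfolding zeta_of_counts_uminus
    by (smt (verit) mult.assoc mult.commute mult_1 zeta_of_counts_nth_0)
qed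

lemma zeta_of_counts_sum:
  assumes "finite S"
  shows "zeta_of_counts (\<lambda>n. \<Sum>i\<in>S. p i n) = (\<Prod>i\<in>S. zeta_of_counts (p i))"
  using assms
proof (induction S rule: finite_induct)
  case empty
  show ?case by (simp add: zeta_of_counts_def fps_compose_0_right
      fps_zero_def[symmetric] cong: if_cong)
next
  case (insert a S)
  then show ?case by (simp add: zeta_of_counts_add)
qed

lemma fps_nth_compose_X_square:
  fixes f :: "'a::comm_ring_1 fps"
  shows "fps_nth (fps_compose f (fps_X\<^sup>2)) n = (if even n then fps_nth f (n div 2) else 0)"
proof -
  have "fps_nth (fps_compose f (fps_X\<^sup>2)) n = (\<Sum>i=0..n. if n = 2 * i then fps_nth f i else 0)"
    by (auto simp: fps_compose_nth fps_X_power_nth power_mult[symmetric] intro!: sum.cong)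
  also have "\<dots> = (\<Sum>i=0..n. if i = n div 2 then (if even n then fps_nth f i else 0) else 0)"
    by (intro sum.cong) auto
  finally show ?thesis by simp
qed

section \<open>Coded shifts of labelled block graphs\<close>

definition segment :: "(int \<Rightarrow> 'a) \<Rightarrow> int \<Rightarrow> int \<Rightarrow> 'a list" where
  "segment x a b = map x [a..b - 1]"

lemma length_segment [simp]: "length (segment x a b) = nat (b - a)"
  by (simp add: segment_def)

lemma segment_empty [simp]: "b \<le> a \<Longrightarrow> segment x a b = []"
  by (simp add: segment_def)

lemma nth_segment: "m < nat (b - a) \<Longrightarrow> segment x a b ! m = x (a + int m)"
  by (simp add: segment_def)

lemma segment_append: "a \<le> b \<Longrightarrow> b \<le> c \<Longrightarrow> segment x a c = segment x a b @ segment x b c"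
  by (rule nth_equalityI) (auto simp: nth_segment nth_append ac_simps)

lemma last_segment: "a < b \<Longrightarrow> last (segment x a b) = x (b - 1)"
  by (simp add: segment_def upto_rec2)

lemma segment_shift: "segment (\<lambda>k. x (k + c)) a b = segment x (a + c) (b + c)"
  by (rule nth_equalityI) (auto simp: nth_segment algebra_simps)

lemma left_shift_funpow: "(left_shift ^^ n) x = (\<lambda>k. x (k + int n))"
  by (induction n) (auto simp: left_shift_def fun_eq_iff algebra_simps)

lemma periodic_points_iff:
  "x \<in> periodic_points n C \<longleftrightarrow> x \<in> C \<and> (\<forall>k. x (k + int n) = x k)"
  by (simp add: periodic_points_def left_shift_funpow fun_eq_iff)

lemma periodic_mult:
  fixes x :: "int \<Rightarrow> 'a"
  assumes "\<And>k. x (k + n) = x k"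
  shows "x (k + q * n) = x k"
proof (induction q rule: int_induct[of _ 0])
  case (step1 i)
  then show ?case using assms[of "k + i * n"] by (simp add: algebra_simps)
next
  case (step2 i)
  then show ?case using assms[of "k + (i - 1) * n"] by (simp add: algebra_simps)
qed simp

definition periodic_extension :: "'a list \<Rightarrow> int \<Rightarrow> 'a" where
  "periodic_extension w = (\<lambda>k. w ! nat (k mod int (length w)))"

lemma periodic_extension_periodic: "periodic_extension w (k + int (length w)) = periodic_extension w k"
  by (simp add: periodic_extension_def)

lemma segment_periodic_extension: "segment (periodic_extension w) 0 (int (length w)) = w"
  by (rule nth_equalityI) (auto simp: nth_segment periodic_extension_def)

lemma periodic_extension_segment:
  assumes "\<And>k. x (k + int n) = x k" "n > 0"
  shows "periodic_extension (segment x a (a + int n)) k = x (a + k)"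
proof -
  have "x (a + k mod int n) = x (a + k mod int n + (k div int n) * int n)"
    using periodic_mult[of x "int n"] assms(1) by metis
  also have "\<dots> = x (a + k)"
    by (simp add: algebra_simps)
  finally show ?thesis
    using assms(2) by (simp add: periodic_extension_def nth_segment nat_less_iff)
qed

section \<open>Sets of cut positions in the integers\<close>

definition consecutive :: "int set \<Rightarrow> int \<Rightarrow> int \<Rightarrow> bool" where
  "consecutive S k k' \<longleftrightarrow> k \<in> S \<and> k' \<in> S \<and> k < k' \<and> (\<forall>m\<in>S. \<not> (k < m \<and> m < k'))"

definition unbounded :: "int set \<Rightarrow> bool" where
  "unbounded S \<longleftrightarrow> (\<forall>k. (\<exists>m\<in>S. m \<le> k) \<and> (\<exists>m\<in>S. k \<le> m))"

lemma ex_greatest_le: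
  fixes m :: int
  assumes "s \<in> S" "s \<le> m"
  shows "\<exists>a\<in>S. a \<le> m \<and> (\<forall>k\<in>S. k \<le> m \<longrightarrow> k \<le> a)"
proof -
  let ?P = "\<lambda>d. m - int d \<in> S"
  have "?P (nat (m - s))" using assms by simp
  then have 1: "?P (LEAST d. ?P d)" by (rule LeastI)
  have 2: "(LEAST d. ?P d) \<le> nat (m - k)" if "k \<in> S" "k \<le> m" for k
    using that by (intro Least_le) simp
  show ?thesis
    by (rule bexI[OF _ 1]) (use 2 in force)
qed

lemma ex_least_greater:
  fixes m :: int
  assumes "s \<in> S" "m < s"
  shows "\<exists>a\<in>S. m < a \<and> (\<forall>k\<in>S. m < k \<longrightarrow> a \<le> k)"
proof -
  have "\<exists>a\<in>uminus ` S. a \<le> - m - 1 \<and> (\<forall>k\<in>uminus ` S. k \<le> - m - 1 \<longrightarrow> k \<le> a)"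
    using ex_greatest_le[of "- s" "uminus ` S" "- m - 1"] assms by auto
  then show ?thesis by force
qed

lemma ex_consecutive_from:
  assumes "a \<in> S" "b \<in> S" "a < b"
  shows "\<exists>a'. consecutive S a a' \<and> a' \<le> b"
  using ex_least_greater[of b S a] assms by (fastforce simp: consecutive_def)

lemma ex_consecutive_around:
  assumes "unbounded S"
  shows "\<exists>a b. consecutive S a b \<and> a \<le> m \<and> m < b"
proof -
  obtain s s' where "s \<in> S" "s \<le> m" "s' \<in> S" "m + 1 \<le> s'"
    using assms unfolding unbounded_def by meson
  then obtain a b where "a\<in>S" "a \<le> m" "\<forall>k\<in>S. k \<le> m \<longrightarrow> k \<le> a"
    "b\<in>S" "m < b" "\<forall>k\<in>S. m < k \<longrightarrow> b \<le> k"
    using ex_greatest_le[of s S m] ex_least_greater[of s' S m] by force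
  then show ?thesis
    by (intro exI[of _ a] exI[of _ b]) (force simp: consecutive_def)
qed

text \<open>Adding one cut in front creates exactly one new gap, the one from \<open>a\<close> to
  the former first cut \<open>b\<close>. This is the step that prepends a block to a
  decomposition.\<close>

lemma consecutive_insert_least:
  assumes "\<And>t. t \<in> T \<Longrightarrow> b \<le> t" "b \<in> T" "a < b" and kk: "consecutive (insert a T) k k'"
  shows "k = a \<and> k' = b \<or> consecutive T k k'"
proof (cases "k = a")
  case True
  then have "k' \<in> T" "\<not> (a < b \<and> b < k')"
    using kk assms(2) by (auto simp: consecutive_def)
  then show ?thesis using True assms(1)[of k'] assms(3) by auto
next
  case False
  then have "k \<in> T" using kk by (auto simp: consecutive_def)
  then have "a < k" using assms(1)[of k] assms(3) by simp
  then have "k' \<noteq> a" using kk by (auto simp: consecutive_def)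
  then show ?thesis using False kk by (auto simp: consecutive_def)
qed

lemma consecutive_unique:
  assumes "consecutive S a b" "consecutive S a' b'" "a \<le> m" "m < b" "a' \<le> m" "m < b'"
  shows "a = a'" "b = b'"
proof -
  have "\<not> (a < a' \<and> a' < b)" "\<not> (a' < a \<and> a < b')" "\<not> (a < b' \<and> b' < b)" "\<not> (a' < b \<and> b < b')"
    using assms(1,2) unfolding consecutive_def by blast+
  then show "a = a'" "b = b'" using assms(3-6) by linarith+
qed

lemma unbounded_periodic:
  assumes "s \<in> S" "\<And>k. k \<in> S \<Longrightarrow> k + n \<in> S" "\<And>k. k \<in> S \<Longrightarrow> k - n \<in> S" "0 < n"
  shows "unbounded S"
proof -
  have up: "s + int d * n \<in> S" and down: "s - int d * n \<in> S" for d
  proof (induction d)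
    case (Suc d)
    {
      case 1
      then show ?case using assms(2)[OF Suc(1)] by (simp add: algebra_simps)
    next
      case 2
      then show ?case using assms(3)[OF Suc(2)] by (simp add: algebra_simps)
    }
  qed (use assms(1) in auto)
  have le: "d \<le> d * n" if "0 \<le> d" for d
    using that assms(4) mult_left_mono[of 1 n d] by simp
  show ?thesis
    unfolding unbounded_def
  proof (intro allI conjI)
    fix k
    show "\<exists>m\<in>S. m \<le> k"
      by (rule bexI[OF _ down[of "nat \<bar>s - k\<bar>"]]) (use le[of "\<bar>s - k\<bar>"] in auto)
    show "\<exists>m\<in>S. k \<le> m"
      by (rule bexI[OF _ up[of "nat \<bar>k - s\<bar>"]]) (use le[of "\<bar>k - s\<bar>"] in auto)
  qed
qed

section \<open>Decompositions of sequences into blocks along walks in a graph\<close>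

lemma unbounded_shift:
  assumes "unbounded S"
  shows "unbounded {k. k + c \<in> S}"
  unfolding unbounded_def
proof (intro allI conjI)
  fix k
  obtain m m' where m: "m \<in> S" "m \<le> k + c" "m' \<in> S" "k + c \<le> m'"
    using assms unfolding unbounded_def by meson
  show "\<exists>m\<in>{k. k + c \<in> S}. m \<le> k" by (rule bexI[of _ "m - c"]) (use m in auto)
  show "\<exists>m\<in>{k. k + c \<in> S}. k \<le> m" by (rule bexI[of _ "m' - c"]) (use m in auto)
qed

text \<open>The vertex at a cut is read off the letter just before it, so a decomposition is nothing
  but its cut set. Uniqueness of decompositions can then be stated as equality of sets of
  integers.\<close>

definition decomposes :: "('v \<Rightarrow> 'v \<Rightarrow> 'a list set) \<Rightarrow> ('a \<Rightarrow> 'v) \<Rightarrow> (int \<Rightarrow> 'a) \<Rightarrow> int set \<Rightarrow> bool" where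
  "decomposes W lab x S \<longleftrightarrow> unbounded S \<and>
     (\<forall>k k'. consecutive S k k' \<longrightarrow> segment x k k' \<in> W (lab (x (k - 1))) (lab (x (k' - 1))))"

definition coded_shift :: "('v \<Rightarrow> 'v \<Rightarrow> 'a list set) \<Rightarrow> ('a \<Rightarrow> 'v) \<Rightarrow> (int \<Rightarrow> 'a) set" where
  "coded_shift W lab = {x. \<exists>S. decomposes W lab x S}"

lemma decomposes_shift:
  assumes "decomposes W lab x S"
  shows "decomposes W lab (\<lambda>k. x (k + c)) {k. k + c \<in> S}"
proof -
  have *: "consecutive S (k + c) (k' + c)" if "consecutive {k. k + c \<in> S} k k'" for k k'
    unfolding consecutive_def
  proof (intro conjI ballI)
    fix m assume "m \<in> S"
    then have "m - c \<in> {k. k + c \<in> S}" by simp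
    then have "\<not> (k < m - c \<and> m - c < k')" using that unfolding consecutive_def by blast
    then show "\<not> (k + c < m \<and> m < k' + c)" by linarith
  qed (use that in \<open>auto simp: consecutive_def\<close>)
  have **: "k - 1 + c = k + c - 1" for k by simp
  show ?thesis
    using assms * unbounded_shift[of S c] unfolding decomposes_def segment_shift ** by blast
qed

inductive path_word :: "('v \<Rightarrow> 'v \<Rightarrow> 'a list set) \<Rightarrow> 'v \<Rightarrow> 'v \<Rightarrow> 'a list \<Rightarrow> bool" for W where
  Nil: "path_word W i i []"
| Append: "b \<in> W i j \<Longrightarrow> path_word W j k u \<Longrightarrow> path_word W i k (b @ u)"

lemma path_word_segment:
  assumes "decomposes W lab x S" "a \<in> S" "b \<in> S" "a \<le> b"
  shows "path_word W (lab (x (a - 1))) (lab (x (b - 1))) (segment x a b)"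
  using assms(2-4)
proof (induction "nat (b - a)" arbitrary: a rule: less_induct)
  case less
  show ?case
  proof (cases "a = b")
    case True
    then show ?thesis by (simp add: path_word.Nil)
  next
    case False
    then obtain a' where a': "consecutive S a a'" "a' \<le> b"
      using ex_consecutive_from[of a S b] less by auto
    then have "a < a'" "a' \<in> S" by (auto simp: consecutive_def)
    then have "path_word W (lab (x (a' - 1))) (lab (x (b - 1))) (segment x a' b)"
      using less a' by auto
    moreover have "segment x a a' \<in> W (lab (x (a - 1))) (lab (x (a' - 1)))"
      using a' assms(1) by (auto simp: decomposes_def)
    ultimately show ?thesis
      using segment_append[of a a' b x] \<open>a < a'\<close> a'(2) by (auto intro: path_word.Append)
  qed
qed

text \<open>\<open>prefix_code\<close> together with \<open>lab_last\<close> makes the walk behind a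
  finite word unique once its starting vertex is fixed. This does not settle where a two-sided
  sequence is to be cut (a sequence with constant letters can be cut into pairs in two ways), hence
  the separate assumption \<open>decomposes_unique\<close>.\<close>

locale block_graph =
  fixes W :: "'v::finite \<Rightarrow> 'v \<Rightarrow> 'a::finite list set" and lab :: "'a \<Rightarrow> 'v"
  assumes block_nonempty: "b \<in> W i j \<Longrightarrow> b \<noteq> []"
    and lab_last: "b \<in> W i j \<Longrightarrow> lab (last b) = j"
    and prefix_code: "b \<in> W i j \<Longrightarrow> b' \<in> W i j' \<Longrightarrow> b @ u = b' @ u' \<Longrightarrow> b = b'"
    and decomposes_unique: "decomposes W lab x S \<Longrightarrow> decomposes W lab x S' \<Longrightarrow> S = S'"
begin

lemma lab_last_path_word:
  assumes "path_word W i j w"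
  shows "w = [] \<and> i = j \<or> w \<noteq> [] \<and> lab (last w) = j"
  using assms by induction (auto simp: lab_last block_nonempty)

text \<open>The translate of a cut set by a period cuts the same sequence, so by uniqueness it is
  the same set.\<close>

lemma decomposes_periodic:
  assumes "decomposes W lab x S" "\<And>k. x (k + n) = x k"
  shows "k + n \<in> S \<longleftrightarrow> k \<in> S"
proof -
  have "decomposes W lab x {k. k + n \<in> S}"
    using decomposes_shift[OF assms(1), of n] assms(2) by simp
  then show ?thesis using decomposes_unique[OF assms(1)] by blast
qed

text \<open>The converse of \<open>path_word_segment\<close>: wherever the word of a walk is placed
  in a sequence, with the right vertex before it, the walk yields cuts there.\<close>

lemma path_word_cuts:
  assumes "path_word W i j w" "segment x a (a + int (length w)) = w" "lab (x (a - 1)) = i"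
  shows "\<exists>T \<subseteq> {a..a + int (length w)}. a \<in> T \<and> a + int (length w) \<in> T \<and>
    (\<forall>k k'. consecutive T k k' \<longrightarrow> segment x k k' \<in> W (lab (x (k - 1))) (lab (x (k' - 1))))"
  using assms
proof (induction arbitrary: a rule: path_word.induct)
  case (Nil i)
  then show ?case by (intro exI[of _ "{a}"]) (auto simp: consecutive_def)
next
  case (Append b i j k u)
  let ?a = "a + int (length b)"
  have "segment x a ?a @ segment x ?a (?a + int (length u)) = b @ u"
    using Append.prems(1) segment_append[of a ?a "?a + int (length u)" x] by (simp add: algebra_simps)
  then have seg: "segment x a ?a = b" "segment x ?a (?a + int (length u)) = u"
    by (auto simp: append_eq_append_conv)
  have "x (?a - 1) = last b"
    using last_segment[of a ?a x] seg(1) block_nonempty[OF Append.hyps(1)] by simp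
  then have lab: "lab (x (?a - 1)) = j"
    using lab_last Append.hyps(1) by metis
  obtain T where T: "T \<subseteq> {?a..?a + int (length u)}" "?a \<in> T" "?a + int (length u) \<in> T"
    and cons: "\<And>k k'. consecutive T k k' \<Longrightarrow> segment x k k' \<in> W (lab (x (k - 1))) (lab (x (k' - 1)))"
    using Append.IH[OF seg(2) lab] by blast
  have "0 < length b" using block_nonempty[OF Append.hyps(1)] by simp
  then have pos: "a < ?a" by linarith
  show ?case
  proof (intro exI[of _ "insert a T"] conjI allI impI)
    show "insert a T \<subseteq> {a..a + int (length (b @ u))}" using T pos by auto
    show "a + int (length (b @ u)) \<in> insert a T" using T by (simp add: algebra_simps)
  next
    fix k k' assume kk: "consecutive (insert a T) k k'"
    show "segment x k k' \<in> W (lab (x (k - 1))) (lab (x (k' - 1)))"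
      using consecutive_insert_least[OF _ T(2) pos kk] T(1) cons seg lab Append.hyps(1) Append.prems(2)
      by fastforce
  qed auto
qed

text \<open>The word of a closed walk, repeated with period \<open>n\<close>, is decomposed by the
  cuts of one period and all their translates. The vertex before \<open>a\<close> is read off the
  last letter of the period, and this is where closedness of the walk enters. The further
  conclusions recover the walk from the sequence, as the injectivity of the count requires.\<close>

lemma decomposes_cyclic:
  assumes b: "b \<in> W i j" and u: "path_word W j i u"
    and n: "n = length b + length u" and per: "\<And>k. x (k + int n) = x k"
    and x: "segment x a (a + int n) = b @ u"
  shows "\<exists>S. decomposes W lab x S \<and> consecutive S a (a + int (length b))"
    and "segment x a (a + int (length b)) = b" "segment x (a + int (length b)) (a + int n) = u"
    and "lab (x (a - 1)) = i" "lab (x (a + int (length b) - 1)) = j"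
proof -
  let ?a = "a + int (length b)"
  have b0: "0 < length b" using block_nonempty[OF b] by simp
  have "segment x a ?a @ segment x ?a (a + int n) = b @ u"
    using x n segment_append[of a ?a "a + int n" x] by (simp add: algebra_simps)
  then show seg: "segment x a ?a = b" "segment x ?a (a + int n) = u"
    by (auto simp: append_eq_append_conv)
  have "x (?a - 1) = last b"
    using last_segment[of a ?a x] seg(1) b0 by simp
  then show lab: "lab (x (?a - 1)) = j"
    using lab_last b by metis
  have "lab (last (b @ u)) = i"
    using lab_last_path_word[OF u] lab_last[OF b] by auto
  moreover have "x (a + int n - 1) = last (b @ u)"
    using last_segment[of a "a + int n" x] x b0 n by simp
  moreover have "x (a - 1) = x (a + int n - 1)"
    using per[of "a - 1"] by (simp add: algebra_simps)
  ultimately show lab0: "lab (x (a - 1)) = i" by simp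
  have n0: "int n > 0" using b0 n by linarith
  have len: "?a + int (length u) = a + int n" using n by simp
  obtain T where T: "T \<subseteq> {?a..a + int n}" "?a \<in> T" "a + int n \<in> T"
    and cons: "\<And>k k'. consecutive T k k' \<Longrightarrow> segment x k k' \<in> W (lab (x (k - 1))) (lab (x (k' - 1)))"
    using path_word_cuts[OF u, of x ?a] lab seg(2) unfolding len by auto
  let ?T = "insert a T"
  have consT: "segment x k k' \<in> W (lab (x (k - 1))) (lab (x (k' - 1)))" if kk: "consecutive ?T k k'" for k k'
    using consecutive_insert_least[OF _ T(2) _ kk] T(1) cons seg lab lab0 b b0
    by fastforce
  have sub: "?T \<subseteq> {a..a + int n}" using T by auto
  \<comment> \<open>Both ends of the window \<open>{a..a + int n}\<close> are in \<open>?T\<close>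
    and coincide modulo \<open>n\<close>, so the pull-back of \<open>?T\<close> agrees with
    \<open>?T\<close> on the closed window.\<close>
  define S where "S = {k. a + (k - a) mod int n \<in> ?T}"
  have S_per: "k + int n \<in> S \<longleftrightarrow> k \<in> S" for k
  proof -
    have "k + int n - a = k - a + int n" by simp
    then show ?thesis unfolding S_def by (metis (no_types, lifting) mem_Collect_eq mod_add_self2)
  qed
  have S_per_mult: "k + q * int n \<in> S \<longleftrightarrow> k \<in> S" for k q
    using periodic_mult[of "\<lambda>k. k \<in> S" "int n" k q] S_per by blast
  have S_window: "k \<in> S \<longleftrightarrow> k \<in> ?T" if "a \<le> k" "k \<le> a + int n" for k
  proof (cases "k = a + int n")
    case True
    then show ?thesis using T by (simp add: S_def)
  next
    case False
    then have "(k - a) mod int n = k - a" using that by simp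
    then show ?thesis by (simp add: S_def)
  qed
  have unb: "unbounded S"
  proof (rule unbounded_periodic[of a _ "int n"])
    show "k - int n \<in> S" if "k \<in> S" for k using S_per[of "k - int n"] that by simp
  qed (use S_per n0 in \<open>auto simp: S_def\<close>)
  have "segment x k k' \<in> W (lab (x (k - 1))) (lab (x (k' - 1)))" if kk: "consecutive S k k'" for k k'
  proof -
    \<comment> \<open>The gap is translated by \<open>q\<close> periods into the window that starts
      at \<open>a\<close>.\<close>
    define q where "q = (k - a) div int n"
    let ?k = "k + (- q) * int n" and ?k' = "k' + (- q) * int n"
    have "?k = a + (k - a) mod int n"
      unfolding q_def by (simp add: minus_mult_div_eq_mod[symmetric] algebra_simps)
    then have k: "a \<le> ?k" "?k < a + int n" using n0 by simp_all
    \<comment> \<open>Every window ends in a cut, so no gap straddles two windows.\<close>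
    have "a + int n \<in> S" using T by (simp add: S_def)
    then have "a + int n + q * int n \<in> S" using S_per_mult by metis
    then have "\<not> (k < a + int n + q * int n \<and> a + int n + q * int n < k')"
      using kk by (simp add: consecutive_def)
    then have "k' \<le> a + int n + q * int n"
      using k(2) by simp
    then have k': "?k' \<le> a + int n" by simp
    have "consecutive ?T ?k ?k'"
      unfolding consecutive_def
    proof (intro conjI ballI)
      show "?k \<in> ?T"
        using S_window[of ?k] S_per_mult[of k "-q"] k kk unfolding consecutive_def by simp
      have "k < k'" using kk by (simp add: consecutive_def)
      then show "?k' \<in> ?T"
        using S_window[of ?k'] S_per_mult[of k' "-q"] k k' kk unfolding consecutive_def by simp
      show "?k < ?k'" using kk by (simp add: consecutive_def)
      fix m assume m: "m \<in> ?T"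
      show "\<not> (?k < m \<and> m < ?k')"
      proof
        assume *: "?k < m \<and> m < ?k'"
        have "a \<le> m" "m \<le> a + int n" using m sub by auto
        then have "m \<in> S" using S_window[of m] m by blast
        then have "m + q * int n \<in> S" using S_per_mult by metis
        then have "\<not> (k < m + q * int n \<and> m + q * int n < k')"
          using kk by (simp add: consecutive_def)
        then show False using * by simp
      qed
    qed
    then have "segment x ?k ?k' \<in> W (lab (x (?k - 1))) (lab (x (?k' - 1)))" by (rule consT)
    moreover have shift: "x (m + (- q) * int n) = x m" for m
      by (rule periodic_mult) (rule per)
    moreover have "segment x ?k ?k' = segment x k k'"
      by (simp only: segment_shift[symmetric] shift)
    moreover have "x (m + (- q) * int n - 1) = x (m - 1)" for m
    proof -
      have "m + (- q) * int n - 1 = (m - 1) + (- q) * int n" by simp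
      then show ?thesis by (simp only: shift)
    qed
    ultimately show ?thesis by simp
  qed
  then have "decomposes W lab x S" using unb by (auto simp: decomposes_def)
  moreover have "consecutive S a ?a"
    unfolding consecutive_def
  proof (intro conjI ballI)
    show "a \<in> S" by (simp add: S_def)
    show "?a \<in> S" using S_window[of ?a] T(2) n by simp
    show "a < ?a" using b0 by simp
    fix m assume m: "m \<in> S"
    show "\<not> (a < m \<and> m < ?a)"
    proof
      assume *: "a < m \<and> m < ?a"
      then have "m \<in> T" using S_window[of m] m n by simp
      then show False using * T(1) by auto
    qed
  qed
  ultimately show "\<exists>S. decomposes W lab x S \<and> consecutive S a ?a" by blast
qed

end

section \<open>Counting blocks, walks and periodic points\<close>

context block_graph
begin

definition blocks :: "'v \<Rightarrow> 'v \<Rightarrow> nat \<Rightarrow> 'a list set" where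
  "blocks i j l = {b \<in> W i j. length b = l}"

definition path_words :: "'v \<Rightarrow> 'v \<Rightarrow> nat \<Rightarrow> 'a list set" where
  "path_words i j l = {w. path_word W i j w \<and> length w = l}"

lemma finite_blocks: "finite (blocks i j l)"
  and finite_path_words: "finite (path_words i j l)"
  using finite_lists_length_eq[of "UNIV :: 'a set" l]
  by (auto simp: blocks_def path_words_def intro: finite_subset rev_finite_subset)

lemma blocks_0: "blocks i j 0 = {}"
  using block_nonempty by (auto simp: blocks_def)

lemma path_words_unfold:
  "path_words i j n = (if n = 0 \<and> i = j then {[]} else {}) \<union>
     (\<lambda>(k, l, b, u). b @ u) ` (SIGMA k:UNIV. SIGMA l:{..n}. blocks i k l \<times> path_words k j (n - l))"
  (is "?L = ?E \<union> ?f ` ?R")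
proof (intro equalityI subsetI)
  fix w assume w: "w \<in> ?L"
  then have "path_word W i j w" and len: "length w = n" by (auto simp: path_words_def)
  then show "w \<in> ?E \<union> ?f ` ?R"
  proof cases
    case (Append b k u)
    then have "(k, length b, b, u) \<in> ?R" using len by (auto simp: blocks_def path_words_def)
    then show ?thesis using Append by (auto intro!: image_eqI[where x = "(k, length b, b, u)"])
  qed auto
next
  fix w assume "w \<in> ?E \<union> ?f ` ?R"
  then show "w \<in> ?L"
    by (auto simp: path_words_def blocks_def split: if_splits intro: path_word.intros)
qed

text \<open>Splitting off the first block is injective: \<open>prefix_code\<close> determines the
  block and \<open>lab_last\<close> its end vertex. In generating functions this is the equation
  \<open>K = mat 1 + block_matrix ** K\<close>.\<close>

lemma card_path_words:
  "card (path_words i j n) = (if n = 0 \<and> i = j then 1 else 0) +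
     (\<Sum>k\<in>UNIV. \<Sum>l\<le>n. card (blocks i k l) * card (path_words k j (n - l)))"
proof -
  let ?R = "SIGMA k:UNIV. SIGMA l:{..n}. blocks i k l \<times> path_words k j (n - l)"
  let ?f = "\<lambda>(k, l, b, u). b @ u"
  have fin: "finite ?R"
    by (intro finite_SigmaI finite_cartesian_product finite_blocks finite_path_words) auto
  have "inj_on ?f ?R"
  proof (rule inj_onI)
    fix t t' assume t: "t \<in> ?R" "t' \<in> ?R" "?f t = ?f t'"
    obtain k l b u where [simp]: "t = (k, l, b, u)" by (cases t)
    obtain k' l' b' u' where [simp]: "t' = (k', l', b', u')" by (cases t')
    have b: "b \<in> W i k" "b' \<in> W i k'" "length b = l" "length b' = l'" and "b @ u = b' @ u'"
      using t by (auto simp: blocks_def)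
    then have "b = b'" using prefix_code by blast
    moreover have "k = k'" using b(1,2) \<open>b = b'\<close> lab_last by metis
    ultimately show "t = t'" using b(3,4) \<open>b @ u = b' @ u'\<close> by simp
  qed
  then have "card (?f ` ?R) = (\<Sum>k\<in>UNIV. \<Sum>l\<le>n. card (blocks i k l) * card (path_words k j (n - l)))"
    by (simp add: card_image card_SigmaI card_cartesian_product finite_blocks finite_path_words)
  moreover have "card (path_words i j n) = (if n = 0 \<and> i = j then 1 else 0) + card (?f ` ?R)"
  proof -
    define I where "I = ?f ` ?R"
    have "[] \<notin> I" "finite I" using block_nonempty fin by (auto simp: blocks_def I_def)
    then show ?thesis
      unfolding path_words_unfold[of i j n] I_def[symmetric] by simp
  qed
  ultimately show ?thesis by simp
qed

text \<open>Look at the block \<open>b\<close> covering position 0. It runs from vertex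
  \<open>i\<close> to vertex \<open>j\<close>, has length \<open>l\<close> and begins at
  \<open>- a\<close> for some \<open>a < l\<close>; the rest \<open>u\<close> of the period is a
  walk from \<open>j\<close> back to \<open>i\<close>. The \<open>l\<close> choices of
  \<open>a\<close> give the factor that later becomes the derivative of the block generating
  function.\<close>

lemma card_periodic_points:
  assumes n: "n > 0"
  shows "card (periodic_points n (coded_shift W lab)) =
    (\<Sum>i\<in>UNIV. \<Sum>j\<in>UNIV. \<Sum>l\<le>n. l * (card (blocks i j l) * card (path_words j i (n - l))))"
proof -
  let ?P = "periodic_points n (coded_shift W lab)"
  let ?T = "SIGMA i:UNIV. SIGMA j:UNIV. SIGMA l:{..n}. {..<l} \<times> blocks i j l \<times> path_words j i (n - l)"
  let ?f = "\<lambda>(i, j, l, a, b, u) k. periodic_extension (b @ u) (k + int a)"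
  have key: "(\<forall>k. x (k + int n) = x k) \<and>
      (\<exists>S. decomposes W lab x S \<and> consecutive S (- int a) (- int a + int l)) \<and>
      segment x (- int a) (- int a + int l) = b \<and> segment x (- int a + int l) (- int a + int n) = u \<and>
      lab (x (- int a - 1)) = i \<and> lab (x (- int a + int l - 1)) = j"
    if "(i, j, l, a, b, u) \<in> ?T" "x = ?f (i, j, l, a, b, u)" for i j l a b u x
  proof -
    have b: "b \<in> W i j" "length b = l" and u: "path_word W j i u" and len: "n = length b + length u"
      using that by (auto simp: blocks_def path_words_def)
    have per: "x (k + int n) = x k" for k
      using that(2) periodic_extension_periodic[of "b @ u" "k + int a"] len by (simp add: ac_simps)
    have "segment x (- int a) (- int a + int n) = segment (periodic_extension (b @ u)) 0 (int n)"
      using that(2) segment_shift[of "periodic_extension (b @ u)" "int a" "- int a" "- int a + int n"] by simp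
    also have "\<dots> = b @ u" using segment_periodic_extension[of "b @ u"] len by simp
    finally show ?thesis
      using decomposes_cyclic[OF b(1) u len, of x "- int a"] per b(2) by blast
  qed
  have "bij_betw ?f ?T ?P"
  proof (rule bij_betw_imageI)
    show "inj_on ?f ?T"
    proof (rule inj_onI)
      fix t t' assume t: "t \<in> ?T" "t' \<in> ?T" "?f t = ?f t'"
      obtain i j l a b u where t_eq: "t = (i, j, l, a, b, u)" by (cases t)
      obtain i' j' l' a' b' u' where t'_eq: "t' = (i', j', l', a', b', u')" by (cases t')
      note t' = t(1,2)[unfolded t_eq t'_eq]
      define x where "x = ?f t"
      have x: "x = ?f (i, j, l, a, b, u)" by (simp only: x_def t_eq)
      have x': "x = ?f (i', j', l', a', b', u')" by (simp only: x_def t(3) t'_eq)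
      obtain S where S: "decomposes W lab x S" "consecutive S (- int a) (- int a + int l)"
        and 1: "segment x (- int a) (- int a + int l) = b" "segment x (- int a + int l) (- int a + int n) = u"
          "lab (x (- int a - 1)) = i" "lab (x (- int a + int l - 1)) = j"
        using key[OF t'(1) x] by blast
      obtain S' where S': "decomposes W lab x S'" "consecutive S' (- int a') (- int a' + int l')"
        and 2: "segment x (- int a') (- int a' + int l') = b'" "segment x (- int a' + int l') (- int a' + int n) = u'"
          "lab (x (- int a' - 1)) = i'" "lab (x (- int a' + int l' - 1)) = j'"
        using key[OF t'(2) x'] by blast
      \<comment> \<open>Both blocks cover position 0, and gaps of one cut set covering a common
        position are equal.\<close>
      have "a < l" "a' < l'" using t' by auto
      moreover have "S' = S" using S S' decomposes_unique by blast
      ultimately have "- int a = - int a'" "- int a + int l = - int a' + int l'"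
        using consecutive_unique[OF S(2), of "- int a'" "- int a' + int l'" 0] S'(2) by auto
      then have "a = a'" "l = l'" by auto
      then show "t = t'" using 1 2 by (simp add: t_eq t'_eq)
    qed
    show "?f ` ?T = ?P"
    proof (intro equalityI subsetI)
      fix x assume "x \<in> ?f ` ?T"
      then obtain i j l a b u where "(i, j, l, a, b, u) \<in> ?T" "x = ?f (i, j, l, a, b, u)" by auto
      from key[OF this] show "x \<in> ?P" by (auto simp: periodic_points_iff coded_shift_def)
    next
      fix x assume "x \<in> ?P"
      then obtain S where S: "decomposes W lab x S" and per: "\<And>k. x (k + int n) = x k"
        by (auto simp: periodic_points_iff coded_shift_def)
      obtain k k' where k: "consecutive S k k'" "k \<le> 0" "0 < k'"
        using ex_consecutive_around[of S 0] S by (auto simp: decomposes_def)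
      have kS: "k \<in> S" "k' \<in> S" "k < k'" using k by (auto simp: consecutive_def)
      have kn: "k + int n \<in> S" using decomposes_periodic[OF S per] kS by simp
      \<comment> \<open>\<open>k + int n\<close> is itself a cut, so the block that starts at
        \<open>k\<close> fits into one period.\<close>
      have le: "k' \<le> k + int n" using k(1) kn n unfolding consecutive_def by force
      define b u where "b = segment x k k'" and "u = segment x k' (k + int n)"
      have "x (k + int n - 1) = x (k - 1)" using per[of "k - 1"] by (simp add: algebra_simps)
      then have "path_word W (lab (x (k' - 1))) (lab (x (k - 1))) u"
        using path_word_segment[OF S kS(2) kn le] by (simp add: u_def)
      moreover have "b \<in> W (lab (x (k - 1))) (lab (x (k' - 1)))"
        using S k(1) by (simp add: decomposes_def b_def)
      moreover have "b @ u = segment x k (k + int n)"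
        using segment_append[of k k' "k + int n" x] kS le by (simp add: b_def u_def)
      then have "x = (\<lambda>m. periodic_extension (b @ u) (m + int (nat (- k))))"
        using periodic_extension_segment[of x n k] per n k(2) by (simp add: fun_eq_iff)
      moreover have "length b = nat (k' - k)" "length u = n - nat (k' - k)" "nat (k' - k) \<le> n"
        using kS le by (auto simp: b_def u_def)
      ultimately show "x \<in> ?f ` ?T"
        using k kS by (intro image_eqI[where x = "(lab (x (k - 1)), lab (x (k' - 1)), nat (k' - k), nat (- k), b, u)"])
          (auto simp: blocks_def path_words_def nat_less_iff)
    qed
  qed
  then have "card ?P = card ?T" by (simp add: bij_betw_same_card)
  then show ?thesis
    by (simp add: card_SigmaI card_cartesian_product finite_blocks finite_path_words)
qed

definition block_matrix :: "real fps^'v^'v" where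
  "block_matrix = (\<chi> i j. Abs_fps (\<lambda>l. real (card (blocks i j l))))"

theorem zeta_coded_shift: "zeta_fps (coded_shift W lab) * det (mat 1 - block_matrix) = 1"
proof -
  \<comment> \<open>The generating functions of all walks, playing the role of the inverse of
    \<open>mat 1 - block_matrix\<close>.\<close>
  define K :: "real fps^'v^'v" where "K = (\<chi> i j. Abs_fps (\<lambda>l. real (card (path_words i j l))))"
  have "K $ i $ j = (mat 1 + block_matrix ** K) $ i $ j" for i j
  proof (rule fps_ext)
    fix n
    show "fps_nth (K $ i $ j) n = fps_nth ((mat 1 + block_matrix ** K) $ i $ j) n"
      using card_path_words[of i j n]
      by (auto simp: K_def block_matrix_def mat_def matrix_matrix_mult_def fps_sum_nth fps_mult_nth
          atLeast0AtMost)
  qed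
  then have K: "K = mat 1 + block_matrix ** K" by (simp add: vec_eq_iff)
  have "log_counts (\<lambda>n. real (card (periodic_points n (coded_shift W lab))))
      = (\<Sum>i\<in>UNIV. \<Sum>j\<in>UNIV. fps_deriv (block_matrix $ i $ j) * K $ j $ i)"
  proof (rule fps_ext)
    fix n
    \<comment> \<open>The summand for \<open>l = 0\<close> carries the factor 0; after the index
      shift the factors \<open>Suc l\<close> are those of \<open>fps_deriv\<close>.\<close>
    have "real (card (periodic_points (Suc n) (coded_shift W lab))) = (\<Sum>i\<in>UNIV. \<Sum>j\<in>UNIV.
        \<Sum>l\<le>n. real (Suc l) * (real (card (blocks i j (Suc l))) * real (card (path_words j i (n - l)))))"
      by (simp add: card_periodic_points sum.atMost_Suc_shift del: sum.atMost_Suc of_nat_Suc mult_Suc)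
    then show "fps_nth (log_counts (\<lambda>n. real (card (periodic_points n (coded_shift W lab))))) n
      = fps_nth (\<Sum>i\<in>UNIV. \<Sum>j\<in>UNIV. fps_deriv (block_matrix $ i $ j) * K $ j $ i) n"
      by (simp add: log_counts_def K_def block_matrix_def fps_sum_nth fps_mult_nth atLeast0AtMost
          mult.assoc add.commute del: of_nat_Suc)
  qed
  \<comment> \<open>Blocks are nonempty, so \<open>block_matrix\<close> has no constant
    coefficients.\<close>
  moreover have "fps_nth (det (mat 1 - block_matrix)) 0 = 1"
  proof -
    have "fps_nth (det (mat 1 - block_matrix)) 0 = det (mat 1 :: real^'v^'v)"
      unfolding det_def fps_sum_nth
    proof (intro sum.cong refl)
      fix p :: "'v \<Rightarrow> 'v"
      have "fps_nth (prod f S) 0 = (\<Prod>i\<in>S. fps_nth (f i) 0)" for f :: "'v \<Rightarrow> real fps" and S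
        by (induction S rule: infinite_finite_induct) auto
      then show "fps_nth (of_int (sign p) * (\<Prod>i\<in>UNIV. (mat 1 - block_matrix) $ i $ p i)) 0
        = of_int (sign p) * (\<Prod>i\<in>UNIV. (mat 1 :: real^'v^'v) $ i $ p i)"
        by (auto simp: mat_def block_matrix_def blocks_0 fps_of_int intro!: prod.cong)
    qed
    then show ?thesis by simp
  qed
  ultimately show ?thesis
    unfolding zeta_fps_eq
    by (intro zeta_of_counts_mult_eq_1) (simp_all add: fps_deriv_det_one_minus[OF K])
qed

end

section \<open>Words as partial isometries on the path space\<close>

lemma lookup_adj: "Poly_Mapping.lookup (adj x) w = cnj (Poly_Mapping.lookup x (adj_word w))"
  unfolding adj_def map_key.rep_eq[OF inj_adj_word] comp_def
  by (simp add: Poly_Mapping.map.rep_eq when_def)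

lemma adj_add: "adj (x + y) = adj x + adj y"
  by (rule poly_mapping_eqI) (simp add: lookup_adj lookup_add)

lemma adj_adj: "adj (adj x) = x"
  by (rule poly_mapping_eqI) (simp add: lookup_adj)

lemma adj_zero: "adj 0 = 0"
  by (rule poly_mapping_eqI) (simp add: lookup_adj)

lemma adj_one: "adj 1 = 1"
  using adj_single[of 0 1] by (simp add: zero_free_monoid_def flip: single_one)

text \<open>Reduces linear statements to monomials; the step is phrased as a sum so that additivity
  applies to it directly.\<close>

lemma free_star_algebra_induct:
  assumes "P 0" and "\<And>f k v. P f \<Longrightarrow> P (f + Poly_Mapping.single k v)"
  shows "P (x :: 'n free_star_algebra)"
proof (induction x rule: Poly_Mapping.update_induct)
  case (update f k v)
  have "Poly_Mapping.update k v f = f + Poly_Mapping.single k v"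
    using update(1)
    by (intro poly_mapping_eqI)
      (auto simp: lookup_update lookup_add lookup_single when_def in_keys_iff)
  then show ?case using update assms(2) by simp
qed (rule assms(1))

lemma lookup_scal: "Poly_Mapping.lookup (scal c x) w = c * Poly_Mapping.lookup x w"
  by (simp add: scal_def Poly_Mapping.map.rep_eq when_def)

lemma scal_conv_mult: "scal c x = Poly_Mapping.single 0 c * x"
proof (induction x rule: free_star_algebra_induct)
  case 1
  show ?case by (rule poly_mapping_eqI) (simp add: lookup_scal)
next
  case (2 f k v)
  have "scal c (f + Poly_Mapping.single k v) = scal c f + Poly_Mapping.single k (c * v)"
    by (rule poly_mapping_eqI) (simp add: lookup_scal lookup_add lookup_single when_def distrib_left)
  then show ?case using 2 by (simp add: distrib_left mult_single)
qed

definition adj_list :: "'n letter list \<Rightarrow> 'n letter list" where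
  "adj_list w = rev (map adj_letter w)"

lemma adj_list_simps [simp]:
  "adj_list [] = []" "adj_list (a # w) = adj_list w @ [adj_letter a]"
  "adj_list (u @ v) = adj_list v @ adj_list u" "adj_list (adj_list w) = w"
  "length (adj_list w) = length w"
  by (simp_all add: adj_list_def rev_map comp_def)

lemma adj_word_FM: "adj_word (FM w) = FM (adj_list w)"
  by (simp add: adj_list_def)

locale transition_matrix =
  fixes A :: "nat^'n::finite^'n"
  assumes zero_one: "A $ i $ j \<in> {0, 1}"
    and essential: "essential A"
begin

definition infinite_paths :: "(nat \<Rightarrow> 'n) set" where
  "infinite_paths = {x. \<forall>k. A $ x k $ x (Suc k) \<noteq> 0}"

text \<open>The generators and their adjoints as partial maps of the orthonormal basis of
  \<open>\<ell>\<^sup>2(infinite_paths)\<close>.\<close>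

fun act_letter :: "'n letter \<Rightarrow> (nat \<Rightarrow> 'n) \<Rightarrow> (nat \<Rightarrow> 'n) option" where
  "act_letter (Alpha i) x = (if x 0 = i then Some (x \<circ> Suc) else None)"
| "act_letter (Beta i) x = (if A $ i $ x 0 \<noteq> 0 then Some (case_nat i x) else None)"

fun act :: "'n letter list \<Rightarrow> (nat \<Rightarrow> 'n) \<Rightarrow> (nat \<Rightarrow> 'n) option" where
  "act [] x = Some x"
| "act (a # w) x = Option.bind (act w x) (act_letter a)"

definition live :: "'n letter list \<Rightarrow> bool" where
  "live w \<longleftrightarrow> (\<exists>x\<in>infinite_paths. act w x \<noteq> None)"

lemma act_append: "act (u @ v) x = Option.bind (act v x) (act u)"
  by (induction u) simp_all

lemma act_letter_in_paths: "x \<in> infinite_paths \<Longrightarrow> act_letter a x = Some y \<Longrightarrow> y \<in> infinite_paths"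
  by (cases a) (auto simp: infinite_paths_def split: if_splits nat.splits)

lemma act_in_paths: "x \<in> infinite_paths \<Longrightarrow> act w x = Some y \<Longrightarrow> y \<in> infinite_paths"
  by (induction w arbitrary: y) (auto simp: bind_eq_Some_conv act_letter_in_paths)

lemma act_adj_letter:
  assumes "x \<in> infinite_paths" "act_letter a x = Some y"
  shows "act_letter (adj_letter a) y = Some x"
proof (cases a)
  case (Alpha i)
  have "A $ x 0 $ x (Suc 0) \<noteq> 0" using assms(1) by (simp add: infinite_paths_def)
  moreover have "case_nat (x 0) (x \<circ> Suc) = x" by (simp add: fun_eq_iff split: nat.splits)
  ultimately show ?thesis using Alpha assms(2) by (auto split: if_splits)
next
  case (Beta i)
  then have "y = case_nat i x" using assms(2) by (auto split: if_splits)
  then show ?thesis using Beta by (simp add: fun_eq_iff)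
qed

text \<open>Each letter acts on paths as a partial injection whose inverse is the action of the
  adjoint letter. Everything that makes the word operators partial isometries rests on this.\<close>

lemma act_adj_list:
  assumes "x \<in> infinite_paths" "act w x = Some y"
  shows "act (adj_list w) y = Some x"
  using assms
proof (induction w arbitrary: y)
  case (Cons a w)
  then obtain z where z: "act w x = Some z" "act_letter a z = Some y"
    by (auto simp: bind_eq_Some_conv)
  then have "act_letter (adj_letter a) y = Some z"
    using act_adj_letter act_in_paths Cons.prems(1) by blast
  then show ?case using Cons.IH[OF Cons.prems(1) z(1)] by (simp add: act_append)
qed simp

lemma live_adj_list [simp]: "live (adj_list w) \<longleftrightarrow> live w"
proof -
  have "live (adj_list w)" if "live w" for w
    using that act_adj_list act_in_paths unfolding live_def
    by (metis not_None_eq)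
  from this[of w] this[of "adj_list w"] show ?thesis by auto
qed

lemma live_infix: "live (u @ v @ w) \<Longrightarrow> live v"
proof -
  assume "live (u @ v @ w)"
  then obtain x y where x: "x \<in> infinite_paths" "act (u @ v @ w) x = Some y"
    unfolding live_def by auto
  then obtain z z' where z: "act w x = Some z" "act v z = Some z'"
    by (auto simp: act_append bind_eq_Some_conv)
  then show "live v" using act_in_paths[OF x(1) z(1)] unfolding live_def by auto
qed

lemma infinite_path_from: "\<exists>x\<in>infinite_paths. x 0 = i"
proof -
  have "\<forall>i. \<exists>j. A $ i $ j \<noteq> 0" using essential by (simp add: essential_def)
  then obtain s where s: "\<And>i. A $ i $ s i \<noteq> 0" by metis
  show ?thesis
    by (rule bexI[of _ "\<lambda>k. (s ^^ k) i"]) (use s in \<open>auto simp: infinite_paths_def\<close>)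
qed

end

section \<open>The representation on finitely supported vectors\<close>

text \<open>Finitely supported vectors carry the \<open>\<ell>\<^sup>2\<close> inner product without any convergence issue, and
  suffice for operator norms.\<close>

definition support :: "('a \<Rightarrow> complex) \<Rightarrow> 'a set" where
  "support \<xi> = {x. \<xi> x \<noteq> 0}"

text \<open>Summing over the intersection of the supports keeps the sum finite as soon as one of the
  two supports is finite, so additivity in one argument needs finiteness of the other support
  only.\<close>

definition inner_prod :: "('a \<Rightarrow> complex) \<Rightarrow> ('a \<Rightarrow> complex) \<Rightarrow> complex" where
  "inner_prod \<xi> \<eta> = (\<Sum>x\<in>support \<xi> \<inter> support \<eta>. cnj (\<xi> x) * \<eta> x)"

definition l2_norm :: "('a \<Rightarrow> complex) \<Rightarrow> real" where
  "l2_norm \<xi> = L2_set (\<lambda>x. cmod (\<xi> x)) (support \<xi>)"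

lemma inner_prod_eq_sum:
  assumes "finite F" "support \<xi> \<inter> support \<eta> \<subseteq> F"
  shows "inner_prod \<xi> \<eta> = (\<Sum>x\<in>F. cnj (\<xi> x) * \<eta> x)"
  unfolding inner_prod_def by (rule sum.mono_neutral_left) (use assms in \<open>auto simp: support_def\<close>)

lemma l2_norm_eq_L2_set:
  assumes "finite F" "support \<xi> \<subseteq> F"
  shows "l2_norm \<xi> = L2_set (\<lambda>x. cmod (\<xi> x)) F"
  unfolding l2_norm_def L2_set_def
  by (intro arg_cong[where f = sqrt] sum.mono_neutral_left) (use assms in \<open>auto simp: support_def\<close>)

lemma l2_norm_nonneg [simp]: "0 \<le> l2_norm \<xi>"
  by (simp add: l2_norm_def)

lemma l2_norm_eq_0_iff: "finite (support \<xi>) \<Longrightarrow> l2_norm \<xi> = 0 \<longleftrightarrow> \<xi> = (\<lambda>_. 0)"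
  by (auto simp: l2_norm_def L2_set_eq_0_iff support_def fun_eq_iff)

lemma l2_norm_triangle:
  assumes "finite (support \<xi>)" "finite (support \<eta>)"
  shows "l2_norm (\<lambda>x. \<xi> x + \<eta> x) \<le> l2_norm \<xi> + l2_norm \<eta>"
proof -
  let ?F = "support \<xi> \<union> support \<eta>"
  have F: "finite ?F" "support \<xi> \<subseteq> ?F" "support \<eta> \<subseteq> ?F" "support (\<lambda>x. \<xi> x + \<eta> x) \<subseteq> ?F"
    using assms by (auto simp: support_def)
  have "L2_set (\<lambda>x. cmod (\<xi> x + \<eta> x)) ?F \<le> L2_set (\<lambda>x. cmod (\<xi> x) + cmod (\<eta> x)) ?F"
    by (intro L2_set_mono norm_triangle_ineq) auto
  also have "\<dots> \<le> L2_set (\<lambda>x. cmod (\<xi> x)) ?F + L2_set (\<lambda>x. cmod (\<eta> x)) ?F"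
    by (rule L2_set_triangle_ineq)
  finally show ?thesis by (simp only: l2_norm_eq_L2_set[OF F(1)] F)
qed

lemma l2_norm_scale:
  assumes "finite (support \<xi>)"
  shows "l2_norm (\<lambda>x. c * \<xi> x) = cmod c * l2_norm \<xi>"
proof -
  have "l2_norm (\<lambda>x. c * \<xi> x) = L2_set (\<lambda>x. cmod (c * \<xi> x)) (support \<xi>)"
    by (rule l2_norm_eq_L2_set) (use assms in \<open>auto simp: support_def\<close>)
  then show ?thesis
    by (simp add: norm_mult L2_set_right_distrib l2_norm_def)
qed

lemma inner_prod_self:
  assumes "finite (support \<xi>)"
  shows "inner_prod \<xi> \<xi> = complex_of_real ((l2_norm \<xi>)\<^sup>2)"
  using assms unfolding inner_prod_def l2_norm_def L2_set_def
  by (simp add: sum_nonneg complex_norm_square[symmetric] mult.commute flip: of_real_power)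

lemma norm_inner_prod_le:
  assumes "finite (support \<xi>)" "finite (support \<eta>)"
  shows "cmod (inner_prod \<xi> \<eta>) \<le> l2_norm \<xi> * l2_norm \<eta>"
proof -
  let ?F = "support \<xi> \<union> support \<eta>"
  have F: "finite ?F" "support \<xi> \<inter> support \<eta> \<subseteq> ?F" "support \<xi> \<subseteq> ?F" "support \<eta> \<subseteq> ?F"
    using assms by auto
  have "cmod (inner_prod \<xi> \<eta>) \<le> (\<Sum>x\<in>?F. \<bar>cmod (\<xi> x)\<bar> * \<bar>cmod (\<eta> x)\<bar>)"
    unfolding inner_prod_eq_sum[OF F(1,2)] by (rule sum_norm_le) (simp add: norm_mult)
  also have "\<dots> \<le> L2_set (\<lambda>x. cmod (\<xi> x)) ?F * L2_set (\<lambda>x. cmod (\<eta> x)) ?F"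
    by (rule L2_set_mult_ineq)
  finally show ?thesis by (simp only: l2_norm_eq_L2_set[OF F(1)] F)
qed

lemma inner_prod_add_left:
  assumes "finite (support \<eta>)"
  shows "inner_prod (\<lambda>x. \<xi> x + \<xi>' x) \<eta> = inner_prod \<xi> \<eta> + inner_prod \<xi>' \<eta>"
  by (simp add: inner_prod_eq_sum[OF assms] sum.distrib distrib_right)

lemma inner_prod_add_right:
  assumes "finite (support \<xi>)"
  shows "inner_prod \<xi> (\<lambda>x. \<eta> x + \<eta>' x) = inner_prod \<xi> \<eta> + inner_prod \<xi> \<eta>'"
  by (simp add: inner_prod_eq_sum[OF assms] sum.distrib distrib_left)

lemma inner_prod_scale_left:
  assumes "finite (support \<eta>)"
  shows "inner_prod (\<lambda>x. cnj c * \<xi> x) \<eta> = c * inner_prod \<xi> \<eta>"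
  by (simp add: inner_prod_eq_sum[OF assms] sum_distrib_left mult.assoc)

lemma inner_prod_scale_right:
  assumes "finite (support \<xi>)"
  shows "inner_prod \<xi> (\<lambda>x. c * \<eta> x) = c * inner_prod \<xi> \<eta>"
  by (simp add: inner_prod_eq_sum[OF assms] sum_distrib_left mult.left_commute)

section \<open>The representation of the free *-algebra and its operator norm\<close>

context transition_matrix
begin

text \<open>The image of the basis vector of \<open>x\<close> is that of \<open>act w x\<close>.
  Evaluated at \<open>y\<close>, this asks for the preimage of \<open>y\<close>, which the adjoint
  word computes; no sum over preimages appears because the action is injective.\<close>

fun word_op :: "'n letter free_monoid \<Rightarrow> ((nat \<Rightarrow> 'n) \<Rightarrow> complex) \<Rightarrow> (nat \<Rightarrow> 'n) \<Rightarrow> complex" where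
  "word_op (FM w) \<xi> y = (if y \<in> infinite_paths
     then (case act (adj_list w) y of Some x \<Rightarrow> \<xi> x | None \<Rightarrow> 0) else 0)"

definition rep :: "'n free_star_algebra \<Rightarrow> ((nat \<Rightarrow> 'n) \<Rightarrow> complex) \<Rightarrow> (nat \<Rightarrow> 'n) \<Rightarrow> complex" where
  "rep f \<xi> y = (\<Sum>w\<in>Poly_Mapping.keys f. Poly_Mapping.lookup f w * word_op w \<xi> y)"

definition vectors :: "((nat \<Rightarrow> 'n) \<Rightarrow> complex) set" where
  "vectors = {\<xi>. finite (support \<xi>) \<and> support \<xi> \<subseteq> infinite_paths}"

lemma finite_support [simp]: "\<xi> \<in> vectors \<Longrightarrow> finite (support \<xi>)"
  by (simp add: vectors_def)

lemma vectors_add: "\<xi> \<in> vectors \<Longrightarrow> \<eta> \<in> vectors \<Longrightarrow> (\<lambda>x. \<xi> x + \<eta> x) \<in> vectors"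
proof -
  assume "\<xi> \<in> vectors" "\<eta> \<in> vectors"
  moreover have "support (\<lambda>x. \<xi> x + \<eta> x) \<subseteq> support \<xi> \<union> support \<eta>" by (auto simp: support_def)
  ultimately show ?thesis
    unfolding vectors_def by (auto intro: finite_subset)
qed

lemma vectors_scale: "\<xi> \<in> vectors \<Longrightarrow> (\<lambda>x. c * \<xi> x) \<in> vectors"
  unfolding vectors_def support_def
  by (auto intro: rev_finite_subset)

lemma rep_eq_sum:
  assumes "finite F" "Poly_Mapping.keys f \<subseteq> F"
  shows "rep f \<xi> y = (\<Sum>w\<in>F. Poly_Mapping.lookup f w * word_op w \<xi> y)"
  unfolding rep_def
  by (rule sum.mono_neutral_left) (use assms in \<open>auto simp: in_keys_iff\<close>)

lemma rep_zero: "rep 0 \<xi> = (\<lambda>_. 0)"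
  by (simp add: rep_def fun_eq_iff)

lemma rep_add: "rep (f + g) \<xi> = (\<lambda>y. rep f \<xi> y + rep g \<xi> y)"
proof
  fix y
  let ?F = "Poly_Mapping.keys f \<union> Poly_Mapping.keys g"
  have "finite ?F" "Poly_Mapping.keys f \<subseteq> ?F" "Poly_Mapping.keys g \<subseteq> ?F" "Poly_Mapping.keys (f + g) \<subseteq> ?F"
    using Poly_Mapping.keys_add[of f g] by auto
  then show "rep (f + g) \<xi> y = rep f \<xi> y + rep g \<xi> y"
    by (simp only: rep_eq_sum[of ?F] lookup_add distrib_right sum.distrib)
qed

lemma rep_single: "rep (Poly_Mapping.single w c) \<xi> = (\<lambda>y. c * word_op w \<xi> y)"
  by (simp add: fun_eq_iff rep_eq_sum[of "{w}"] lookup_single)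

lemma word_op_plus: "word_op (u + v) \<xi> = word_op u (word_op v \<xi>)"
proof
  fix y
  obtain u' v' where [simp]: "u = FM u'" "v = FM v'" by (cases u; cases v)
  show "word_op (u + v) \<xi> y = word_op u (word_op v \<xi>) y"
    using act_in_paths by (auto simp: act_append split: option.splits)
qed

lemma word_op_linear:
  "word_op w (\<lambda>y. \<xi> y + \<eta> y) y = word_op w \<xi> y + word_op w \<eta> y"
  "word_op w (\<lambda>y. c * \<xi> y) y = c * word_op w \<xi> y"
  "word_op w (\<lambda>_. 0) y = 0"
  by (cases w; simp split: option.splits)+

lemma rep_linear:
  "rep f (\<lambda>y. \<xi> y + \<eta> y) y = rep f \<xi> y + rep f \<eta> y"
  "rep f (\<lambda>y. c * \<xi> y) y = c * rep f \<xi> y"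
  "rep f (\<lambda>_. 0) y = 0"
  by (simp_all add: rep_def word_op_linear distrib_left sum.distrib sum_distrib_left mult.left_commute)

lemma rep_mult: "rep (f * g) \<xi> = rep f (rep g \<xi>)"
proof (induction f rule: free_star_algebra_induct)
  case 1
  show ?case by (simp add: rep_zero)
next
  case (2 f k v)
  have "rep (Poly_Mapping.single k v * g) \<xi> y = v * word_op k (rep g \<xi>) y" for y
  proof (induction g rule: free_star_algebra_induct)
    case 1
    show ?case by (simp add: rep_zero word_op_linear)
  next
    case (2 g l u)
    then show ?case
      by (simp add: distrib_left rep_add mult_single rep_single word_op_linear word_op_plus)
  qed
  then show ?case using 2 by (simp add: distrib_right rep_add rep_single)
qed

lemma word_op_in_vectors:
  assumes "\<xi> \<in> vectors"
  shows "word_op w \<xi> \<in> vectors"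
proof -
  obtain w' where w: "w = FM w'" by (cases w)
  have "support (word_op w \<xi>) \<subseteq> (\<lambda>x. the (act w' x)) ` support \<xi>"
  proof
    fix y assume "y \<in> support (word_op w \<xi>)"
    then obtain x where x: "y \<in> infinite_paths" "act (adj_list w') y = Some x" "x \<in> support \<xi>"
      by (auto simp: support_def w split: if_splits option.splits)
    then have "act w' x = Some y" using act_adj_list[of y "adj_list w'" x] by simp
    then show "y \<in> (\<lambda>x. the (act w' x)) ` support \<xi>" using x(3) by (intro image_eqI[of _ _ x]) auto
  qed
  then have "finite (support (word_op w \<xi>))"
    using assms by (auto intro: finite_subset)
  then show ?thesis by (auto simp: vectors_def support_def w split: if_splits)
qed

lemma rep_in_vectors:
  assumes "\<xi> \<in> vectors"
  shows "rep f \<xi> \<in> vectors"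
proof (induction f rule: free_star_algebra_induct)
  case 1
  then show ?case by (simp add: rep_zero vectors_def support_def)
next
  case (2 f k v)
  then show ?case
    by (simp add: rep_add rep_single vectors_add vectors_scale word_op_in_vectors assms)
qed

text \<open>Both sides sum over the graph of the partial injection \<open>act w\<close>, indexed
  once by the source and once by the target.\<close>

lemma inner_prod_word_op_adj:
  assumes "\<xi> \<in> vectors" "\<eta> \<in> vectors"
  shows "inner_prod (word_op (adj_word w) \<xi>) \<eta> = inner_prod \<xi> (word_op w \<eta>)"
proof -
  obtain w' where w: "w = FM w'" by (cases w)
  let ?f = "\<lambda>x. the (act w' x)" and ?g = "\<lambda>x. the (act (adj_list w') x)"
  have 1: "x \<in> infinite_paths \<and> (\<exists>y. act w' x = Some y \<and> act (adj_list w') y = Some x \<and> y \<in> infinite_paths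
      \<and> y \<in> support \<xi> \<and> word_op (adj_word w) \<xi> x = \<xi> y \<and> word_op w \<eta> y = \<eta> x)"
    if x: "x \<in> support (word_op (adj_word w) \<xi>) \<inter> support \<eta>" for x
  proof -
    obtain y where y: "x \<in> infinite_paths" "act w' x = Some y" "y \<in> support \<xi>"
      using x by (auto simp: support_def w adj_word_FM simp del: adj_word.simps split: if_splits option.splits)
    then show ?thesis
      using act_adj_list[of x w' y] act_in_paths[of x w' y] by (simp add: w adj_word_FM del: adj_word.simps)
  qed
  have 2: "y \<in> infinite_paths \<and> (\<exists>x. act (adj_list w') y = Some x \<and> act w' x = Some y \<and> x \<in> infinite_paths
      \<and> x \<in> support \<eta> \<and> word_op (adj_word w) \<xi> x = \<xi> y \<and> word_op w \<eta> y = \<eta> x)"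
    if y: "y \<in> support \<xi> \<inter> support (word_op w \<eta>)" for y
  proof -
    obtain x where x: "y \<in> infinite_paths" "act (adj_list w') y = Some x" "x \<in> support \<eta>"
      using y by (auto simp: support_def w split: if_splits option.splits)
    then show ?thesis
      using act_adj_list[of y "adj_list w'" x] act_in_paths[of y "adj_list w'" x]
      by (simp add: w adj_word_FM del: adj_word.simps)
  qed
  show ?thesis
    unfolding inner_prod_def
  proof (rule sum.reindex_bij_witness[where i = ?g and j = ?f])
    fix x assume x: "x \<in> support (word_op (adj_word w) \<xi>) \<inter> support \<eta>"
    from 1[OF x] show "?g (?f x) = x" by auto
    from 1[OF x] x show "?f x \<in> support \<xi> \<inter> support (word_op w \<eta>)" by (auto simp: support_def)
    from 1[OF x] show "cnj (\<xi> (?f x)) * word_op w \<eta> (?f x) = cnj (word_op (adj_word w) \<xi> x) * \<eta> x" by auto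
  next
    fix y assume y: "y \<in> support \<xi> \<inter> support (word_op w \<eta>)"
    from 2[OF y] show "?f (?g y) = y" by auto
    from 2[OF y] y show "?g y \<in> support (word_op (adj_word w) \<xi>) \<inter> support \<eta>" by (auto simp: support_def)
  qed
qed

lemma inner_prod_rep_adj:
  assumes "\<xi> \<in> vectors" "\<eta> \<in> vectors"
  shows "inner_prod (rep (adj f) \<xi>) \<eta> = inner_prod \<xi> (rep f \<eta>)"
proof (induction f rule: free_star_algebra_induct)
  case 1
  then show ?case by (simp add: adj_zero rep_zero inner_prod_def support_def)
next
  case (2 f k v)
  then show ?case
    using assms
    by (simp add: adj_add adj_single rep_add rep_single inner_prod_add_left inner_prod_add_right
        inner_prod_scale_left inner_prod_scale_right inner_prod_word_op_adj)
qed

text \<open>The values of \<open>word_op w \<xi>\<close> are values of \<open>\<xi>\<close> at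
  distinct points.\<close>

lemma l2_norm_word_op_le:
  assumes "\<xi> \<in> vectors"
  shows "l2_norm (word_op w \<xi>) \<le> l2_norm \<xi>"
proof -
  obtain w' where w: "w = FM w'" by (cases w)
  let ?g = "\<lambda>y. the (act (adj_list w') y)"
  let ?S = "support (word_op w \<xi>)"
  have 1: "\<exists>x. act (adj_list w') y = Some x \<and> act w' x = Some y \<and> x \<in> support \<xi> \<and> word_op w \<xi> y = \<xi> x"
    if y: "y \<in> ?S" for y
  proof -
    obtain x where x: "y \<in> infinite_paths" "act (adj_list w') y = Some x" "x \<in> support \<xi>"
      using y by (auto simp: support_def w split: if_splits option.splits)
    then show ?thesis using act_adj_list[of y "adj_list w'" x] by (simp add: w)
  qed
  have inj: "inj_on ?g ?S"
    by (rule inj_onI) (use 1 in \<open>metis option.sel\<close>)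
  have "(\<Sum>y\<in>?S. (cmod (word_op w \<xi> y))\<^sup>2) = (\<Sum>y\<in>?S. (cmod (\<xi> (?g y)))\<^sup>2)"
    by (rule sum.cong) (use 1 in force)+
  also have "\<dots> = (\<Sum>x\<in>?g ` ?S. (cmod (\<xi> x))\<^sup>2)"
    using inj by (simp add: sum.reindex)
  also have "\<dots> \<le> (\<Sum>x\<in>support \<xi>. (cmod (\<xi> x))\<^sup>2)"
    by (rule sum_mono2) (use assms 1 in force)+
  finally show ?thesis unfolding l2_norm_def L2_set_def by simp
qed

lemma rep_bounded: "\<exists>C. \<forall>\<xi>\<in>vectors. l2_norm (rep f \<xi>) \<le> C * l2_norm \<xi>"
proof (induction f rule: free_star_algebra_induct)
  case 1
  then show ?case by (intro exI[of _ 0]) (simp add: rep_zero l2_norm_def support_def)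
next
  case (2 f k v)
  then obtain C where C: "\<And>\<xi>. \<xi> \<in> vectors \<Longrightarrow> l2_norm (rep f \<xi>) \<le> C * l2_norm \<xi>" by blast
  have "l2_norm (rep (f + Poly_Mapping.single k v) \<xi>) \<le> (C + cmod v) * l2_norm \<xi>" if \<xi>: "\<xi> \<in> vectors" for \<xi>
  proof -
    have "l2_norm (rep (f + Poly_Mapping.single k v) \<xi>)
        \<le> l2_norm (rep f \<xi>) + l2_norm (\<lambda>y. v * word_op k \<xi> y)"
      unfolding rep_add rep_single
      by (rule l2_norm_triangle) (simp_all add: \<xi> rep_in_vectors vectors_scale word_op_in_vectors)
    also have "l2_norm (\<lambda>y. v * word_op k \<xi> y) = cmod v * l2_norm (word_op k \<xi>)"
      by (rule l2_norm_scale) (simp add: \<xi> word_op_in_vectors)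
    also have "\<dots> \<le> cmod v * l2_norm \<xi>"
      using l2_norm_word_op_le[OF \<xi>] by (intro mult_left_mono) auto
    finally show ?thesis using C[OF \<xi>] by (simp add: distrib_right)
  qed
  then show ?case by blast
qed

definition op_norm :: "'n free_star_algebra \<Rightarrow> real" where
  "op_norm f = Sup {l2_norm (rep f \<xi>) | \<xi>. \<xi> \<in> vectors \<and> l2_norm \<xi> \<le> 1}"

lemma zero_in_vectors: "(\<lambda>_. 0) \<in> vectors" "l2_norm (\<lambda>_. 0) = 0"
  by (simp_all add: vectors_def support_def l2_norm_def)

lemma op_norm_le:
  assumes "0 \<le> C" "\<And>\<xi>. \<xi> \<in> vectors \<Longrightarrow> l2_norm (rep f \<xi>) \<le> C * l2_norm \<xi>"
  shows "op_norm f \<le> C"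
  unfolding op_norm_def
proof (rule cSup_least)
  show "{l2_norm (rep f \<xi>) | \<xi>. \<xi> \<in> vectors \<and> l2_norm \<xi> \<le> 1} \<noteq> {}"
    using zero_in_vectors by (metis (mono_tags, lifting) empty_Collect_eq zero_le_one)
  fix r assume "r \<in> {l2_norm (rep f \<xi>) | \<xi>. \<xi> \<in> vectors \<and> l2_norm \<xi> \<le> 1}"
  then obtain \<xi> where \<xi>: "\<xi> \<in> vectors" "l2_norm \<xi> \<le> 1" "r = l2_norm (rep f \<xi>)" by auto
  have "r \<le> C * l2_norm \<xi>" using assms(2) \<xi> by simp
  also have "\<dots> \<le> C" using assms(1) \<xi>(2) by (simp add: mult_left_le)
  finally show "r \<le> C" .
qed

lemma op_norm_upper:
  assumes "\<xi> \<in> vectors" "l2_norm \<xi> \<le> 1"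
  shows "l2_norm (rep f \<xi>) \<le> op_norm f"
  unfolding op_norm_def
proof (rule cSup_upper)
  obtain C where C: "\<And>\<xi>. \<xi> \<in> vectors \<Longrightarrow> l2_norm (rep f \<xi>) \<le> C * l2_norm \<xi>" using rep_bounded by blast
  have "l2_norm (rep f \<xi>) \<le> \<bar>C\<bar>" if "\<xi> \<in> vectors" "l2_norm \<xi> \<le> 1" for \<xi>
  proof -
    have "l2_norm (rep f \<xi>) \<le> \<bar>C\<bar> * l2_norm \<xi>"
      using C[OF that(1)] by (meson abs_ge_self l2_norm_nonneg mult_right_mono order_trans)
    also have "\<dots> \<le> \<bar>C\<bar>" using that(2) by (simp add: mult_left_le)
    finally show ?thesis .
  qed
  then show "bdd_above {l2_norm (rep f \<xi>) | \<xi>. \<xi> \<in> vectors \<and> l2_norm \<xi> \<le> 1}"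
    by (intro bdd_aboveI[of _ "\<bar>C\<bar>"]) auto
qed (use assms in auto)

lemma op_norm_nonneg: "0 \<le> op_norm f"
proof -
  have "l2_norm (rep f (\<lambda>_. 0)) \<le> op_norm f"
    by (rule op_norm_upper) (simp_all add: zero_in_vectors)
  then show ?thesis using l2_norm_nonneg order_trans by blast
qed

lemma op_norm_bound:
  assumes "\<xi> \<in> vectors"
  shows "l2_norm (rep f \<xi>) \<le> op_norm f * l2_norm \<xi>"
proof (cases "l2_norm \<xi> = 0")
  case True
  then have "\<xi> = (\<lambda>_. 0)" using assms by (simp add: l2_norm_eq_0_iff)
  moreover have "rep f (\<lambda>_. 0) = (\<lambda>_. 0)" by (simp add: rep_linear fun_eq_iff)
  ultimately show ?thesis by (simp add: zero_in_vectors)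
next
  case False
  define c where "c = inverse (l2_norm \<xi>)"
  have pos: "0 < l2_norm \<xi>" using False l2_norm_nonneg[of \<xi>] by linarith
  then have c: "c > 0" by (simp add: c_def)
  have "l2_norm (rep f (\<lambda>x. complex_of_real c * \<xi> x)) \<le> op_norm f"
    by (rule op_norm_upper) (use assms pos in \<open>simp_all add: vectors_scale l2_norm_scale c_def norm_inverse\<close>)
  moreover have "rep f (\<lambda>x. complex_of_real c * \<xi> x) = (\<lambda>y. complex_of_real c * rep f \<xi> y)"
    by (simp add: rep_linear fun_eq_iff)
  moreover have "l2_norm (\<lambda>y. complex_of_real c * rep f \<xi> y) = c * l2_norm (rep f \<xi>)"
    using c assms by (subst l2_norm_scale) (simp_all add: rep_in_vectors)
  ultimately have "c * l2_norm (rep f \<xi>) \<le> op_norm f" by simp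
  then show ?thesis using pos by (simp add: c_def field_simps)
qed

lemma op_norm_add: "op_norm (f + g) \<le> op_norm f + op_norm g"
proof (rule op_norm_le)
  fix \<xi> assume \<xi>: "\<xi> \<in> vectors"
  have "l2_norm (rep (f + g) \<xi>) \<le> l2_norm (rep f \<xi>) + l2_norm (rep g \<xi>)"
    unfolding rep_add by (rule l2_norm_triangle) (simp_all add: rep_in_vectors \<xi>)
  then show "l2_norm (rep (f + g) \<xi>) \<le> (op_norm f + op_norm g) * l2_norm \<xi>"
    using op_norm_bound[OF \<xi>, of f] op_norm_bound[OF \<xi>, of g] by (simp add: distrib_right)
qed (simp add: op_norm_nonneg)

lemma op_norm_mult: "op_norm (f * g) \<le> op_norm f * op_norm g"
proof (rule op_norm_le)
  fix \<xi> assume \<xi>: "\<xi> \<in> vectors"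
  have "l2_norm (rep f (rep g \<xi>)) \<le> op_norm f * l2_norm (rep g \<xi>)"
    by (rule op_norm_bound) (simp add: rep_in_vectors \<xi>)
  also have "\<dots> \<le> op_norm f * (op_norm g * l2_norm \<xi>)"
    by (intro mult_left_mono op_norm_bound \<xi> op_norm_nonneg)
  finally show "l2_norm (rep (f * g) \<xi>) \<le> op_norm f * op_norm g * l2_norm \<xi>"
    by (simp add: rep_mult mult.assoc)
qed (simp add: op_norm_nonneg)

lemma rep_scal: "rep (scal c f) \<xi> = (\<lambda>y. c * rep f \<xi> y)"
proof
  fix y
  have "Poly_Mapping.keys (scal c f) \<subseteq> Poly_Mapping.keys f" by (auto simp: in_keys_iff lookup_scal)
  then show "rep (scal c f) \<xi> y = c * rep f \<xi> y"
    by (simp add: rep_eq_sum[of "Poly_Mapping.keys f"] lookup_scal sum_distrib_left mult.assoc)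
qed

lemma op_norm_scal: "op_norm (scal c f) = cmod c * op_norm f"
proof -
  have le: "op_norm (scal c f) \<le> cmod c * op_norm f" for c f
  proof (rule op_norm_le)
    fix \<xi> assume \<xi>: "\<xi> \<in> vectors"
    have "l2_norm (rep (scal c f) \<xi>) = cmod c * l2_norm (rep f \<xi>)"
      unfolding rep_scal by (rule l2_norm_scale) (simp add: \<xi> rep_in_vectors)
    then show "l2_norm (rep (scal c f) \<xi>) \<le> cmod c * op_norm f * l2_norm \<xi>"
      using op_norm_bound[OF \<xi>, of f] by (simp add: mult_left_mono mult.assoc)
  qed (simp add: op_norm_nonneg)
  show ?thesis
  proof (cases "c = 0")
    case True
    then show ?thesis using le[of 0 f] op_norm_nonneg[of "scal c f"] by simp
  next
    case False
    have "scal (inverse c) (scal c f) = f"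
      using False by (intro poly_mapping_eqI) (simp add: lookup_scal)
    then have "op_norm f \<le> cmod (inverse c) * op_norm (scal c f)" using le[of "inverse c" "scal c f"] by simp
    then have "cmod c * op_norm f \<le> op_norm (scal c f)"
      using False by (simp add: norm_inverse norm_divide field_simps)
    then show ?thesis using le[of c f] by simp
  qed
qed

text \<open>With \<open>g = adj f * f\<close>, Cauchy-Schwarz bounds the square of the norm of
  \<open>rep f \<xi>\<close>, which is the inner product of \<open>rep g \<xi>\<close> with
  \<open>\<xi>\<close>, by \<open>op_norm g\<close> times the squared norm of \<open>\<xi>\<close>.
  Submultiplicativity then gives \<open>op_norm f \<le> op_norm (adj f)\<close>; applied to
  \<open>adj f\<close> as well, this is an equality, and it closes the circle of estimates.\<close>

lemma op_norm_adj_mult: "op_norm (adj f * f) = (op_norm f)\<^sup>2"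
proof -
  have sq: "(op_norm f)\<^sup>2 \<le> op_norm (adj f * f)" for f
  proof -
    have "op_norm f \<le> sqrt (op_norm (adj f * f))"
    proof (rule op_norm_le)
      fix \<xi> assume \<xi>: "\<xi> \<in> vectors"
      have v: "rep f \<xi> \<in> vectors" "rep (adj f * f) \<xi> \<in> vectors" using \<xi> rep_in_vectors by auto
      have "complex_of_real ((l2_norm (rep f \<xi>))\<^sup>2) = inner_prod (rep f \<xi>) (rep f \<xi>)"
        using v by (simp add: inner_prod_self)
      also have "\<dots> = inner_prod (rep (adj f * f) \<xi>) \<xi>"
        using inner_prod_rep_adj[OF v(1) \<xi>, of f] by (simp add: rep_mult)
      finally have "(l2_norm (rep f \<xi>))\<^sup>2 = cmod (inner_prod (rep (adj f * f) \<xi>) \<xi>)"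
        by (metis abs_of_nonneg norm_of_real zero_le_power2)
      also have "\<dots> \<le> l2_norm (rep (adj f * f) \<xi>) * l2_norm \<xi>"
        by (rule norm_inner_prod_le) (use v \<xi> in auto)
      also have "\<dots> \<le> (op_norm (adj f * f) * l2_norm \<xi>) * l2_norm \<xi>"
        by (intro mult_right_mono op_norm_bound \<xi>) simp
      finally have "l2_norm (rep f \<xi>) \<le> sqrt (op_norm (adj f * f) * (l2_norm \<xi>)\<^sup>2)"
        by (intro real_le_rsqrt) (simp add: power2_eq_square mult.assoc)
      then show "l2_norm (rep f \<xi>) \<le> sqrt (op_norm (adj f * f)) * l2_norm \<xi>"
        by (simp add: real_sqrt_mult)
    qed (simp add: op_norm_nonneg)
    then have "(op_norm f)\<^sup>2 \<le> (sqrt (op_norm (adj f * f)))\<^sup>2"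
      by (intro power_mono op_norm_nonneg)
    then show ?thesis by (simp add: op_norm_nonneg)
  qed
  have le: "op_norm f \<le> op_norm (adj f)" for f
  proof (cases "op_norm f = 0")
    case False
    have "op_norm f * op_norm f \<le> op_norm (adj f) * op_norm f"
      using sq[of f] op_norm_mult[of "adj f" f] by (simp add: power2_eq_square)
    then show ?thesis using False op_norm_nonneg[of f] by (simp add: mult_le_cancel_right)
  qed (simp add: op_norm_nonneg)
  have "op_norm (adj f) = op_norm f" using le[of f] le[of "adj f"] by (simp add: adj_adj)
  then show ?thesis using sq[of f] op_norm_mult[of "adj f" f] by (simp add: power2_eq_square)
qed

lemma op_norm_eq_0:
  assumes "\<And>\<xi>. \<xi> \<in> vectors \<Longrightarrow> rep f \<xi> = (\<lambda>_. 0)"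
  shows "op_norm f = 0"
  using op_norm_le[of 0 f] op_norm_nonneg[of f] assms by (simp add: zero_in_vectors)

lemma case_nat_shift: "case_nat (y 0) (y \<circ> Suc) = y"
  "case_nat (y 0) (y \<circ> Suc) \<circ> Suc = y \<circ> Suc"
  by (simp_all add: fun_eq_iff split: nat.splits)

lemma rep_diff_eq_0:
  assumes "rep f \<xi> = rep g \<xi>"
  shows "rep (f - g) \<xi> = (\<lambda>_. 0)"
proof -
  have "rep f \<xi> = (\<lambda>y. rep (f - g) \<xi> y + rep g \<xi> y)"
    using rep_add[of "f - g" g \<xi>] by simp
  then show ?thesis using assms by (simp add: fun_eq_iff)
qed

lemma rep_sum: "rep (\<Sum>i\<in>I. f i) \<xi> = (\<lambda>y. \<Sum>i\<in>I. rep (f i) \<xi> y)"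
  by (induction I rule: infinite_finite_induct) (simp_all add: rep_zero rep_add)

lemma gen_products:
  "gen i * adj (gen i) = Poly_Mapping.single (FM [Beta i, Alpha i]) 1"
  "adj (gen i) * gen i = Poly_Mapping.single (FM [Alpha i, Beta i]) 1"
  "gen i * adj (gen i) * gen i = Poly_Mapping.single (FM [Beta i, Alpha i, Beta i]) 1"
  by (simp_all add: adj_gen gen_def adj_single mult_single)

lemma rep_range_projection:
  "rep (Poly_Mapping.single (FM [Beta i, Alpha i]) 1) \<xi> y = (if y \<in> infinite_paths \<and> y 0 = i then \<xi> y else 0)"
proof -
  have "A $ y 0 $ y (Suc 0) \<noteq> 0" if "y \<in> infinite_paths" using that by (simp add: infinite_paths_def)
  then show ?thesis by (auto simp: rep_single case_nat_shift)
qed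

lemma rep_source_projection:
  "rep (Poly_Mapping.single (FM [Alpha i, Beta i]) 1) \<xi> y
    = (if y \<in> infinite_paths \<and> A $ i $ y 0 \<noteq> 0 then \<xi> y else 0)"
  by (simp add: rep_single comp_def)

lemma rep_relation:
  assumes "r \<in> ck_relations A" "\<xi> \<in> vectors"
  shows "rep r \<xi> = (\<lambda>_. 0)"
proof -
  \<comment> \<open>Words act as 0 away from \<open>infinite_paths\<close>, so the unit relation
    holds because the vectors vanish there too.\<close>
  have supp: "\<xi> y = 0" if "y \<notin> infinite_paths" for y
    using assms(2) that by (auto simp: vectors_def support_def)
  from assms(1) consider (1) i where "r = gen i * adj (gen i) * gen i - gen i"
    | (2) "r = (\<Sum>j\<in>UNIV. gen j * adj (gen j)) - 1"
    | (3) i where "r = adj (gen i) * gen i - (\<Sum>j\<in>UNIV. of_nat (A $ i $ j) * (gen j * adj (gen j)))"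
    by (auto simp: ck_relations_def)
  then show ?thesis
  proof cases
    case 1
    have "rep (gen i * adj (gen i) * gen i) \<xi> y = rep (gen i) \<xi> y" for y
    proof -
      have "A $ y 0 $ y (Suc 0) \<noteq> 0" if "y \<in> infinite_paths" using that by (simp add: infinite_paths_def)
      then show ?thesis unfolding gen_products(3) by (auto simp: gen_def rep_single case_nat_shift)
    qed
    then show ?thesis unfolding 1 by (intro rep_diff_eq_0) (simp add: fun_eq_iff)
  next
    case 2
    have "rep 1 \<xi> y = \<xi> y" for y
      using supp by (auto simp: single_one[symmetric] rep_single zero_free_monoid_def simp del: single_one)
    moreover have "rep (\<Sum>j\<in>UNIV. gen j * adj (gen j)) \<xi> y = \<xi> y" for y
    proof -
      have "rep (\<Sum>j\<in>UNIV. gen j * adj (gen j)) \<xi> y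
          = (\<Sum>j\<in>UNIV. if j = y 0 then if y \<in> infinite_paths then \<xi> y else 0 else 0)"
        by (auto simp: rep_sum gen_products rep_range_projection intro!: sum.cong)
      then show ?thesis using supp[of y] by simp
    qed
    ultimately show ?thesis unfolding 2 by (intro rep_diff_eq_0) (simp add: fun_eq_iff)
  next
    case 3
    have "rep (\<Sum>j\<in>UNIV. of_nat (A $ i $ j) * (gen j * adj (gen j))) \<xi> y
        = (\<Sum>j\<in>UNIV. if j = y 0 then if y \<in> infinite_paths \<and> A $ i $ j \<noteq> 0 then \<xi> y else 0 else 0)" for y
      unfolding rep_sum
    proof (rule sum.cong[OF refl])
      fix j
      show "rep (of_nat (A $ i $ j) * (gen j * adj (gen j))) \<xi> y
        = (if j = y 0 then if y \<in> infinite_paths \<and> A $ i $ j \<noteq> 0 then \<xi> y else 0 else 0)"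
        using zero_one[of i j] by (auto simp: gen_products rep_range_projection rep_zero)
    qed
    then show ?thesis unfolding 3 by (intro rep_diff_eq_0) (simp add: fun_eq_iff gen_products rep_source_projection)
  qed
qed

lemma op_norm_in_ck_seminorms: "op_norm \<in> ck_seminorms A"
proof -
  have "op_norm r = 0" if "r \<in> ck_relations A" for r
    by (rule op_norm_eq_0, rule rep_relation[OF that])
  then show ?thesis
    by (simp add: ck_seminorms_def cstar_seminorm_def op_norm_nonneg op_norm_add op_norm_scal
        op_norm_mult op_norm_adj_mult)
qed

text \<open>The point mass at a path on which \<open>w\<close> acts has a nonzero image, so
  \<open>op_norm\<close>, one of the seminorms under the supremum, does not vanish on
  \<open>w\<close>.\<close>

lemma live_imp_not_ck_zero:
  assumes "live w"
  shows "\<not> ck_zero A (Poly_Mapping.single (FM w) 1)"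
proof -
  obtain x y where x: "x \<in> infinite_paths" "act w x = Some y" using assms by (auto simp: live_def)
  define \<delta> :: "(nat \<Rightarrow> 'n) \<Rightarrow> complex" where "\<delta> = (\<lambda>z. if z = x then 1 else 0)"
  have supp: "support \<delta> = {x}" by (auto simp: support_def \<delta>_def)
  then have v: "\<delta> \<in> vectors" using x(1) unfolding vectors_def by simp
  have "rep (Poly_Mapping.single (FM w) 1) \<delta> y = 1"
    unfolding rep_single word_op.simps act_adj_list[OF x] using act_in_paths[OF x] by (simp add: \<delta>_def)
  then have "rep (Poly_Mapping.single (FM w) 1) \<delta> \<noteq> (\<lambda>_. 0)"
    by (metis zero_neq_one)
  then have "0 < l2_norm (rep (Poly_Mapping.single (FM w) 1) \<delta>)"
    using rep_in_vectors[OF v] by (simp add: l2_norm_eq_0_iff less_le)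
  moreover have "l2_norm (rep (Poly_Mapping.single (FM w) 1) \<delta>) \<le> op_norm (Poly_Mapping.single (FM w) 1)"
    by (rule op_norm_upper[OF v]) (simp add: l2_norm_def supp, simp add: \<delta>_def)
  ultimately show ?thesis
    using ck_norm_greatest[OF op_norm_in_ck_seminorms, of "Poly_Mapping.single (FM w) 1"]
    by (simp add: ck_zero_def)
qed

end

section \<open>Orthogonality of projections under a C*-seminorm\<close>

locale cstar =
  fixes p :: "'n free_star_algebra \<Rightarrow> real"
  assumes seminorm: "cstar_seminorm p"
begin

lemma nonneg [simp]: "0 \<le> p x"
  and triangle: "p (x + y) \<le> p x + p y"
  and p_scal: "p (scal c x) = cmod c * p x"
  and submult: "p (x * y) \<le> p x * p y"
  and p_adj_mult: "p (adj x * x) = (p x)\<^sup>2"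
  using seminorm by (auto simp: cstar_seminorm_def)

lemma p_zero [simp]: "p 0 = 0"
proof -
  have "scal 0 0 = (0 :: 'n free_star_algebra)" by (simp add: scal_conv_mult)
  then show ?thesis using p_scal[of 0 0] by simp
qed

lemma p_uminus [simp]: "p (- x) = p x"
proof -
  have "- x = scal (- 1) x" by (rule poly_mapping_eqI) (simp add: lookup_scal)
  then show ?thesis by (simp add: p_scal)
qed

lemma p_diff: "p (x - y) \<le> p x + p y"
  using triangle[of x "- y"] by simp

text \<open>That the involution is isometric follows from the C*-identity and
  submultiplicativity.\<close>

lemma p_adj: "p (adj x) = p x"
proof -
  have le: "p x \<le> p (adj x)" for x
  proof (cases "p x = 0")
    case False
    have "p x * p x \<le> p (adj x) * p x"
      using submult[of "adj x" x] by (simp add: p_adj_mult power2_eq_square)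
    then show ?thesis using False nonneg[of x] by (simp add: mult_le_cancel_right)
  qed simp
  from le[of x] le[of "adj x"] show ?thesis by (simp add: adj_adj)
qed

lemma p_le_0 [simp]: "p x \<le> 0 \<longleftrightarrow> p x = 0"
  using nonneg[of x] by linarith

text \<open>Equality in the Hausdorff quotient by the seminorm. Being a congruence for all
  operations, it lets computations in the C*-algebra be written in the free *-algebra.\<close>

definition eqv :: "'n free_star_algebra \<Rightarrow> 'n free_star_algebra \<Rightarrow> bool" (infix \<open>\<doteq>\<close> 50) where
  "x \<doteq> y \<longleftrightarrow> p (x - y) = 0"

lemma eqv_refl [simp]: "x \<doteq> x"
  by (simp add: eqv_def)

lemma eqv_sym: "x \<doteq> y \<Longrightarrow> y \<doteq> x"
  using p_uminus[of "x - y"] by (simp add: eqv_def)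

lemma eqv_trans [trans]: "x \<doteq> y \<Longrightarrow> y \<doteq> z \<Longrightarrow> x \<doteq> z"
  using triangle[of "x - y" "y - z"] nonneg[of "x - z"] by (simp add: eqv_def)

lemma eqv_eq: "x \<doteq> y \<Longrightarrow> p x = p y"
  using triangle[of "x - y" y] triangle[of "y - x" x] p_uminus[of "x - y"] by (simp add: eqv_def)

lemma eqv_add: "x \<doteq> x' \<Longrightarrow> y \<doteq> y' \<Longrightarrow> x + y \<doteq> x' + y'"
  using triangle[of "x - x'" "y - y'"] by (simp add: eqv_def add_diff_add)

lemma eqv_diff: "x \<doteq> x' \<Longrightarrow> y \<doteq> y' \<Longrightarrow> x - y \<doteq> x' - y'"
  using eqv_add[of x x' "- y" "- y'"] p_uminus[of "y - y'"] by (simp add: eqv_def)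

lemma eqv_scal: "x \<doteq> y \<Longrightarrow> scal c x \<doteq> scal c y"
  using p_scal[of c "x - y"] by (simp add: eqv_def scal_conv_mult right_diff_distrib)

lemma eqv_mult:
  assumes "x \<doteq> x'" "y \<doteq> y'"
  shows "x * y \<doteq> x' * y'"
proof -
  have "x * y - x' * y' = (x - x') * y + x' * (y - y')" by (simp add: algebra_simps)
  then have "p (x * y - x' * y') \<le> p (x - x') * p y + p x' * p (y - y')"
    using triangle[of "(x - x') * y" "x' * (y - y')"] submult[of "x - x'" y] submult[of x' "y - y'"]
    by simp
  then show ?thesis using assms by (simp add: eqv_def)
qed

lemma eqv_sum: "(\<And>i. i \<in> I \<Longrightarrow> f i \<doteq> g i) \<Longrightarrow> (\<Sum>i\<in>I. f i) \<doteq> (\<Sum>i\<in>I. g i)"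
  by (induction I rule: infinite_finite_induct) (auto intro: eqv_add)

lemma eqv_adj: "x \<doteq> y \<Longrightarrow> adj x \<doteq> adj y"
proof -
  have "adj x - adj y = adj (x - y)"
    using adj_add[of "x - y" y] by simp
  then show "x \<doteq> y \<Longrightarrow> adj x \<doteq> adj y" by (simp add: eqv_def p_adj)
qed

lemma projection_le_1:
  assumes "adj q = q" "q * q \<doteq> q"
  shows "p q \<le> 1"
proof -
  have "(p q)\<^sup>2 = p q" using p_adj_mult[of q] eqv_eq[OF assms(2)] assms(1) by simp
  then show ?thesis by (auto simp: power2_eq_square)
qed

lemma scal_rules:
  "scal c (x + y) = scal c x + scal c y" "scal c x + scal d x = scal (c + d) x"
  "scal c x * y = scal c (x * y)" "x * scal c y = scal c (x * y)" "scal c (scal d x) = scal (c * d) x"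
  "scal 1 x = x" "scal 0 x = 0"
proof -
  show "scal c (x + y) = scal c x + scal c y" "scal c x * y = scal c (x * y)"
    by (simp_all add: scal_conv_mult distrib_left mult.assoc)
  show "scal c x + scal d x = scal (c + d) x" "scal c (scal d x) = scal (c * d) x"
    "scal 1 x = x" "scal 0 x = 0"
    by (rule poly_mapping_eqI, simp add: lookup_scal lookup_add algebra_simps)+
  have "x * Poly_Mapping.single 0 c = Poly_Mapping.single 0 c * x"
  proof (induction x rule: free_star_algebra_induct)
    case (2 f k v)
    then show ?case by (simp add: distrib_left distrib_right mult_single mult.commute)
  qed simp
  then show "x * scal c y = scal c (x * y)"
    unfolding scal_conv_mult by (metis mult.assoc)
qed

lemma adj_scal: "adj (scal c x) = scal (cnj c) (adj x)"
  by (rule poly_mapping_eqI) (simp add: lookup_adj lookup_scal)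

text \<open>In a C*-algebra the two norm bounds say that the spectrum of \<open>a\<close> is nonnegative and nonpositive.
  Without spectral theory: \<open>\<parallel>e + w a\<parallel> \<le> 1\<close> for \<open>w\<close> and \<open>\<i> w\<close> gives the same bound for \<open>(1 + \<i>) w\<close>,
  because the mean of the squares of \<open>e + w a\<close> and \<open>e + \<i> w a\<close> is \<open>e + (1 + \<i>) w a\<close>.\<close>

lemma selfadjoint_null:
  assumes e: "adj e = e" "e * e \<doteq> e" and a: "adj a = a" "e * a \<doteq> a" "a * e \<doteq> a"
    and t: "0 < t" "t \<le> 1"
    and minus: "p (e - a) \<le> 1" and plus: "p (e + scal (complex_of_real t) a) \<le> 1"
  shows "p a = 0"
proof -
  define u where "u c = e + scal c a" for c
  have mult: "u c * u d \<doteq> e + scal (c + d) a + scal (c * d) (a * a)" for c d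
  proof -
    have "u c * u d = e * e + (scal d (e * a) + scal c (a * e)) + scal (c * d) (a * a)"
      by (simp add: u_def distrib_left distrib_right scal_rules ac_simps)
    also have "\<dots> \<doteq> e + (scal d a + scal c a) + scal (c * d) (a * a)"
      by (intro eqv_add eqv_scal e a eqv_refl)
    finally show ?thesis by (simp add: scal_rules add.commute)
  qed
  have mean: "p (e + scal ((c + d) / 2 + (c' + d') / 2) a + scal ((c * d + c' * d') / 2) (a * a)) \<le> 1"
    if "p (u c) \<le> 1" "p (u d) \<le> 1" "p (u c') \<le> 1" "p (u d') \<le> 1" for c d c' d'
  proof -
    have half: "scal (1/2) e + scal (1/2) e = e" by (simp add: scal_rules(2,6))
    have "scal (1/2) (u c * u d) + scal (1/2) (u c' * u d')
      \<doteq> scal (1/2) (e + scal (c + d) a + scal (c * d) (a * a))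
        + scal (1/2) (e + scal (c' + d') a + scal (c' * d') (a * a))"
      by (intro eqv_add eqv_scal mult)
    also have "\<dots> = (scal (1/2) e + scal (1/2) e) + (scal ((c + d) / 2) a + scal ((c' + d') / 2) a)
        + (scal ((c * d) / 2) (a * a) + scal ((c' * d') / 2) (a * a))"
      by (simp add: scal_rules(1,5) ac_simps)
    also have "\<dots> = e + scal ((c + d) / 2 + (c' + d') / 2) a + scal ((c * d + c' * d') / 2) (a * a)"
      by (simp only: half) (simp only: scal_rules(2) add_divide_distrib)
    finally have "p (e + scal ((c + d) / 2 + (c' + d') / 2) a + scal ((c * d + c' * d') / 2) (a * a))
      = p (scal (1/2) (u c * u d) + scal (1/2) (u c' * u d'))"
      using eqv_eq by metis
    also have "\<dots> \<le> p (u c * u d) / 2 + p (u c' * u d') / 2"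
      using triangle[of "scal (1/2) (u c * u d)" "scal (1/2) (u c' * u d')"] by (simp add: p_scal norm_divide)
    also have "\<dots> \<le> 1"
    proof -
      have "p (u c * u d) \<le> 1" "p (u c' * u d') \<le> 1"
        using submult[of "u c" "u d"] submult[of "u c'" "u d'"] that
        by (meson mult_le_one nonneg order_trans)+
      then show ?thesis by simp
    qed
    finally show ?thesis .
  qed
  have e1: "p e \<le> 1" using projection_le_1 e .
  have pos: "p (u (complex_of_real t)) \<le> 1" using plus by (simp add: u_def)
  \<comment> \<open>\<open>e - t a\<close> is a convex combination of \<open>e\<close> and
    \<open>e - a\<close>, which is where \<open>t \<le> 1\<close> enters.\<close>
  have neg: "p (u (- complex_of_real t)) \<le> 1"
  proof -
    have "u (- complex_of_real t) = scal (complex_of_real (1 - t)) e + scal (complex_of_real t) (e - a)"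
      by (rule poly_mapping_eqI) (simp add: u_def lookup_scal lookup_add lookup_minus algebra_simps)
    then have "p (u (- complex_of_real t)) \<le> (1 - t) * p e + t * p (e - a)"
      using triangle[of "scal (complex_of_real (1 - t)) e" "scal (complex_of_real t) (e - a)"] t
      by (simp only: p_scal norm_of_real)
    also have "\<dots> \<le> (1 - t) * 1 + t * 1"
      using t e1 minus by (intro add_mono mult_left_mono) auto
    finally show ?thesis by simp
  qed
  \<comment> \<open>The linear terms of the squares of \<open>e + t a\<close> and
    \<open>e - t a\<close> cancel in their mean.\<close>
  have square: "p (e + scal (complex_of_real (t\<^sup>2)) (a * a)) \<le> 1"
    using mean[OF pos pos neg neg] by (simp add: scal_rules power2_eq_square)
  \<comment> \<open>As \<open>a\<close> is selfadjoint, the product of \<open>e + \<i> s t a\<close>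
    with its adjoint has no linear term either, and the C*-identity reduces the bound to
    \<open>square\<close>.\<close>
  have imaginary: "p (u (\<i> * complex_of_real (s * t))) \<le> 1" if "s\<^sup>2 = 1" for s
  proof -
    have "(p (u (\<i> * complex_of_real (s * t))))\<^sup>2
        = p (u (- \<i> * complex_of_real (s * t)) * u (\<i> * complex_of_real (s * t)))"
      unfolding p_adj_mult[symmetric] by (simp add: u_def adj_add adj_scal e a)
    also have "\<dots> = p (e + scal (complex_of_real ((s * t)\<^sup>2)) (a * a))"
      using eqv_eq[OF mult[of "- \<i> * complex_of_real (s * t)" "\<i> * complex_of_real (s * t)"]]
      by (simp add: scal_rules power2_eq_square algebra_simps flip: of_real_mult)
    also have "\<dots> \<le> 1" using square that by (simp add: power_mult_distrib)
    finally show ?thesis by (simp add: abs_square_le_1)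
  qed
  have all: "p (u ((1 + \<i>) ^ k * w * complex_of_real t)) \<le> 1" if "w \<in> {1, -1, \<i>, -\<i>}" for k w
    using that
  proof (induction k arbitrary: w)
    case 0
    then show ?case using pos neg imaginary[of 1] imaginary[of "-1"] by auto
  next
    case (Suc k)
    let ?c = "(1 + \<i>) ^ k * w * complex_of_real t" and ?d = "(1 + \<i>) ^ k * (\<i> * w) * complex_of_real t"
    have halves: "(c + c) / 2 = c" for c :: complex by simp
    have "\<i> * w \<in> {1, -1, \<i>, -\<i>}" using Suc.prems by auto
    then have "p (u ?c) \<le> 1" "p (u ?d) \<le> 1" using Suc by blast+
    from mean[OF this(1,1) this(2,2)]
    have "p (e + scal (?c + ?d) a + scal ((?c * ?c + ?d * ?d) / 2) (a * a)) \<le> 1"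
      by (simp only: halves)
    moreover have "?c * ?c + ?d * ?d = 0" by (simp add: algebra_simps)
    moreover have "?c + ?d = (1 + \<i>) ^ Suc k * w * complex_of_real t" by (simp add: algebra_simps)
    ultimately show ?case by (simp only: u_def scal_rules(7) div_0 add_0_right)
  qed
  \<comment> \<open>The coefficient of \<open>a\<close> has modulus growing like the powers of the
    square root of 2, while the norm of the sum with \<open>e\<close> stays at most 1; hence the
    norm of \<open>a\<close> must be 0.\<close>
  have bound: "cmod (1 + \<i>) ^ k * (t * p a) \<le> 2" for k
  proof -
    have "scal ((1 + \<i>) ^ k * complex_of_real t) a = u ((1 + \<i>) ^ k * complex_of_real t) - e"
      by (simp add: u_def)
    then have "p (scal ((1 + \<i>) ^ k * complex_of_real t) a) \<le> 2"
      using p_diff[of "u ((1 + \<i>) ^ k * complex_of_real t)" e] all[of 1 k] e1 by simp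
    then show ?thesis using t by (simp add: p_scal norm_mult norm_power mult.assoc)
  qed
  show ?thesis
  proof (rule ccontr)
    assume "p a \<noteq> 0"
    then have "0 < t * p a" using t nonneg[of a] by (simp add: less_le)
    moreover have "1 < cmod (1 + \<i>)" by (simp add: cmod_def)
    then obtain k where "2 / (t * p a) < cmod (1 + \<i>) ^ k" using real_arch_pow by blast
    ultimately show False using bound[of k] by (simp add: field_simps)
  qed
qed

end

section \<open>Consequences of the relations in the Cuntz-Krieger algebra\<close>

definition word_elem :: "'n letter list \<Rightarrow> 'n free_star_algebra" where
  "word_elem w = Poly_Mapping.single (FM w) 1"

lemma word_elem_append: "word_elem (u @ v) = word_elem u * word_elem v"
  by (simp add: word_elem_def mult_single)

lemma word_elem_Nil: "word_elem [] = 1"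
  unfolding word_elem_def zero_free_monoid_def[symmetric] by simp

lemma adj_word_elem: "adj (word_elem w) = word_elem (adj_list w)"
  by (simp add: word_elem_def adj_single adj_word_FM del: adj_word.simps)

lemma prod_list_phi: "prod_list (map phi w) = word_elem w"
proof (induction w)
  case Nil
  then show ?case by (simp add: word_elem_Nil)
next
  case (Cons a w)
  have "phi a = word_elem [a]"
  proof (cases a)
    case (Alpha i)
    then show ?thesis using adj_gen[of i] by (simp add: word_elem_def)
  qed (simp add: word_elem_def gen_def)
  then show ?case using Cons word_elem_append[of "[a]" w] by simp
qed

context transition_matrix
begin

text \<open>The supremum of the seminorms respecting the relations is again a C*-seminorm, so the
  computations are carried out once, for \<open>ck_norm A\<close>; there \<open>\<doteq>\<close> is
  equality in the Cuntz-Krieger algebra.\<close>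

sublocale ck: cstar "ck_norm A"
  by unfold_locales (rule cstar_seminorm_ck_norm)

notation ck.eqv (infix \<open>\<doteq>\<close> 50)

lemma word_elem_gen:
  "gen i = word_elem [Beta i]"
  by (simp add: word_elem_def gen_def)

lemma word_elem_partial_isometry:
  "word_elem [Beta i, Alpha i, Beta i] \<doteq> word_elem [Beta i]"
  "word_elem [Alpha i, Beta i, Alpha i] \<doteq> word_elem [Alpha i]"
proof -
  have "gen i * adj (gen i) * gen i - gen i \<in> ck_relations A" by (auto simp: ck_relations_def)
  then show *: "word_elem [Beta i, Alpha i, Beta i] \<doteq> word_elem [Beta i]"
    using ck_norm_relations by (simp add: ck.eqv_def word_elem_gen adj_word_elem word_elem_append[symmetric])
  show "word_elem [Alpha i, Beta i, Alpha i] \<doteq> word_elem [Alpha i]"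
    using ck.eqv_adj[OF *] by (simp add: adj_word_elem)
qed

lemma sum_range_projections: "(\<Sum>j\<in>UNIV. word_elem [Beta j, Alpha j]) \<doteq> 1"
proof -
  have "(\<Sum>j\<in>UNIV. gen j * adj (gen j)) - 1 \<in> ck_relations A" by (auto simp: ck_relations_def)
  then show ?thesis
    using ck_norm_relations by (simp add: ck.eqv_def word_elem_gen adj_word_elem word_elem_append[symmetric])
qed

lemma source_projection:
  "word_elem [Alpha i, Beta i] \<doteq> (\<Sum>j\<in>UNIV. of_nat (A $ i $ j) * word_elem [Beta j, Alpha j])"
proof -
  have "adj (gen i) * gen i - (\<Sum>j\<in>UNIV. of_nat (A $ i $ j) * (gen j * adj (gen j))) \<in> ck_relations A"
    by (auto simp: ck_relations_def)
  then show ?thesis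
    using ck_norm_relations by (simp add: ck.eqv_def word_elem_gen adj_word_elem word_elem_append[symmetric])
qed

lemma range_projection_idem: "word_elem [Beta i, Alpha i, Beta i, Alpha i] \<doteq> word_elem [Beta i, Alpha i]"
  using ck.eqv_mult[OF word_elem_partial_isometry(1)[of i] ck.eqv_refl[of "word_elem [Alpha i]"]]
  by (simp add: word_elem_append[symmetric])

text \<open>Compress by \<open>e = P i\<close>. The elements \<open>a j = e * P j * e\<close> sum to
  \<open>e\<close>, and \<open>a i\<close> is already \<open>e\<close>, so those with
  \<open>j \<noteq> i\<close> sum to 0. Each of them satisfies the bound \<open>minus\<close>; since
  \<open>a k\<close> is minus the sum of the others, it also satisfies an opposite bound, and
  \<open>selfadjoint_null\<close> gives \<open>a k \<doteq> 0\<close>. By the C*-identity the norm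
  of \<open>a k\<close> is the square of that of \<open>P k * e\<close>.\<close>

lemma range_projections_orthogonal:
  assumes "k \<noteq> i"
  shows "word_elem [Beta k, Alpha k, Beta i, Alpha i] \<doteq> 0"
proof -
  define e where "e = word_elem [Beta i, Alpha i]"
  define P where "P j = word_elem [Beta j, Alpha j]" for j :: 'n
  define a where "a j = e * P j * e" for j
  have idem: "P j * P j \<doteq> P j" for j
    using range_projection_idem[of j] by (simp add: P_def word_elem_append[symmetric])
  have eP: "e = P i" by (simp add: e_def P_def)
  have ee: "e * e \<doteq> e" using idem eP by simp
  have adjP: "adj (P j) = P j" for j by (simp add: P_def adj_word_elem)
  have ea: "e * a j \<doteq> a j" "a j * e \<doteq> a j" for j
    using ck.eqv_mult[OF ee ck.eqv_refl[of "P j * e"]] ck.eqv_mult[OF ck.eqv_refl[of "e * P j"] ee]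
    by (simp_all add: a_def mult.assoc)
  have adj_a: "adj (a j) = a j" for j
    by (simp add: a_def e_def P_def adj_word_elem word_elem_append[symmetric])
  have e1: "ck_norm A e \<le> 1" using ck.projection_le_1 ee eP adjP by simp
  have minus: "ck_norm A (e - a j) \<le> 1" for j
  proof -
    have adj1: "adj (1 - P j) = 1 - P j"
      using adj_add[of "1 - P j" "P j"] by (simp add: adj_one adjP eq_diff_eq)
    have "(1 - P j) * (1 - P j) = 1 - P j - (P j - P j * P j)" by (simp add: algebra_simps)
    also have "\<dots> \<doteq> 1 - P j - (P j - P j)" by (intro ck.eqv_diff ck.eqv_refl idem)
    finally have "ck_norm A (1 - P j) \<le> 1" using ck.projection_le_1[OF adj1] by simp
    then have "ck_norm A (e * (1 - P j) * e) \<le> 1 * 1 * 1"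
      using ck.submult[of "e * (1 - P j)" e] ck.submult[of e "1 - P j"] e1
      by (meson ck.nonneg mult_mono order_trans zero_le_one mult_nonneg_nonneg)
    moreover have "e * (1 - P j) * e = e * e - a j" by (simp add: a_def algebra_simps)
    moreover have "e * e - a j \<doteq> e - a j" by (intro ck.eqv_diff ck.eqv_refl ee)
    ultimately show ?thesis using ck.eqv_eq by fastforce
  qed
  define R where "R = UNIV - {i, k}"
  define m where "m = card R"
  have sum_a: "a k + (\<Sum>j\<in>R. a j) \<doteq> 0"
  proof -
    have "(\<Sum>j\<in>UNIV. a j) = e * (\<Sum>j\<in>UNIV. P j) * e"
      by (simp add: a_def sum_distrib_left sum_distrib_right)
    also have "\<dots> \<doteq> e * 1 * e"
      unfolding P_def by (intro ck.eqv_mult sum_range_projections ck.eqv_refl)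
    also have "e * 1 * e \<doteq> e" using ee by simp
    finally have "(\<Sum>j\<in>UNIV. a j) \<doteq> e" .
    moreover have "a i \<doteq> e"
      using ck.eqv_trans[OF ck.eqv_mult[OF ee ck.eqv_refl[of e]] ee] eP by (simp add: a_def)
    ultimately have "(\<Sum>j\<in>UNIV. a j) - a i \<doteq> 0" using ck.eqv_diff by fastforce
    moreover have "(\<Sum>j\<in>UNIV. a j) = a i + (a k + (\<Sum>j\<in>R. a j))"
    proof -
      have "UNIV = insert i (insert k R)" "i \<notin> insert k R" "k \<notin> R" using assms by (auto simp: R_def)
      then show ?thesis by (metis finite_class.finite_UNIV finite_insert sum.insert)
    qed
    ultimately show ?thesis by simp
  qed
  \<comment> \<open>Modulo the relations, \<open>(1 + m) e + a k\<close> equals the sum of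
    \<open>e\<close> and the \<open>m\<close> elements \<open>e - a j\<close> with \<open>j\<close>
    other than \<open>i\<close> and \<open>k\<close>, all of norm at most 1. Dividing by
    \<open>1 + m\<close> gives the constant \<open>t\<close> of
    \<open>selfadjoint_null\<close>.\<close>
  have plus: "ck_norm A (e + scal (complex_of_real (1 / (1 + real m))) (a k)) \<le> 1"
  proof -
    have "(e + (\<Sum>j\<in>R. e - a j)) + (a k + (\<Sum>j\<in>R. a j)) = (1 + of_nat m) * e + a k"
      by (simp add: sum_subtractf m_def algebra_simps)
    moreover have "(e + (\<Sum>j\<in>R. e - a j)) + (a k + (\<Sum>j\<in>R. a j)) \<doteq> (e + (\<Sum>j\<in>R. e - a j)) + 0"
      by (intro ck.eqv_add ck.eqv_refl sum_a)
    ultimately have "(1 + of_nat m) * e + a k \<doteq> e + (\<Sum>j\<in>R. e - a j)" by (simp only: add_0_right)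
    then have "ck_norm A ((1 + of_nat m) * e + a k) = ck_norm A (e + (\<Sum>j\<in>R. e - a j))"
      by (rule ck.eqv_eq)
    also have "\<dots> \<le> 1 + real m"
    proof -
      have "ck_norm A (\<Sum>j\<in>S. e - a j) \<le> real (card S)" if "finite S" for S
        using that
      proof (induction S rule: finite_induct)
        case (insert j S)
        then show ?case using ck.triangle[of "e - a j" "\<Sum>j\<in>S. e - a j"] minus[of j] by simp
      qed simp
      then have "ck_norm A (\<Sum>j\<in>R. e - a j) \<le> real m" unfolding m_def by simp
      then show ?thesis using ck.triangle[of e "\<Sum>j\<in>R. e - a j"] e1 by linarith
    qed
    finally have le: "ck_norm A ((1 + of_nat m) * e + a k) \<le> 1 + real m" .
    let ?c = "complex_of_real (1 / (1 + real m))"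
    have "(1 + of_nat m) * e = scal (of_nat (Suc m)) e"
      by (simp only: scal_conv_mult single_of_nat) (simp only: of_nat_Suc)
    then have "scal ?c ((1 + of_nat m) * e + a k) = scal (?c * of_nat (Suc m)) e + scal ?c (a k)"
      by (simp only: ck.scal_rules(1,5))
    moreover have "?c * of_nat (Suc m) = 1"
    proof -
      have "?c * of_nat (Suc m) = complex_of_real (1 / (1 + real m) * real (Suc m))"
        by (simp only: of_real_mult of_real_of_nat_eq)
      also have "1 / (1 + real m) * real (Suc m) = 1" by simp
      finally show ?thesis by simp
    qed
    ultimately have "e + scal ?c (a k) = scal ?c ((1 + of_nat m) * e + a k)"
      by (simp only: ck.scal_rules(6))
    then have "ck_norm A (e + scal ?c (a k)) = 1 / (1 + real m) * ck_norm A ((1 + of_nat m) * e + a k)"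
      by (simp only: ck.p_scal norm_of_real abs_of_nonneg[of "1 / (1 + real m)"]) simp
    also have "\<dots> \<le> 1 / (1 + real m) * (1 + real m)" by (intro mult_left_mono le) simp
    finally show ?thesis by simp
  qed
  have "ck_norm A (a k) = 0"
    by (rule ck.selfadjoint_null[OF _ ee adj_a ea _ _ minus plus]) (use adjP eP in auto)
  moreover have "adj (P k * e) * (P k * e) \<doteq> a k"
  proof -
    have "adj (P k * e) * (P k * e) = e * (P k * P k) * e"
      by (simp add: P_def e_def adj_word_elem word_elem_append[symmetric])
    also have "\<dots> \<doteq> a k" unfolding a_def by (intro ck.eqv_mult ck.eqv_refl idem)
    finally show ?thesis .
  qed
  ultimately have "(ck_norm A (P k * e))\<^sup>2 = 0"
    using ck.eqv_eq ck.p_adj_mult by metis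
  then show ?thesis by (simp add: ck.eqv_def P_def e_def word_elem_append[symmetric])
qed

text \<open>Replace both letters by means of the partial isometry relations: the product of the two
  range projections appears in the middle.\<close>

lemma Alpha_Beta_distinct:
  assumes "k \<noteq> i"
  shows "word_elem [Alpha k, Beta i] \<doteq> 0"
proof -
  have "word_elem [Alpha k] * word_elem [Beta i]
      \<doteq> word_elem [Alpha k, Beta k, Alpha k] * word_elem [Beta i, Alpha i, Beta i]"
    by (intro ck.eqv_mult ck.eqv_sym[OF word_elem_partial_isometry(1)] ck.eqv_sym[OF word_elem_partial_isometry(2)])
  also have "\<dots> = word_elem [Alpha k] * word_elem [Beta k, Alpha k, Beta i, Alpha i] * word_elem [Beta i]"
    by (simp add: word_elem_append[symmetric])
  also have "\<dots> \<doteq> word_elem [Alpha k] * 0 * word_elem [Beta i]"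
    by (intro ck.eqv_mult ck.eqv_refl range_projections_orthogonal assms)
  finally show ?thesis by (simp add: word_elem_append[symmetric])
qed

text \<open>After substituting the source relation, orthogonality leaves only the summand for
  \<open>j\<close>.\<close>

lemma Alpha_Beta_Beta: "word_elem [Alpha i, Beta i, Beta j] \<doteq> of_nat (A $ i $ j) * word_elem [Beta j]"
proof -
  have "word_elem [Alpha i, Beta i] * word_elem [Beta j]
      \<doteq> (\<Sum>k\<in>UNIV. of_nat (A $ i $ k) * word_elem [Beta k, Alpha k]) * word_elem [Beta j]"
    by (intro ck.eqv_mult source_projection ck.eqv_refl)
  also have "\<dots> = (\<Sum>k\<in>UNIV. of_nat (A $ i $ k) * word_elem [Beta k] * word_elem [Alpha k, Beta j])"
    by (simp add: sum_distrib_right mult.assoc word_elem_append[symmetric])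
  also have "\<dots> \<doteq> (\<Sum>k\<in>UNIV. if k = j then of_nat (A $ i $ k) * word_elem [Beta j, Alpha j, Beta j] else 0)"
  proof (rule ck.eqv_sum)
    fix k
    have "of_nat (A $ i $ k) * word_elem [Beta k] * word_elem [Alpha k, Beta j] \<doteq> of_nat (A $ i $ k) * word_elem [Beta k] * 0"
      if "k \<noteq> j" by (intro ck.eqv_mult Alpha_Beta_distinct that ck.eqv_refl)
    then show "of_nat (A $ i $ k) * word_elem [Beta k] * word_elem [Alpha k, Beta j]
      \<doteq> (if k = j then of_nat (A $ i $ k) * word_elem [Beta j, Alpha j, Beta j] else 0)"
      by (auto simp: mult.assoc word_elem_append[symmetric])
  qed
  also have "(\<Sum>k\<in>UNIV. if k = j then of_nat (A $ i $ k) * word_elem [Beta j, Alpha j, Beta j] else 0)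
      = of_nat (A $ i $ j) * word_elem [Beta j, Alpha j, Beta j]" by simp
  also have "\<dots> \<doteq> of_nat (A $ i $ j) * word_elem [Beta j]"
    by (intro ck.eqv_mult ck.eqv_refl word_elem_partial_isometry)
  finally show ?thesis by (simp add: word_elem_append[symmetric])
qed

lemma Beta_Beta_no_edge:
  assumes "A $ i $ j = 0"
  shows "word_elem [Beta i, Beta j] \<doteq> 0"
proof -
  have "word_elem [Beta i] * word_elem [Beta j] \<doteq> word_elem [Beta i, Alpha i, Beta i] * word_elem [Beta j]"
    by (intro ck.eqv_mult ck.eqv_refl ck.eqv_sym[OF word_elem_partial_isometry(1)])
  also have "\<dots> = word_elem [Beta i] * word_elem [Alpha i, Beta i, Beta j]"
    by (simp add: word_elem_append[symmetric])
  also have "\<dots> \<doteq> word_elem [Beta i] * (of_nat (A $ i $ j) * word_elem [Beta j])"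
    by (intro ck.eqv_mult ck.eqv_refl Alpha_Beta_Beta)
  finally show ?thesis using assms by (simp add: word_elem_append[symmetric])
qed

section \<open>Reduction of words against long prefixes of paths\<close>

definition prefix_word :: "nat \<Rightarrow> (nat \<Rightarrow> 'n) \<Rightarrow> 'n letter list" where
  "prefix_word m x = map (\<lambda>k. Beta (x k)) [0..<m]"

lemma prefix_word_Suc: "prefix_word (Suc m) x = Beta (x 0) # prefix_word m (x \<circ> Suc)"
  by (simp add: prefix_word_def upt_conv_Cons map_Suc_upt[symmetric] del: upt_Suc)

text \<open>Multiplying a path prefix by a letter mirrors \<open>act_letter\<close>: the result is 0
  or again a path prefix. At most one letter of the prefix is consumed per letter of
  \<open>w\<close>, hence the bound on \<open>m\<close>.\<close>

lemma word_elem_prefix: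
  assumes "x \<in> infinite_paths" "length w < n"
  shows "case act w x of None \<Rightarrow> word_elem (w @ prefix_word n x) \<doteq> 0
    | Some y \<Rightarrow> \<exists>m. n \<le> m + length w \<and> word_elem (w @ prefix_word n x) \<doteq> word_elem (prefix_word m y)"
  using assms(2)
proof (induction w)
  case Nil
  then show ?case by auto
next
  case (Cons a w)
  have split: "word_elem ((a # w) @ prefix_word n x) = word_elem [a] * word_elem (w @ prefix_word n x)"
    by (simp add: word_elem_append[symmetric])
  show ?case
  proof (cases "act w x")
    case None
    then have "word_elem [a] * word_elem (w @ prefix_word n x) \<doteq> word_elem [a] * 0"
      using Cons by (intro ck.eqv_mult ck.eqv_refl) simp
    then show ?thesis using None split by simp
  next
    case (Some y)
    then obtain m where m: "n \<le> m + length w" "word_elem (w @ prefix_word n x) \<doteq> word_elem (prefix_word m y)"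
      using Cons by auto
    have y: "y \<in> infinite_paths" using act_in_paths assms(1) Some by blast
    \<comment> \<open>Two letters must remain: cancelling \<open>Alpha i\<close> against
      \<open>Beta i\<close> uses the source relation, which needs the letter after
      \<open>Beta i\<close>.\<close>
    obtain m' where m': "m = Suc (Suc m')"
    proof -
      have "m = Suc (Suc (m - 2))" using m(1) Cons.prems by simp
      then show ?thesis using that by blast
    qed
    have eq: "word_elem ((a # w) @ prefix_word n x) \<doteq> word_elem [a] * word_elem (prefix_word m y)"
      unfolding split by (intro ck.eqv_mult ck.eqv_refl m)
    show ?thesis
    proof (cases a)
      case (Alpha i)
      show ?thesis
      proof (cases "y 0 = i")
        case True
        have edge: "A $ i $ y (Suc 0) = 1"
        proof -
          have "A $ y 0 $ y (Suc 0) \<noteq> 0" using y unfolding infinite_paths_def by blast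
          then show ?thesis using True zero_one[of i "y (Suc 0)"] by auto
        qed
        have "word_elem [a] * word_elem (prefix_word m y)
            = word_elem [Alpha i, Beta i, Beta (y (Suc 0))] * word_elem (prefix_word m' (y \<circ> Suc \<circ> Suc))"
          using True by (simp add: m' Alpha prefix_word_Suc word_elem_append[symmetric])
        also have "\<dots> \<doteq> (of_nat (A $ i $ y (Suc 0)) * word_elem [Beta (y (Suc 0))]) * word_elem (prefix_word m' (y \<circ> Suc \<circ> Suc))"
          by (intro ck.eqv_mult ck.eqv_refl Alpha_Beta_Beta)
        also have "\<dots> = word_elem (prefix_word (Suc m') (y \<circ> Suc))"
          by (simp add: edge prefix_word_Suc word_elem_append[symmetric])
        finally have "word_elem ((a # w) @ prefix_word n x) \<doteq> word_elem (prefix_word (Suc m') (y \<circ> Suc))"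
          using eq ck.eqv_trans by blast
        then show ?thesis using Some True Alpha m(1) m' by (auto intro!: exI[of _ "Suc m'"])
      next
        case False
        have "word_elem [a] * word_elem (prefix_word m y)
            = word_elem [Alpha i, Beta (y 0)] * word_elem (prefix_word (Suc m') (y \<circ> Suc))"
          by (simp add: m' Alpha prefix_word_Suc word_elem_append[symmetric])
        also have "\<dots> \<doteq> 0 * word_elem (prefix_word (Suc m') (y \<circ> Suc))"
          using False by (intro ck.eqv_mult ck.eqv_refl Alpha_Beta_distinct) auto
        finally have "word_elem ((a # w) @ prefix_word n x) \<doteq> 0"
          using eq ck.eqv_trans by fastforce
        then show ?thesis using Some False Alpha by simp
      qed
    next
      case (Beta i)
      show ?thesis
      proof (cases "A $ i $ y 0 = 0")
        case True
        have "word_elem [a] * word_elem (prefix_word m y)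
            = word_elem [Beta i, Beta (y 0)] * word_elem (prefix_word (Suc m') (y \<circ> Suc))"
          by (simp add: m' Beta prefix_word_Suc word_elem_append[symmetric])
        also have "\<dots> \<doteq> 0 * word_elem (prefix_word (Suc m') (y \<circ> Suc))"
          using True by (intro ck.eqv_mult ck.eqv_refl Beta_Beta_no_edge)
        finally have "word_elem ((a # w) @ prefix_word n x) \<doteq> 0"
          using eq ck.eqv_trans by fastforce
        then show ?thesis using Some True Beta by simp
      next
        case False
        have "case_nat i y \<circ> Suc = y" by (simp add: fun_eq_iff)
        then have "word_elem [a] * word_elem (prefix_word m y) = word_elem (prefix_word (Suc m) (case_nat i y))"
          by (simp add: Beta prefix_word_Suc word_elem_append[symmetric])
        then show ?thesis using eq Some False Beta m(1) by (auto intro!: exI[of _ "Suc m"])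
      qed
    qed
  qed
qed

text \<open>Either some pair of neighbouring letters is not an edge, and the word is killed by
  \<open>Beta_Beta_no_edge\<close>, or it follows edges and extends to an infinite path.\<close>

lemma word_elem_Beta_path:
  "word_elem (map Beta v) \<doteq> 0 \<or> (\<exists>x\<in>infinite_paths. map Beta v = prefix_word (length v) x)"
proof (induction v)
  case Nil
  then show ?case using infinite_path_from by (auto simp: prefix_word_def)
next
  case (Cons i v)
  from Cons.IH show ?case
  proof
    assume 0: "word_elem (map Beta v) \<doteq> 0"
    have "word_elem [Beta i] * word_elem (map Beta v) \<doteq> word_elem [Beta i] * 0"
      by (intro ck.eqv_mult ck.eqv_refl 0)
    then show ?thesis by (simp add: word_elem_append[symmetric])
  next
    assume "\<exists>x\<in>infinite_paths. map Beta v = prefix_word (length v) x"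
    then obtain x where x: "x \<in> infinite_paths" "map Beta v = prefix_word (length v) x" by blast
    show ?thesis
    proof (cases v)
      case Nil
      then show ?thesis using infinite_path_from[of i] by (auto simp: prefix_word_def)
    next
      case (Cons j v')
      then have j: "j = x 0" using x(2) by (simp add: prefix_word_Suc)
      show ?thesis
      proof (cases "A $ i $ j = 0")
        case True
        have "word_elem [Beta i, Beta j] * word_elem (map Beta v') \<doteq> 0 * word_elem (map Beta v')"
          by (intro ck.eqv_mult ck.eqv_refl Beta_Beta_no_edge True)
        then show ?thesis by (simp add: Cons word_elem_append[symmetric])
      next
        case False
        have "case_nat i x \<in> infinite_paths"
          using x(1) False j by (auto simp: infinite_paths_def split: nat.splits)
        moreover have "case_nat i x \<circ> Suc = x" by (simp add: fun_eq_iff)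
        then have "map Beta (i # v) = prefix_word (length (i # v)) (case_nat i x)"
          using x(2) by (simp add: prefix_word_Suc)
        ultimately show ?thesis by blast
      qed
    qed
  qed
qed

text \<open>Iterates the unit relation by inserting the sum for length \<open>n\<close> between
  \<open>Beta i\<close> and \<open>Alpha i\<close>.\<close>

lemma sum_path_projections:
  "(\<Sum>v\<in>{v. length v = n}. word_elem (map Beta v) * word_elem (map Alpha (rev v))) \<doteq> 1"
proof (induction n)
  case 0
  then show ?case by (simp add: word_elem_Nil)
next
  case (Suc n)
  let ?s = "\<lambda>v. word_elem (map Beta v) * word_elem (map Alpha (rev v))"
  have "bij_betw (\<lambda>(i, v). i # v) (UNIV \<times> {v :: 'n list. length v = n}) {v. length v = Suc n}"
    by (rule bij_betwI[where g = "\<lambda>v. (hd v, tl v)"]) (auto simp: length_Suc_conv)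
  then have "(\<Sum>v\<in>{v. length v = Suc n}. ?s v) = (\<Sum>(i, v)\<in>UNIV \<times> {v :: 'n list. length v = n}. ?s (i # v))"
    by (subst sum.reindex_bij_betw[symmetric]) (auto simp: case_prod_unfold)
  also have "\<dots> = (\<Sum>i\<in>UNIV. \<Sum>v\<in>{v. length v = n}. ?s (i # v))"
    by (rule sum.cartesian_product[symmetric])
  also have "\<dots> = (\<Sum>i\<in>UNIV. word_elem [Beta i] * (\<Sum>v\<in>{v. length v = n}. ?s v) * word_elem [Alpha i])"
    unfolding sum_distrib_left sum_distrib_right
    by (intro sum.cong refl) (simp add: word_elem_append[symmetric])
  also have "\<dots> \<doteq> (\<Sum>i\<in>UNIV. word_elem [Beta i] * 1 * word_elem [Alpha i])"
    by (intro ck.eqv_sum ck.eqv_mult ck.eqv_refl Suc)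
  also have "(\<Sum>i\<in>UNIV. word_elem [Beta i] * 1 * word_elem [Alpha i]) = (\<Sum>i\<in>UNIV. word_elem [Beta i, Alpha i])"
    by (simp add: word_elem_append[symmetric])
  also have "\<dots> \<doteq> 1" by (rule sum_range_projections)
  finally show ?case .
qed

lemma not_live_imp_ck_zero:
  assumes "\<not> live w"
  shows "word_elem w \<doteq> 0"
proof -
  \<comment> \<open>The least length that \<open>word_elem_prefix\<close> admits for
    \<open>w\<close>.\<close>
  let ?V = "{v :: 'n list. length v = Suc (length w)}"
  have zero: "word_elem w * word_elem (map Beta v) \<doteq> 0" if "v \<in> ?V" for v
    using word_elem_Beta_path[of v]
  proof
    assume "word_elem (map Beta v) \<doteq> 0"
    then have "word_elem w * word_elem (map Beta v) \<doteq> word_elem w * 0"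
      by (intro ck.eqv_mult ck.eqv_refl)
    then show ?thesis by simp
  next
    assume "\<exists>x\<in>infinite_paths. map Beta v = prefix_word (length v) x"
    then obtain x where x: "x \<in> infinite_paths" "map Beta v = prefix_word (length v) x" by blast
    then have "act w x = None" using assms by (simp add: live_def)
    then show ?thesis using word_elem_prefix[OF x(1), of w "length v"] x(2) that
      by (simp add: word_elem_append)
  qed
  have "word_elem w = word_elem w * 1" by simp
  also have "\<dots> \<doteq> word_elem w * (\<Sum>v\<in>?V. word_elem (map Beta v) * word_elem (map Alpha (rev v)))"
    by (intro ck.eqv_mult ck.eqv_refl ck.eqv_sym[OF sum_path_projections])
  also have "\<dots> = (\<Sum>v\<in>?V. word_elem w * word_elem (map Beta v) * word_elem (map Alpha (rev v)))"
    by (simp add: sum_distrib_left mult.assoc)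
  also have "\<dots> \<doteq> (\<Sum>v\<in>?V. 0 * word_elem (map Alpha (rev v)))"
    by (intro ck.eqv_sum ck.eqv_mult ck.eqv_refl zero)
  finally show ?thesis by simp
qed

theorem forbidden_iff_not_live: "forbidden A w \<longleftrightarrow> \<not> live w"
proof -
  have "ck_zero A (word_elem w)" if "\<not> live w"
    using not_live_imp_ck_zero[OF that] by (simp add: ck.eqv_def ck_zero_def)
  then show ?thesis
    using live_imp_not_ck_zero[of w] by (auto simp: forbidden_def prod_list_phi word_elem_def)
qed

end

section \<open>Dyck words\<close>

instance letter :: (finite) finite
proof
  have "(UNIV :: 'a letter set) = range Alpha \<union> range Beta"
  proof (intro equalityI subsetI)
    fix a :: "'a letter"
    show "a \<in> range Alpha \<union> range Beta" by (cases a) auto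
  qed simp
  then show "finite (UNIV :: 'a letter set)" by (metis finite_Un finite_code finite_imageI)
qed

fun height_letter :: "'n letter \<Rightarrow> int" where
  "height_letter (Alpha i) = 1"
| "height_letter (Beta i) = - 1"

definition height :: "'n letter list \<Rightarrow> int" where
  "height w = sum_list (map height_letter w)"

lemma height_simps [simp]:
  "height [] = 0" "height (a # w) = height_letter a + height w" "height (u @ v) = height u + height v"
  by (simp_all add: height_def)

lemma height_adj_list [simp]: "height (adj_list w) = - height w"
proof (induction w)
  case (Cons a w)
  then show ?case by (cases a) simp_all
qed simp

lemma height_conv_counts: "height w = int (neg_count w) - int (pos_count w)"
proof (induction w)
  case (Cons a w)
  then show ?case by (cases a) (simp_all add: neg_count_def pos_count_def)
qed (simp add: neg_count_def pos_count_def)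

text \<open>Constrains the shape only: the indices of an opening letter and the letter that closes
  it may differ.\<close>

definition dyck :: "'n letter list \<Rightarrow> bool" where
  "dyck w \<longleftrightarrow> (\<forall>m. 0 \<le> height (take m w)) \<and> height w = 0"

lemma dyck_Nil [simp]: "dyck []"
  by (simp add: dyck_def)

lemma even_length_height: "even (int (length w) - height w)"
proof (induction w)
  case (Cons a w)
  then show ?case by (cases a) auto
qed simp

lemma dyck_append: "dyck u \<Longrightarrow> dyck v \<Longrightarrow> dyck (u @ v)"
  by (auto simp: dyck_def)

lemma dyck_elevate: "dyck u \<Longrightarrow> dyck (Alpha i # u @ [Beta j])"
  by (auto simp: dyck_def take_Cons' split: if_splits)

text \<open>Cut where the height first becomes negative. Heights change in steps of 1, so the letter
  there is a \<open>Beta\<close> and the part before it ends at height 0.\<close>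

lemma dyck_first_passage:
  assumes "height w < 0"
  shows "\<exists>u k v. w = u @ Beta k # v \<and> dyck u"
proof -
  define m where "m = (LEAST m. height (take m w) < 0)"
  have ex: "height (take (length w) w) < 0" using assms by simp
  have m: "height (take m w) < 0" unfolding m_def by (rule LeastI, rule ex)
  have least: "0 \<le> height (take l w)" if "l < m" for l
    using not_less_Least[of l "\<lambda>m. height (take m w) < 0"] that unfolding m_def by simp
  have "m \<le> length w" unfolding m_def by (rule Least_le, rule ex)
  moreover obtain m' where m': "m = Suc m'" using m by (cases m) auto
  ultimately have lt: "m' < length w" by simp
  then have t: "take m w = take m' w @ [w ! m']" by (simp add: m' take_Suc_conv_app_nth)
  have h: "0 \<le> height (take m' w)" using least m' by simp
  obtain k where k: "w ! m' = Beta k" using t m h by (cases "w ! m'") auto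
  have "height (take m' w) = 0" using t m h k by simp
  moreover have "0 \<le> height (take l (take m' w))" for l
    using least[of "min l m'"] m' by (simp add: min.commute)
  ultimately have "dyck (take m' w)" by (simp add: dyck_def)
  moreover have "w = take m' w @ Beta k # drop (Suc m') w"
    using lt k by (metis id_take_nth_drop)
  ultimately show ?thesis by blast
qed

lemma dyck_decompose:
  assumes "dyck w" "w \<noteq> []"
  shows "\<exists>i u k v. w = Alpha i # u @ Beta k # v \<and> dyck u \<and> dyck v"
proof -
  obtain a w' where w: "w = a # w'" using assms(2) by (cases w) auto
  have "0 \<le> height (take 1 w)" using assms(1) unfolding dyck_def by blast
  then obtain i where a: "a = Alpha i" using w by (cases a) auto
  have "height w' < 0" using assms(1) by (simp add: dyck_def w a)
  then obtain u k v where u: "w' = u @ Beta k # v" "dyck u" using dyck_first_passage by blast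
  have "0 \<le> height (take l v)" for l
  proof -
    have "0 \<le> height (take (Suc (length u + Suc l)) w)" using assms(1) unfolding dyck_def by blast
    then show ?thesis using u by (simp add: w a dyck_def)
  qed
  then have "dyck v" using assms(1) u by (simp add: dyck_def w a)
  then show ?thesis using w a u by blast
qed

text \<open>The displayed \<open>Beta\<close> is the first moment at height -1, which the whole word
  determines: the longer of two candidates would contain the passage of the shorter one.\<close>

lemma dyck_first_passage_unique:
  assumes "u @ Beta j # v = u' @ Beta j' # v'" "dyck u" "dyck u'"
  shows "u = u' \<and> j = j' \<and> v = v'"
proof -
  have no: False if h: "us \<noteq> []" "u = u' @ us" "us @ Beta j # v = Beta j' # v'" "dyck u" "dyck u'"
    for us u u' j j' and v v' :: "'a letter list"
  proof -
    obtain us' where "us = Beta j' # us'" using h(1,3) by (cases us) auto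
    then have "height (take (Suc (length u')) u) = height u' - 1" using h(2) by simp
    moreover have "0 \<le> height (take (Suc (length u')) u)" using h(4) unfolding dyck_def by blast
    ultimately show False using h(5) by (simp add: dyck_def)
  qed
  from assms(1) obtain us where "u = u' @ us \<and> us @ Beta j # v = Beta j' # v'
      \<or> u @ us = u' \<and> Beta j # v = us @ Beta j' # v'"
    by (auto simp: append_eq_append_conv2)
  then have "us = []" using no[of us u u' j v j' v'] no[of us u' u j' v' j v] assms(2,3) by metis
  then show ?thesis using \<open>u = u' @ us \<and> _ \<or> _\<close> by auto
qed

section \<open>Labelled Dyck words and their action on paths\<close>

context transition_matrix
begin

text \<open>The words of \<open>C\<^sub>n\<^sup>A(i)\<close>: Dyck words all of whose outermost arches \<open>Alpha j \<dots> Beta j\<close>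
  satisfy \<open>A(j,i) = 1\<close>.\<close>

inductive dyck_at :: "'n \<Rightarrow> 'n letter list \<Rightarrow> bool" where
  Nil: "dyck_at i []"
| Arch: "A $ j $ i \<noteq> 0 \<Longrightarrow> dyck_at j u \<Longrightarrow> dyck_at i v \<Longrightarrow> dyck_at i (Alpha j # u @ Beta j # v)"

lemma dyck_at_imp_dyck: "dyck_at i w \<Longrightarrow> dyck w"
proof (induction rule: dyck_at.induct)
  case (Arch j i u v)
  then show ?case using dyck_append[OF dyck_elevate[of u j j], of v] by simp
qed simp

lemma case_nat_in_paths: "x \<in> infinite_paths \<Longrightarrow> A $ i $ x 0 \<noteq> 0 \<Longrightarrow> case_nat i x \<in> infinite_paths"
  by (auto simp: infinite_paths_def split: nat.splits)

lemma act_dyck_at: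
  assumes "dyck_at i w" "x \<in> infinite_paths" "x 0 = i"
  shows "act w x = Some x"
  using assms
proof (induction arbitrary: x rule: dyck_at.induct)
  case (Arch j i u v)
  have "act u (case_nat j x) = Some (case_nat j x)"
    using Arch by (intro Arch.IH case_nat_in_paths) auto
  moreover have "case_nat j x \<circ> Suc = x" by (simp add: fun_eq_iff)
  ultimately show ?case using Arch by (simp add: act_append)
qed simp

lemma live_dyck_at: "dyck_at i w \<Longrightarrow> live w"
  using act_dyck_at infinite_path_from[of i] unfolding live_def by blast

text \<open>Induction along the first return. The closing letter puts \<open>k\<close> in front of
  the path, the inner word leaves the path alone, and so the opening letter has to remove the same
  \<open>k\<close>. A nonzero action thus forces matching indices, and the edge condition of
  \<open>Beta k\<close> is the one on outermost arches.\<close>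

lemma dyck_act:
  assumes "dyck w" "x \<in> infinite_paths" "act w x = Some y"
  shows "y = x \<and> dyck_at (x 0) w"
  using assms
proof (induction w arbitrary: x y rule: length_induct)
  case (1 w)
  show ?case
  proof (cases "w = []")
    case True
    then show ?thesis using 1 by (simp add: dyck_at.Nil)
  next
    case False
    then obtain i u k v where w: "w = Alpha i # u @ Beta k # v" "dyck u" "dyck v"
      using dyck_decompose 1 by blast
    obtain z where z: "act v x = Some z" using 1 w by (auto simp: act_append bind_eq_Some_conv)
    have "length v < length w" using w by simp
    then have v: "z = x" "dyck_at (x 0) v" using 1(1,3) w(3) z by blast+
    have edge: "A $ k $ x 0 \<noteq> 0" using 1(4) z v w by (auto simp: act_append split: if_splits)
    obtain z' where z': "act u (case_nat k x) = Some z'" "act_letter (Alpha i) z' = Some y"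
      using 1(4) z v edge w by (auto simp: act_append bind_eq_Some_conv)
    have u: "z' = case_nat k x \<and> dyck_at (case_nat k x 0) u"
    proof -
      have "length u < length w" using w by simp
      then show ?thesis using 1(1) w(2) case_nat_in_paths[OF 1(3) edge] z'(1) by blast
    qed
    then have "i = k" "y = x" using z'(2) by (auto simp: fun_eq_iff split: if_splits)
    then show ?thesis using u v w edge by (auto intro: dyck_at.Arch)
  qed
qed

lemma dyck_at_elevate: "dyck_at i w \<Longrightarrow> A $ i $ k \<noteq> 0 \<Longrightarrow> dyck_at k (Alpha i # w @ [Beta i])"
  using dyck_at.Arch[of i k w "[]"] dyck_at.Nil by simp

text \<open>The closing \<open>Beta i\<close> makes the inner word act on a path that begins with
  \<open>i\<close>; this identifies the words counted by c_n^A(i) with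
  \<open>dyck_at i\<close>.\<close>

lemma live_dyck_elevate:
  assumes "dyck w"
  shows "live (Alpha i # w @ [Beta i]) \<longleftrightarrow> dyck_at i w"
proof
  assume "live (Alpha i # w @ [Beta i])"
  then obtain x y where x: "x \<in> infinite_paths" "act (w @ [Beta i]) x = Some y"
    unfolding live_def by (fastforce simp: bind_eq_Some_conv)
  then have "A $ i $ x 0 \<noteq> 0" "act w (case_nat i x) = Some y"
    by (auto simp: act_append split: if_splits)
  then show "dyck_at i w" using dyck_act[OF assms] case_nat_in_paths[OF x(1)] by fastforce
next
  assume "dyck_at i w"
  moreover obtain k where "A $ i $ k \<noteq> 0" using essential by (auto simp: essential_def)
  ultimately show "live (Alpha i # w @ [Beta i])"
    using dyck_at_elevate live_dyck_at by blast
qed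

section \<open>Enumeration of labelled Dyck words\<close>

lemma dyck_at_arch_unique:
  assumes "Alpha j # u @ Beta j # v = Alpha j' # u' @ Beta j' # v'" "dyck_at j u" "dyck_at j' u'"
  shows "j = j' \<and> u = u' \<and> v = v'"
  using dyck_first_passage_unique[of u j v u' j' v'] assms dyck_at_imp_dyck by auto

text \<open>Indexed by the length of the word instead of the number of arches, so that the
  cardinalities are the coefficients of f_i^A(z^2).\<close>

definition dyck_set :: "nat \<Rightarrow> 'n \<Rightarrow> 'n letter list set" where
  "dyck_set n i = {w. dyck_at i w \<and> length w = n}"

lemma finite_dyck_set: "finite (dyck_set n i)"
  using finite_lists_length_eq[of "UNIV :: 'n letter set" n] by (auto simp: dyck_set_def intro: rev_finite_subset)

lemma dyck_set_odd: "odd n \<Longrightarrow> dyck_set n i = {}"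
proof -
  assume n: "odd n"
  have False if "w \<in> dyck_set n i" for w
  proof -
    have "dyck w" "length w = n" using that dyck_at_imp_dyck by (auto simp: dyck_set_def)
    then have "even (int n)" using even_length_height[of w] by (simp add: dyck_def)
    then show False using n by simp
  qed
  then show ?thesis by blast
qed

lemma dyck_set_0: "dyck_set 0 i = {[]}"
  by (auto simp: dyck_set_def dyck_at.Nil)

text \<open>The coefficient form of the functional equation: the first arch, over a vertex
  \<open>j\<close> with an edge to \<open>i\<close>, is split off together with its
  interior.\<close>

lemma card_dyck_set_Suc:
  "card (dyck_set (2 * Suc n) i) =
     (\<Sum>j\<in>UNIV. if A $ j $ i = 0 then 0 else \<Sum>k\<le>n. card (dyck_set (2 * k) j) * card (dyck_set (2 * (n - k)) i))"
proof -
  let ?R = "SIGMA j:{j. A $ j $ i \<noteq> 0}. SIGMA k:{..n}. dyck_set (2 * k) j \<times> dyck_set (2 * (n - k)) i"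
  let ?f = "\<lambda>(j, k, u, v). Alpha j # u @ Beta j # v"
  have "bij_betw ?f ?R (dyck_set (2 * Suc n) i)"
  proof (rule bij_betw_imageI)
    show "inj_on ?f ?R"
    proof (rule inj_onI)
      fix t t' assume t: "t \<in> ?R" "t' \<in> ?R" "?f t = ?f t'"
      obtain j k u v where [simp]: "t = (j, k, u, v)" by (cases t)
      obtain j' k' u' v' where [simp]: "t' = (j', k', u', v')" by (cases t')
      have u: "dyck_at j u" "dyck_at j' u'" "length u = 2 * k" "length u' = 2 * k'"
        using t(1,2) by (auto simp: dyck_set_def)
      have "j = j' \<and> u = u' \<and> v = v'"
        by (rule dyck_at_arch_unique) (use t(3) u in auto)
      then show "t = t'" using u by simp
    qed
    show "?f ` ?R = dyck_set (2 * Suc n) i"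
    proof (intro equalityI subsetI)
      fix w assume "w \<in> ?f ` ?R"
      then show "w \<in> dyck_set (2 * Suc n) i" by (auto simp: dyck_set_def intro: dyck_at.Arch)
    next
      fix w assume w: "w \<in> dyck_set (2 * Suc n) i"
      then have "dyck_at i w" by (simp add: dyck_set_def)
      then show "w \<in> ?f ` ?R"
      proof cases
        case Nil
        then show ?thesis using w by (simp add: dyck_set_def)
      next
        case (Arch j u v)
        have "even (int (length u))"
          using even_length_height[of u] dyck_at_imp_dyck[OF Arch(3)] by (simp add: dyck_def)
        then obtain k where k: "length u = 2 * k" by auto
        then have "(j, k, u, v) \<in> ?R" using Arch w by (auto simp: dyck_set_def)
        then show ?thesis using Arch by (intro image_eqI[where x = "(j, k, u, v)"]) auto
      qed
    qed
  qed
  then have "card (dyck_set (2 * Suc n) i) = card ?R" by (simp add: bij_betw_same_card)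
  also have "\<dots> = (\<Sum>j\<in>{j. A $ j $ i \<noteq> 0}. \<Sum>k\<le>n. card (dyck_set (2 * k) j) * card (dyck_set (2 * (n - k)) i))"
    by (simp add: card_SigmaI card_cartesian_product finite_dyck_set)
  also have "\<dots> = (\<Sum>j\<in>UNIV. if A $ j $ i = 0 then 0 else \<Sum>k\<le>n. card (dyck_set (2 * k) j) * card (dyck_set (2 * (n - k)) i))"
    by (rule sum.mono_neutral_cong_left) auto
  finally show ?thesis .
qed

end

section \<open>Heights and admissible words\<close>

text \<open>Partial sums normalised at position 0 and continued to the left with the opposite sign,
  so that the height of every segment is a difference of two values.\<close>

definition hgt :: "(int \<Rightarrow> 'n letter) \<Rightarrow> int \<Rightarrow> int" where
  "hgt x k = (if 0 \<le> k then height (segment x 0 k) else - height (segment x k 0))"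

lemma height_segment:
  assumes "a \<le> b"
  shows "height (segment x a b) = hgt x b - hgt x a"
proof -
  consider "0 \<le> a" | "a < 0" "0 \<le> b" | "b < 0" by linarith
  then show ?thesis
  proof cases
    case 1
    then show ?thesis using segment_append[of 0 a b x] assms by (simp add: hgt_def)
  next
    case 2
    then show ?thesis using segment_append[of a 0 b x] by (simp add: hgt_def)
  next
    case 3
    then show ?thesis using segment_append[of a b 0 x] assms by (simp add: hgt_def)
  qed
qed

lemma segment_Suc: "segment x k (k + 1) = [x k]"
  by (simp add: segment_def)

lemma hgt_Suc: "hgt x (k + 1) = hgt x k + height_letter (x k)"
  using height_segment[of k "k + 1" x] by (simp add: segment_Suc)

lemma take_segment:
  assumes "m \<le> nat (b - a)"
  shows "take m (segment x a b) = segment x a (a + int m)"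
proof -
  have "segment x a b = segment x a (a + int m) @ segment x (a + int m) b \<or> m = 0"
    using assms by (cases "m = 0") (auto intro!: segment_append)
  moreover have "take m (segment x a (a + int m) @ v) = segment x a (a + int m)" for v by simp
  ultimately show ?thesis by (metis segment_empty take0 order_refl add_0_right of_nat_0)
qed

lemma dyck_segment:
  assumes "a \<le> b"
  shows "dyck (segment x a b) \<longleftrightarrow> (\<forall>k. a \<le> k \<and> k \<le> b \<longrightarrow> hgt x a \<le> hgt x k) \<and> hgt x b = hgt x a"
proof -
  have "0 \<le> height (take m (segment x a b)) \<longleftrightarrow> hgt x a \<le> hgt x (a + int m)" if "m \<le> nat (b - a)" for m
    using that height_segment[of a "a + int m" x] by (simp add: take_segment)
  moreover have "height (take m (segment x a b)) = height (segment x a b)" if "\<not> m \<le> nat (b - a)" for m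
    using that by simp
  ultimately have "dyck (segment x a b) \<longleftrightarrow>
      (\<forall>m. m \<le> nat (b - a) \<longrightarrow> hgt x a \<le> hgt x (a + int m)) \<and> hgt x b = hgt x a"
    unfolding dyck_def using height_segment[OF assms, of x]
    by (metis diff_self eq_iff_diff_eq_0 le_refl order_refl)
  moreover have "(\<forall>m. m \<le> nat (b - a) \<longrightarrow> hgt x a \<le> hgt x (a + int m))
      \<longleftrightarrow> (\<forall>k. a \<le> k \<and> k \<le> b \<longrightarrow> hgt x a \<le> hgt x k)"
  proof (intro iffI allI impI)
    fix k assume *: "\<forall>m. m \<le> nat (b - a) \<longrightarrow> hgt x a \<le> hgt x (a + int m)" and k: "a \<le> k \<and> k \<le> b"
    from *[rule_format, of "nat (k - a)"] k show "hgt x a \<le> hgt x k" by (simp add: nat_mono)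
  next
    fix m assume *: "\<forall>k. a \<le> k \<and> k \<le> b \<longrightarrow> hgt x a \<le> hgt x k" and "m \<le> nat (b - a)"
    then have "a \<le> a + int m \<and> a + int m \<le> b" using assms by linarith
    then show "hgt x a \<le> hgt x (a + int m)" using * by blast
  qed
  ultimately show ?thesis by blast
qed

lemma hgt_periodic:
  assumes "\<And>k. x (k + int n) = x k"
  shows "hgt x (k + int n) = hgt x k + height (segment x 0 (int n))"
proof -
  have "segment x (a + int n) (b + int n) = segment x a b" for a b
    using segment_shift[of x "int n" a b] assms by simp
  then have "hgt x (b + int n) - hgt x (a + int n) = hgt x b - hgt x a" if "a \<le> b" for a b
    using height_segment[of "a + int n" "b + int n" x] height_segment[OF that, of x] that by simp
  note d = this
  have "hgt x 0 = 0" by (simp add: hgt_def)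
  moreover from this have "hgt x (int n) = height (segment x 0 (int n))"
    using height_segment[of 0 "int n" x] by simp
  ultimately show ?thesis
    using d[of 0 k] d[of k 0] by (cases "0 \<le> k") simp_all
qed

lemma hgt_periodic_mult:
  assumes "\<And>k. x (k + int n) = x k"
  shows "hgt x (k + q * int n) = hgt x k + q * height (segment x 0 (int n))"
proof (induction q rule: int_induct[of _ 0])
  case (step1 i)
  then show ?case using hgt_periodic[of x n "k + i * int n"] assms by (simp add: algebra_simps)
next
  case (step2 i)
  then show ?case using hgt_periodic[of x n "k + (i - 1) * int n"] assms by (simp add: algebra_simps)
qed simp

lemma occurs_in_iff: "occurs_in w x \<longleftrightarrow> (\<exists>a. w = segment x a (a + int (length w)))"
proof
  assume "occurs_in w x"
  then obtain k where "\<forall>m<length w. x (k + int m) = w ! m" by (auto simp: occurs_in_def)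
  then have "w = segment x k (k + int (length w))"
    by (intro nth_equalityI) (auto simp: nth_segment)
  then show "\<exists>a. w = segment x a (a + int (length w))" by blast
next
  assume "\<exists>a. w = segment x a (a + int (length w))"
  then obtain a where a: "w = segment x a (a + int (length w))" by blast
  have "x (a + int m) = w ! m" if "m < length w" for m
    using that by (subst a) (simp add: nth_segment)
  then show "occurs_in w x" by (auto simp: occurs_in_def)
qed

section \<open>Free concatenations as coded shifts\<close>

lemma strict_mono_intI:
  fixes s :: "int \<Rightarrow> int"
  assumes "\<And>k. s k < s (k + 1)"
  shows "strict_mono s"
proof (rule strict_monoI)
  fix k l :: int assume "k < l"
  have "s k < s (k + int (Suc d))" for d
  proof (induction d)
    case (Suc d)
    then show ?case using assms[of "k + int (Suc d)"] by (simp add: ac_simps)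
  qed (use assms[of k] in simp)
  from this[of "nat (l - k - 1)"] \<open>k < l\<close> show "s k < s l" by simp
qed

lemma unbounded_enumeration:
  assumes "unbounded S"
  shows "\<exists>s::int \<Rightarrow> int. \<forall>k. consecutive S (s k) (s (k + 1))"
proof -
  obtain s0 b where s0: "consecutive S s0 b" using ex_consecutive_around[OF assms] by blast
  have "\<exists>b. consecutive S a b" if a: "a \<in> S" for a
  proof -
    obtain a' b where *: "consecutive S a' b" "a' \<le> a" "a < b"
      using ex_consecutive_around[OF assms, of a] by blast
    then have "a' = a" using a unfolding consecutive_def by force
    then show ?thesis using * by blast
  qed
  then obtain nxt where nxt: "\<And>a. a \<in> S \<Longrightarrow> consecutive S a (nxt a)" by metis
  have "\<exists>a. consecutive S a b" if b: "b \<in> S" for b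
  proof -
    obtain a b' where *: "consecutive S a b'" "a \<le> b - 1" "b - 1 < b'"
      using ex_consecutive_around[OF assms, of "b - 1"] by blast
    then have "b' = b" using b unfolding consecutive_def by force
    then show ?thesis using * by blast
  qed
  then obtain prv where prv: "\<And>b. b \<in> S \<Longrightarrow> consecutive S (prv b) b" by metis
  define s where "s k = (if 0 \<le> k then (nxt ^^ nat k) s0 else (prv ^^ nat (- k)) s0)" for k :: int
  have s0S: "s0 \<in> S" using s0 by (simp add: consecutive_def)
  have nS: "(nxt ^^ d) s0 \<in> S" for d
    by (induction d) (use s0S nxt in \<open>auto simp: consecutive_def\<close>)
  have pS: "(prv ^^ d) s0 \<in> S" for d
    by (induction d) (use s0S prv in \<open>auto simp: consecutive_def\<close>)
  have "consecutive S (s k) (s (k + 1))" for k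
  proof (cases "0 \<le> k")
    case True
    then have "s (k + 1) = nxt (s k)" by (simp add: s_def nat_add_distrib)
    then show ?thesis using nxt nS True by (simp add: s_def)
  next
    case False
    then have "nat (- k) = Suc (nat (- (k + 1)))" by simp
    then have "s k = prv ((prv ^^ nat (- (k + 1))) s0)" using False by (simp add: s_def)
    moreover have "s (k + 1) = (prv ^^ nat (- (k + 1))) s0"
      using False by (cases "k = -1") (auto simp: s_def)
    ultimately show ?thesis using prv pS by simp
  qed
  then show ?thesis by blast
qed

text \<open>Gaps of the range of a strictly increasing function come from neighbouring indices;
  conversely an unbounded set is enumerated by iterating successor and predecessor. As the set of
  blocks ignores vertices, \<open>lab\<close> is arbitrary.\<close>

lemma bi_infinite_concats_eq_coded_shift: "bi_infinite_concats W = coded_shift (\<lambda>_ _. W) lab"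
proof (intro equalityI subsetI)
  fix x assume "x \<in> bi_infinite_concats W"
  then obtain s :: "int \<Rightarrow> int" where s: "strict_mono s" "\<And>k. segment x (s k) (s (k + 1)) \<in> W"
    by (auto simp: bi_infinite_concats_def segment_def)
  have step: "s k + 1 \<le> s (k + 1)" for k using strict_monoD[OF s(1), of k "k + 1"] by simp
  have up: "s 0 + int d \<le> s (int d)" for d
  proof (induction d)
    case (Suc d)
    then show ?case using step[of "int d"] by (simp add: ac_simps)
  qed simp
  have down: "s (- int d) \<le> s 0 - int d" for d
  proof (induction d)
    case (Suc d)
    then show ?case using step[of "- int (Suc d)"] by simp
  qed simp
  have "unbounded (range s)"
    unfolding unbounded_def
  proof (intro allI conjI)
    fix k
    show "\<exists>m\<in>range s. m \<le> k"
      using down[of "nat \<bar>s 0 - k\<bar>"] by (intro bexI[of _ "s (- int (nat \<bar>s 0 - k\<bar>))"]) auto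
    show "\<exists>m\<in>range s. k \<le> m"
      using up[of "nat \<bar>s 0 - k\<bar>"] by (intro bexI[of _ "s (int (nat \<bar>s 0 - k\<bar>))"]) auto
  qed
  moreover have "segment x a b \<in> W" if c: "consecutive (range s) a b" for a b
  proof -
    obtain i j where ij: "a = s i" "b = s j" using c by (auto simp: consecutive_def)
    then have "i < j" using c strict_mono_less[OF s(1)] by (auto simp: consecutive_def)
    moreover have "\<not> (s i < s (i + 1) \<and> s (i + 1) < s j)" using c ij by (auto simp: consecutive_def)
    then have "\<not> i + 1 < j" by (simp add: strict_mono_less[OF s(1)])
    ultimately have "j = i + 1" by linarith
    then show ?thesis using s(2) ij by simp
  qed
  ultimately show "x \<in> coded_shift (\<lambda>_ _. W) lab"
    by (auto simp: coded_shift_def decomposes_def)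
next
  fix x assume "x \<in> coded_shift (\<lambda>_ _. W) lab"
  then obtain S where S: "unbounded S" "\<And>k k'. consecutive S k k' \<Longrightarrow> segment x k k' \<in> W"
    by (auto simp: coded_shift_def decomposes_def)
  then obtain s :: "int \<Rightarrow> int" where s: "\<And>k. consecutive S (s k) (s (k + 1))" using unbounded_enumeration by blast
  then have "strict_mono s" by (intro strict_mono_intI) (auto simp: consecutive_def)
  then show "x \<in> bi_infinite_concats W"
    using S(2)[OF s] by (auto simp: bi_infinite_concats_def segment_def)
qed

section \<open>Admissibility of words and the generating functions of Dyck words\<close>

context transition_matrix
begin

lemma mem_markov_dyck_shift: "x \<in> markov_dyck_shift A \<longleftrightarrow> (\<forall>a b. live (segment x a b))"
proof
  assume x: "x \<in> markov_dyck_shift A"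
  show "\<forall>a b. live (segment x a b)"
  proof (intro allI)
    fix a b
    have "occurs_in (segment x a b) x"
      unfolding occurs_in_iff by (intro exI[of _ a]) (cases "a \<le> b"; simp)
    then show "live (segment x a b)" using x by (auto simp: markov_dyck_shift_def forbidden_iff_not_live)
  qed
next
  assume "\<forall>a b. live (segment x a b)"
  then show "x \<in> markov_dyck_shift A"
    unfolding markov_dyck_shift_def forbidden_iff_not_live occurs_in_iff by (auto, metis)
qed

lemma act_Beta_prefix:
  assumes "x \<in> infinite_paths"
  shows "act (prefix_word p x) (\<lambda>k. x (k + p)) = Some x"
  using assms
proof (induction p arbitrary: x)
  case 0
  then show ?case by (simp add: prefix_word_def)
next
  case (Suc p)
  have "x \<circ> Suc \<in> infinite_paths" using Suc.prems by (simp add: infinite_paths_def)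
  from Suc.IH[OF this] have "act (prefix_word p (x \<circ> Suc)) (\<lambda>k. x (k + Suc p)) = Some (x \<circ> Suc)"
    by (simp add: comp_def)
  moreover have "A $ x 0 $ x (Suc 0) \<noteq> 0" using Suc.prems unfolding infinite_paths_def by blast
  ultimately show ?case by (simp add: prefix_word_Suc case_nat_shift)
qed

text \<open>To the right the word is continued by the letters \<open>Beta\<close> along a path
  \<open>x\<close> in its domain, to the left by \<open>Beta\<close> letters chosen as successive
  predecessors of the first vertex of the image path; nonzero columns provide the
  predecessors.\<close>

lemma live_imp_admissible:
  assumes "live w"
  shows "admissible A w"
proof -
  obtain x y where x: "x \<in> infinite_paths" "act w x = Some y" using assms by (auto simp: live_def)
  have "\<forall>i. \<exists>j. A $ j $ i \<noteq> 0" using essential by (simp add: essential_def)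
  then obtain pre where pre: "\<And>i. A $ pre i $ i \<noteq> 0" by metis
  \<comment> \<open>The exponent is \<open>Suc m\<close> because \<open>l 0\<close> must already be
    a predecessor of \<open>y 0\<close>.\<close>
  define l where "l m = (pre ^^ Suc m) (y 0)" for m
  define z where "z k = (if k < 0 then Beta (l (nat (- k - 1)))
      else if k < int (length w) then w ! nat k else Beta (x (nat k - length w)))" for k
  have w: "segment z 0 (int (length w)) = w"
    by (rule nth_equalityI) (auto simp: nth_segment z_def)
  have right: "segment z (int (length w)) (int (length w) + int p) = prefix_word p x" for p
    by (rule nth_equalityI) (auto simp: nth_segment z_def prefix_word_def nat_add_distrib)
  have left: "\<exists>y'. act (segment z (- int m) 0) y = Some y' \<and> A $ l m $ y' 0 \<noteq> 0" for m
  proof (induction m)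
    case 0
    then show ?case using pre[of "y 0"] by (simp add: l_def)
  next
    case (Suc m)
    then obtain y' where y': "act (segment z (- int m) 0) y = Some y'" "A $ l m $ y' 0 \<noteq> 0" by blast
    have "segment z (- int (Suc m)) (- int (Suc m) + 1) = [Beta (l m)]"
      using segment_Suc[of z "- 1 - int m"] by (simp add: z_def)
    then have "segment z (- int (Suc m)) 0 = Beta (l m) # segment z (- int m) 0"
      using segment_append[of "- int (Suc m)" "- int (Suc m) + 1" 0 z] by simp
    moreover have "A $ l (Suc m) $ l m \<noteq> 0" using pre[of "l m"] by (simp add: l_def)
    ultimately show ?case using y' by simp
  qed
  have long: "live (segment z (- int m) (int (length w) + int p))" for m p
  proof -
    have "segment z (- int m) (int (length w) + int p) = segment z (- int m) 0 @ w @ prefix_word p x"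
      using segment_append[of "- int m" 0 "int (length w) + int p" z]
        segment_append[of 0 "int (length w)" "int (length w) + int p" z] w right by simp
    moreover have "(\<lambda>k. x (k + p)) \<in> infinite_paths" using x(1) by (simp add: infinite_paths_def)
    ultimately show ?thesis
      using act_Beta_prefix[OF x(1), of p] x(2) left[of m] by (force simp: live_def act_append)
  qed
  have "live (segment z a b)" for a b
  proof (cases "a \<le> b")
    case True
    define m p where "m = nat \<bar>a\<bar>" and "p = nat \<bar>b\<bar>"
    have "- int m \<le> a" "b \<le> int (length w) + int p" by (auto simp: m_def p_def)
    then have "segment z (- int m) (int (length w) + int p)
        = segment z (- int m) a @ segment z a b @ segment z b (int (length w) + int p)"
      using True segment_append[of "- int m" a "int (length w) + int p" z]
        segment_append[of a b "int (length w) + int p" z] by simp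
    then show ?thesis using live_infix long by metis
  next
    case False
    then show ?thesis using live_infix[of "[]" "[]" w] assms by simp
  qed
  then have "z \<in> markov_dyck_shift A" by (simp add: mem_markov_dyck_shift)
  moreover have "occurs_in w z" unfolding occurs_in_iff using w by (intro exI[of _ 0]) simp
  ultimately show ?thesis by (auto simp: admissible_def)
qed

lemma admissible_iff_live: "admissible A w \<longleftrightarrow> live w"
  using live_imp_admissible
  by (auto simp: admissible_def markov_dyck_shift_def forbidden_iff_not_live)

lemma dyck_words_eq: "dyck_words A n = {w. length w = 2 * n \<and> live w \<and> dyck w}"
proof -
  have "(\<forall>m\<le>length w. pos_count (take m w) \<le> neg_count (take m w)) \<and> neg_count w = pos_count w
      \<longleftrightarrow> dyck w" for w :: "'n letter list"
  proof -
    have "(\<forall>m\<le>length w. pos_count (take m w) \<le> neg_count (take m w))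
        \<longleftrightarrow> (\<forall>m\<le>length w. 0 \<le> height (take m w))"
      by (simp add: height_conv_counts)
    moreover have "neg_count w = pos_count w \<longleftrightarrow> height w = 0" by (auto simp: height_conv_counts)
    moreover have "height w = 0 \<Longrightarrow> (\<forall>m\<le>length w. 0 \<le> height (take m w)) \<longleftrightarrow> (\<forall>m. 0 \<le> height (take m w))"
      by (metis eq_refl nat_le_linear take_all)
    ultimately show ?thesis unfolding dyck_def by blast
  qed
  then show ?thesis by (auto simp: dyck_words_def admissible_iff_live)
qed

lemma dyck_words_at_eq: "dyck_words_at A n i = dyck_set (2 * n) i"
proof (cases "n = 0")
  case True
  then show ?thesis by (simp add: dyck_words_at_def dyck_set_0)
next
  case False
  have "live w \<and> dyck w \<and> live (Alpha i # w @ [Beta i]) \<and> dyck (Alpha i # w @ [Beta i]) \<longleftrightarrow> dyck_at i w" for w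
    using live_dyck_elevate[of w i] live_dyck_at[of i w] dyck_at_imp_dyck[of i w] dyck_elevate[of w i i] by blast
  then show ?thesis
    using False by (auto simp: dyck_words_at_def dyck_words_eq dyck_set_def simp del: act.simps)
qed

lemma dyck_fps_relation:
  "dyck_fps A i = 1 + fps_X * dyck_fps A i * (\<Sum>j\<in>UNIV. of_nat (A $ j $ i) * dyck_fps A j)"
proof (rule fps_ext)
  fix n
  have eq: "fps_X * dyck_fps A i * (\<Sum>j\<in>UNIV. of_nat (A $ j $ i) * dyck_fps A j)
      = fps_X * (\<Sum>j\<in>UNIV. if A $ j $ i = 0 then 0 else dyck_fps A j * dyck_fps A i)"
  proof -
    have "of_nat (A $ j $ i) * (dyck_fps A j * dyck_fps A i) = (if A $ j $ i = 0 then 0 else dyck_fps A j * dyck_fps A i)" for j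
      using zero_one[of j i] by auto
    then show ?thesis
      by (simp add: mult.assoc sum_distrib_left mult.left_commute[of "dyck_fps A i"] mult.commute[of "dyck_fps A i"])
  qed
  show "fps_nth (dyck_fps A i) n
    = fps_nth (1 + fps_X * dyck_fps A i * (\<Sum>j\<in>UNIV. of_nat (A $ j $ i) * dyck_fps A j)) n"
  proof (cases n)
    case 0
    then show ?thesis by (simp add: dyck_fps_def dyck_words_at_eq dyck_set_0)
  next
    case (Suc m)
    have "fps_nth (if A $ j $ i = 0 then 0 else dyck_fps A j * dyck_fps A i) m
      = (if A $ j $ i = 0 then 0 else real (\<Sum>k\<le>m. card (dyck_set (2 * k) j) * card (dyck_set (2 * (m - k)) i)))" for j
      by (simp add: dyck_fps_def dyck_words_at_eq fps_mult_nth atLeast0AtMost)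
    then have "fps_nth (fps_X * (\<Sum>j\<in>UNIV. if A $ j $ i = 0 then 0 else dyck_fps A j * dyck_fps A i)) n
      = real (card (dyck_set (2 * Suc m) i))"
      unfolding card_dyck_set_Suc by (auto simp: Suc fps_sum_nth intro!: sum.cong)
    then show ?thesis
      unfolding eq using Suc by (simp add: dyck_fps_def dyck_words_at_eq)
  qed
qed

lemma fps_nth_dyck_fps_sq: "fps_nth (dyck_fps_sq A i) l = real (card (dyck_set l i))"
  by (auto simp: dyck_fps_sq_def fps_nth_compose_X_square dyck_fps_def dyck_words_at_eq dyck_set_odd)

end

section \<open>Periodic points with trivial multiplier\<close>

lemma segment_split:
  assumes "a + 2 \<le> b"
  shows "segment x a b = x a # segment x (a + 1) (b - 1) @ [x (b - 1)]"
proof -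
  have "segment x a b = segment x a (a + 1) @ segment x (a + 1) (b - 1) @ segment x (b - 1) b"
    using assms segment_append[of a "a + 1" b x] segment_append[of "a + 1" "b - 1" b x] by simp
  then show ?thesis using segment_Suc[of x "b - 1"] by (simp add: segment_Suc)
qed

lemma consecutive_chain:
  assumes step: "\<And>k k'. consecutive S k k' \<Longrightarrow> P k k'"
    and refl: "\<And>k. P k k" and trans: "\<And>i j k. P i j \<Longrightarrow> P j k \<Longrightarrow> P i k"
    and "s \<in> S" "t \<in> S" "s \<le> t"
  shows "P s t"
  using assms(4-6)
proof (induction "nat (t - s)" arbitrary: s rule: less_induct)
  case less
  show ?case
  proof (cases "s = t")
    case False
    then obtain s' where s': "consecutive S s s'" "s' \<le> t"
      using ex_consecutive_from[of s S t] less by auto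
    then have "P s' t" using less by (auto simp: consecutive_def)
    then show ?thesis using trans step s'(1) by blast
  qed (simp add: refl)
qed

lemma finite_periodic_points:
  fixes C :: "(int \<Rightarrow> 'a::finite) set"
  assumes "n > 0"
  shows "finite (periodic_points n C)"
proof (rule inj_on_finite)
  show "inj_on (\<lambda>x. segment x 0 (int n)) (periodic_points n C)"
  proof (rule inj_onI)
    fix x y assume "x \<in> periodic_points n C" "y \<in> periodic_points n C"
      and eq: "segment x 0 (int n) = segment y 0 (int n)"
    then have "\<And>k. x (k + int n) = x k" "\<And>k. y (k + int n) = y k" by (auto simp: periodic_points_iff)
    then have "x k = y k" for k
      using periodic_extension_segment[of x n 0 k] periodic_extension_segment[of y n 0 k] assms eq by simp
    then show "x = y" by blast
  qed
  show "(\<lambda>x. segment x 0 (int n)) ` periodic_points n C \<subseteq> {w. length w = n}" by auto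
  show "finite {w :: 'a list. length w = n}" using finite_lists_length_eq[of "UNIV :: 'a set" n] by simp
qed

context transition_matrix
begin

definition arch_words :: "'n set \<Rightarrow> 'n letter list set" where
  "arch_words J = {Alpha i # w @ [Beta i] | i w. (\<forall>j\<in>J. A $ i $ j \<noteq> 0) \<and> dyck_at i w}"

lemma dyck_code_eq: "dyck_code A J = arch_words J"
proof -
  have "A $ i $ j = 1 \<longleftrightarrow> A $ i $ j \<noteq> 0" for i j using zero_one[of i j] by auto
  moreover have "(\<exists>n\<ge>1. w \<in> dyck_words_at A (n - 1) i) \<longleftrightarrow> dyck_at i w" for w i
  proof
    assume w: "dyck_at i w"
    have "even (int (length w))"
      using even_length_height[of w] dyck_at_imp_dyck[OF w] by (simp add: dyck_def)
    then obtain k where "length w = 2 * k" by auto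
    then show "\<exists>n\<ge>1. w \<in> dyck_words_at A (n - 1) i"
      using w by (intro exI[of _ "Suc k"]) (simp add: dyck_words_at_eq dyck_set_def)
  qed (auto simp: dyck_words_at_eq dyck_set_def)
  moreover have "dyck_code A J = {Alpha i # w @ [Beta i] | i w.
      (\<forall>j\<in>J. A $ i $ j = 1) \<and> (\<exists>n\<ge>1. w \<in> dyck_words_at A (n - 1) i)}"
    unfolding dyck_code_def by (rule Collect_cong) iprover
  ultimately show ?thesis unfolding arch_words_def by simp
qed

lemma arch_segment:
  assumes "segment x a b \<in> arch_words J" "a < b"
  shows "hgt x b = hgt x a" "a < m \<Longrightarrow> m < b \<Longrightarrow> hgt x a < hgt x m"
proof -
  obtain i w where w: "segment x a b = Alpha i # w @ [Beta i]" "dyck_at i w"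
    using assms(1) by (auto simp: arch_words_def)
  have "length (segment x a b) = length w + 2" using w(1) by simp
  then have ab: "a + 2 \<le> b" by simp
  then have eq: "x a = Alpha i" "segment x (a + 1) (b - 1) = w" "x (b - 1) = Beta i"
    using w(1) segment_split[OF ab, of x] by auto
  have "dyck (segment x (a + 1) (b - 1))" using eq(2) dyck_at_imp_dyck w(2) by simp
  then have h: "\<And>k. a + 1 \<le> k \<Longrightarrow> k \<le> b - 1 \<Longrightarrow> hgt x (a + 1) \<le> hgt x k" "hgt x (b - 1) = hgt x (a + 1)"
    using dyck_segment[of "a + 1" "b - 1" x] ab by auto
  show "hgt x b = hgt x a"
    using h(2) hgt_Suc[of x a] hgt_Suc[of x "b - 1"] eq by simp
  show "hgt x a < hgt x m" if "a < m" "m < b"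
    using h(1)[of m] hgt_Suc[of x a] eq(1) that by simp
qed

text \<open>All cuts lie at one height and the interior of each block lies strictly above it. The
  resulting set does not depend on \<open>J\<close>, which yields both uniqueness of cuts and the
  intersection formula.\<close>

lemma decomposes_arch_cuts:
  assumes "decomposes (\<lambda>_ _. arch_words J) lab x S"
  shows "S = {k. \<forall>m. hgt x k \<le> hgt x m}"
proof -
  have unb: "unbounded S" using assms by (simp add: decomposes_def)
  have block: "segment x k k' \<in> arch_words J" "k < k'" if "consecutive S k k'" for k k'
    using assms that by (auto simp: decomposes_def consecutive_def)
  have eq: "hgt x s = hgt x t" if "s \<in> S" "t \<in> S" "s \<le> t" for s t
    by (rule consecutive_chain[of S "\<lambda>s t. hgt x s = hgt x t"])
      (use that arch_segment(1) block in \<open>auto, metis\<close>)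
  then have const: "hgt x s = hgt x t" if "s \<in> S" "t \<in> S" for s t
    using that by (metis linear)
  have around: "\<exists>s\<in>S. hgt x s \<le> hgt x m \<and> (m \<in> S \<or> hgt x s < hgt x m)" for m
  proof -
    obtain a b where ab: "consecutive S a b" "a \<le> m" "m < b" using ex_consecutive_around[OF unb] by blast
    then show ?thesis
      using arch_segment(2)[OF block[OF ab(1)], of m]
      by (intro bexI[of _ a]) (cases "a = m"; auto simp: consecutive_def)+
  qed
  show ?thesis
  proof (intro equalityI subsetI CollectI allI)
    fix k m assume "k \<in> S"
    then show "hgt x k \<le> hgt x m" using around[of m] const by metis
  next
    fix k assume "k \<in> {k. \<forall>m. hgt x k \<le> hgt x m}"
    moreover obtain s where "s \<in> S" "k \<in> S \<or> hgt x s < hgt x k" using around[of k] by blast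
    ultimately show "k \<in> S" by (auto simp: not_le[symmetric])
  qed
qed

definition arch_shift :: "'n set \<Rightarrow> (int \<Rightarrow> 'n letter) set" where
  "arch_shift J = bi_infinite_concats (dyck_code A J)"

text \<open>A code without labels is a block graph on the one-element type \<open>1\<close>; its
  determinant is that of a 1 by 1 matrix.\<close>

lemma arch_shift_eq: "arch_shift J = coded_shift (\<lambda>_ _. arch_words J) (\<lambda>_. 1::1)"
  unfolding arch_shift_def dyck_code_eq by (rule bi_infinite_concats_eq_coded_shift)

lemma mem_arch_shift:
  "x \<in> arch_shift J \<longleftrightarrow> decomposes (\<lambda>_ _. arch_words J) (\<lambda>_. 1::1) x {k. \<forall>m. hgt x k \<le> hgt x m}"
  unfolding arch_shift_eq coded_shift_def using decomposes_arch_cuts by fast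

lemma arch_words_INT:
  assumes "J \<noteq> {}"
  shows "arch_words J = (\<Inter>j\<in>J. arch_words {j})"
proof (intro equalityI subsetI)
  fix b assume b: "b \<in> (\<Inter>j\<in>J. arch_words {j})"
  obtain j0 where "j0 \<in> J" using assms by blast
  then obtain i w where w: "b = Alpha i # w @ [Beta i]" "dyck_at i w" using b by (auto simp: arch_words_def)
  have "A $ i $ j \<noteq> 0" if "j \<in> J" for j
  proof -
    have "b \<in> arch_words {j}" using b that by blast
    then show ?thesis using w(1) by (auto simp: arch_words_def)
  qed
  then show "b \<in> arch_words J" using w by (auto simp: arch_words_def)
qed (auto simp: arch_words_def)

text \<open>Membership in each of these shifts refers to the same cut set, so the intersection can
  be taken block by block.\<close>

lemma arch_shift_INT:
  assumes "J \<noteq> {}"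
  shows "arch_shift J = (\<Inter>j\<in>J. arch_shift {j})"
  using assms unfolding set_eq_iff INT_iff mem_arch_shift decomposes_def arch_words_INT[OF assms] by auto

lemma dyck_code_union_eq: "dyck_code_union A = (\<Union>j. arch_shift {j})"
proof -
  have "dyck_code_union A = (\<Union>J\<in>{J. J \<noteq> {}}. arch_shift J)"
    by (simp add: dyck_code_union_def arch_shift_def)
  also have "\<dots> = (\<Union>j. arch_shift {j})"
  proof (intro equalityI subsetI)
    fix x assume "x \<in> (\<Union>J\<in>{J. J \<noteq> {}}. arch_shift J)"
    then obtain J j where "x \<in> arch_shift J" "j \<in> J" by blast
    then have "x \<in> arch_shift {j}" using arch_shift_INT[of J] by auto
    then show "x \<in> (\<Union>j. arch_shift {j})" by blast
  qed auto
  finally show ?thesis .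
qed

lemma block_graph_arch: "block_graph (\<lambda>_ _. arch_words J) (\<lambda>_. 1::1)"
proof
  fix b b' u u' assume b: "b \<in> arch_words J" "b' \<in> arch_words J" "b @ u = b' @ u'"
  then obtain i w i' w' where w: "b = Alpha i # w @ [Beta i]" "dyck_at i w" "b' = Alpha i' # w' @ [Beta i']" "dyck_at i' w'"
    by (auto simp: arch_words_def)
  \<comment> \<open>Once the opening letter is removed, the closing one marks the first passage
    below the starting height.\<close>
  from b(3) have "tl (b @ u) = tl (b' @ u')" by (rule arg_cong)
  then have "w @ Beta i # u = w' @ Beta i' # u'" by (simp add: w(1,3))
  then have "w = w' \<and> i = i'"
    using dyck_first_passage_unique[of w i u w' i' u'] w(2,4) dyck_at_imp_dyck by blast
  then show "b = b'" by (simp add: w(1,3))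
next
  fix x :: "int \<Rightarrow> 'n letter" and S S'
  assume "decomposes (\<lambda>_ _. arch_words J) (\<lambda>_. 1::1) x S" "decomposes (\<lambda>_ _. arch_words J) (\<lambda>_. 1::1) x S'"
  then show "S = S'" using decomposes_arch_cuts by metis
qed (auto simp: arch_words_def)

lemma card_arch_words:
  "card {b \<in> arch_words J. length b = l} =
    (\<Sum>i\<in>UNIV. if (\<forall>j\<in>J. A $ i $ j \<noteq> 0) \<and> 2 \<le> l then card (dyck_set (l - 2) i) else 0)"
proof -
  let ?I = "{i. (\<forall>j\<in>J. A $ i $ j \<noteq> 0) \<and> 2 \<le> l}"
  let ?f = "\<lambda>(i, w). Alpha i # w @ [Beta i]"
  have "bij_betw ?f (SIGMA i:?I. dyck_set (l - 2) i) {b \<in> arch_words J. length b = l}"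
  proof (rule bij_betw_imageI)
    show "?f ` (SIGMA i:?I. dyck_set (l - 2) i) = {b \<in> arch_words J. length b = l}"
    proof (intro equalityI subsetI)
      fix b assume "b \<in> {b \<in> arch_words J. length b = l}"
      then obtain i w where "b = Alpha i # w @ [Beta i]" "\<forall>j\<in>J. A $ i $ j \<noteq> 0" "dyck_at i w" "length w + 2 = l"
        by (auto simp: arch_words_def)
      then show "b \<in> ?f ` (SIGMA i:?I. dyck_set (l - 2) i)"
        by (intro image_eqI[of _ _ "(i, w)"]) (auto simp: dyck_set_def)
    qed (auto simp: arch_words_def dyck_set_def)
  qed (auto simp: inj_on_def)
  then have "card {b \<in> arch_words J. length b = l} = (\<Sum>i\<in>?I. card (dyck_set (l - 2) i))"
    by (simp add: bij_betw_same_card[symmetric] card_SigmaI finite_dyck_set)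
  also have "\<dots> = (\<Sum>i\<in>UNIV. if (\<forall>j\<in>J. A $ i $ j \<noteq> 0) \<and> 2 \<le> l then card (dyck_set (l - 2) i) else 0)"
    by (rule sum.mono_neutral_cong_left) auto
  finally show ?thesis .
qed

definition arch_fps :: "'n set \<Rightarrow> real fps" where
  "arch_fps J = fps_X ^ 2 * (\<Sum>i\<in>UNIV. (\<Prod>j\<in>J. of_nat (A $ i $ j)) * dyck_fps_sq A i)"

lemma fps_nth_arch_fps: "fps_nth (arch_fps J) l = real (card {b \<in> arch_words J. length b = l})"
proof -
  define P where "P i \<longleftrightarrow> (\<forall>j\<in>J. A $ i $ j \<noteq> 0)" for i
  have "(\<Prod>j\<in>J. of_nat (A $ i $ j) :: real fps) = (if P i then 1 else 0)" for i
  proof (cases "P i")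
    case True
    then have "A $ i $ j = 1" if "j \<in> J" for j using that zero_one[of i j] by (auto simp: P_def)
    then show ?thesis using True by simp
  next
    case False
    then have "\<exists>j\<in>J. A $ i $ j = 0" by (auto simp: P_def)
    then show ?thesis using False by auto
  qed
  then have "fps_nth (arch_fps J) l
      = (\<Sum>i\<in>UNIV. if P i \<and> 2 \<le> l then real (card (dyck_set (l - 2) i)) else 0)"
    unfolding arch_fps_def fps_X_power_mult_nth fps_sum_nth
    by (cases "l < 2") (auto simp: fps_nth_dyck_fps_sq intro!: sum.cong)
  also have "\<dots> = real (card {b \<in> arch_words J. length b = l})"
    unfolding card_arch_words of_nat_sum P_def[symmetric] by (intro sum.cong) auto
  finally show ?thesis .
qed

lemma zeta_arch_shift: "zeta_fps (arch_shift J) * (1 - arch_fps J) = 1"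
proof -
  interpret block_graph "\<lambda>_ _. arch_words J" "\<lambda>_. 1::1" by (rule block_graph_arch)
  have "block_matrix $ 1 $ 1 = arch_fps J"
    by (rule fps_ext) (simp add: block_matrix_def blocks_def fps_nth_arch_fps)
  then have "det (mat 1 - block_matrix) = 1 - arch_fps J"
    by (simp add: det_1 mat_def)
  then show ?thesis using zeta_coded_shift by (simp add: arch_shift_eq)
qed

section \<open>Inclusion-exclusion for the union of the arch shifts\<close>

lemma card_periodic_union:
  assumes "n > 0"
  shows "real (card (periodic_points n (dyck_code_union A)))
    = (\<Sum>J\<in>{J. J \<noteq> {}}. (-1) ^ (card J + 1) * real (card (periodic_points n (arch_shift J))))"
proof -
  interpret Incl_Excl finite "\<lambda>S. real (card S)"
    by unfold_locales (auto simp: card_Un_disjnt)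
  have "periodic_points n (dyck_code_union A) = (\<Union>j. periodic_points n (arch_shift {j}))"
    by (auto simp: dyck_code_union_eq periodic_points_def)
  moreover have "real (card (\<Union>j. periodic_points n (arch_shift {j})))
    = (\<Sum>J | J \<subseteq> UNIV \<and> J \<noteq> {}. (-1) ^ (card J + 1) * real (card (\<Inter>j\<in>J. periodic_points n (arch_shift {j}))))"
    by (rule restricted_indexed) (simp_all add: finite_periodic_points assms)
  ultimately have "real (card (periodic_points n (dyck_code_union A)))
    = (\<Sum>J | J \<subseteq> UNIV \<and> J \<noteq> {}. (-1) ^ (card J + 1) * real (card (\<Inter>j\<in>J. periodic_points n (arch_shift {j}))))"
    by simp
  also have "\<dots> = (\<Sum>J\<in>{J. J \<noteq> {}}. (-1) ^ (card J + 1) * real (card (periodic_points n (arch_shift J))))"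
  proof (rule sum.cong)
    fix J :: "'n set" assume "J \<in> {J. J \<noteq> {}}"
    then have "(\<Inter>j\<in>J. periodic_points n (arch_shift {j})) = periodic_points n (arch_shift J)"
      using arch_shift_INT[of J] by (auto simp: periodic_points_def)
    then show "(-1) ^ (card J + 1) * real (card (\<Inter>j\<in>J. periodic_points n (arch_shift {j})))
      = (-1) ^ (card J + 1) * real (card (periodic_points n (arch_shift J)))" by simp
  qed simp
  finally show ?thesis .
qed

lemma zeta_dyck_code_union:
  "zeta_fps (dyck_code_union A) = (\<Prod>J\<in>{J. J \<noteq> {}}. zeta_fps (arch_shift J) powi ((-1) ^ (card J + 1)))"
proof -
  have "zeta_fps (dyck_code_union A) = zeta_of_counts (\<lambda>n. \<Sum>J\<in>{J. J \<noteq> {}}.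
      (-1) ^ (card J + 1) * real (card (periodic_points n (arch_shift J))))"
    unfolding zeta_fps_eq by (rule zeta_of_counts_cong) (rule card_periodic_union)
  also have "\<dots> = (\<Prod>J\<in>{J. J \<noteq> {}}. zeta_of_counts (\<lambda>n.
      (-1) ^ (card J + 1) * real (card (periodic_points n (arch_shift J)))))"
    by (rule zeta_of_counts_sum) simp
  also have "\<dots> = (\<Prod>J\<in>{J. J \<noteq> {}}. zeta_fps (arch_shift J) powi ((-1) ^ (card J + 1)))"
  proof (rule prod.cong)
    fix J :: "'n set"
    show "zeta_of_counts (\<lambda>n. (-1) ^ (card J + 1) * real (card (periodic_points n (arch_shift J))))
      = zeta_fps (arch_shift J) powi ((-1) ^ (card J + 1))"
    proof (cases "even (card J)")
      case True
      then show ?thesis by (simp add: zeta_of_counts_uminus zeta_fps_eq power_int_minus)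
    next
      case False
      then show ?thesis by (simp add: zeta_fps_eq)
    qed
  qed simp
  finally show ?thesis .
qed

section \<open>Periodic points whose period has height 0\<close>

lemma path_word_arch_words: "path_word (\<lambda>_ _. arch_words {j}) (i::1) k w \<Longrightarrow> dyck_at j w"
proof (induction rule: path_word.induct)
  case (Append b i k l u)
  then obtain h w where "b = Alpha h # w @ [Beta h]" "A $ h $ j \<noteq> 0" "dyck_at h w"
    by (auto simp: arch_words_def)
  then show ?case using dyck_at.Arch[of h j w u] Append.IH by simp
qed (rule dyck_at.Nil)

lemma arch_shift_subset: "arch_shift {j} \<subseteq> markov_dyck_shift A"
proof
  fix x assume "x \<in> arch_shift {j}"
  then obtain S where S: "decomposes (\<lambda>_ _. arch_words {j}) (\<lambda>_. 1::1) x S"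
    by (auto simp: arch_shift_eq coded_shift_def)
  have "live (segment x a b)" if "a \<le> b" for a b
  proof -
    obtain s t where s: "s \<in> S" "s \<le> a" "t \<in> S" "b \<le> t" using S unfolding decomposes_def unbounded_def by meson
    then have "live (segment x s t)"
      using path_word_segment[OF S s(1,3)] path_word_arch_words live_dyck_at that by force
    moreover have "segment x s t = segment x s a @ segment x a b @ segment x b t"
      using segment_append[of s a t x] segment_append[of a b t x] s that by simp
    ultimately show ?thesis using live_infix by metis
  qed
  moreover have "live (segment x a b)" if "b < a" for a b
    using that live_dyck_at[OF dyck_at.Nil] by simp
  ultimately show "x \<in> markov_dyck_shift A" unfolding mem_markov_dyck_shift by (meson linorder_not_less)
qed

text \<open>A global minimum moves to another position under translation by a period in either
  direction, which excludes a drift of either sign.\<close>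

lemma arch_shift_balanced:
  assumes "x \<in> arch_shift J" "\<And>k. x (k + int n) = x k"
  shows "height (segment x 0 (int n)) = 0"
proof -
  let ?S = "{k. \<forall>m. hgt x k \<le> hgt x m}"
  have "unbounded ?S" using assms(1) by (simp add: mem_arch_shift decomposes_def)
  then obtain k where k: "k \<in> ?S" unfolding unbounded_def by blast
  have "hgt x (k + int n) = hgt x k + height (segment x 0 (int n))"
    by (rule hgt_periodic) (rule assms(2))
  moreover have "hgt x (k - int n + int n) = hgt x (k - int n) + height (segment x 0 (int n))"
    by (rule hgt_periodic) (rule assms(2))
  ultimately show ?thesis using k by (metis (mono_tags, lifting) add_le_same_cancel1 antisym diff_add_cancel le_add_same_cancel1 mem_Collect_eq)
qed

text \<open>A second outermost arch would begin at an interior position of the same height as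
  \<open>a\<close>.\<close>

lemma prime_dyck_at:
  assumes "dyck_at j (segment x a b)" "a < b" "\<And>m. a < m \<Longrightarrow> m < b \<Longrightarrow> hgt x a < hgt x m"
  shows "segment x a b \<in> arch_words {j}"
  using assms(1)
proof cases
  case Nil
  then have "length (segment x a b) = 0" by simp
  then show ?thesis using assms(2) by simp
next
  case (Arch i u v)
  let ?m = "a + int (length u) + 2"
  have len: "nat (b - a) = length u + length v + 2" using arg_cong[OF Arch(1), of length] by simp
  have "take (length u + 2) (segment x a b) = Alpha i # u @ [Beta i]" using Arch(1) by simp
  then have "segment x a ?m = Alpha i # u @ [Beta i]"
    using take_segment[of "length u + 2" b a x] len by (simp add: ac_simps)
  then have "hgt x ?m = hgt x a"
    using height_segment[of a ?m x] dyck_at_imp_dyck[OF Arch(3)] by (simp add: dyck_def)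
  then have "\<not> ?m < b" using assms(3)[of ?m] by auto
  then have "length v = 0" using len assms(2) by linarith
  then have "segment x a b = Alpha i # u @ [Beta i]" using Arch(1) by simp
  then show ?thesis using Arch(2,3) by (auto simp: arch_words_def)
qed

text \<open>Let the word of one period, started at a minimum, act on a path \<open>z\<close>.
  Whatever stands to the right of a block within the period is a Dyck word and fixes
  \<open>z\<close>, so every block acts on \<open>z\<close> itself and is compatible with the one
  vertex \<open>z 0\<close>.\<close>

lemma balanced_periodic_in_arch_shift:
  assumes x: "x \<in> markov_dyck_shift A" and per: "\<And>k. x (k + int n) = x k" and n: "n > 0"
    and bal: "height (segment x 0 (int n)) = 0"
  shows "\<exists>j. x \<in> arch_shift {j}"
proof -
  let ?S = "{k. \<forall>m. hgt x k \<le> hgt x m}"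
  have hper: "hgt x (k + q * int n) = hgt x k" for k q
    using hgt_periodic_mult[of x n k q] per bal by simp
  \<comment> \<open>Without drift the heights are periodic, so a minimum over one period is
    global.\<close>
  obtain k0 where k0: "k0 \<in> ?S"
  proof -
    have "finite (hgt x ` {0..<int n})" "hgt x ` {0..<int n} \<noteq> {}" using n by auto
    then obtain k0 where k0: "k0 \<in> {0..<int n}" "hgt x k0 = Min (hgt x ` {0..<int n})"
      using Min_in by (metis (no_types, lifting) imageE)
    have "hgt x k0 \<le> hgt x m" for m
    proof -
      have "m mod int n \<in> {0..<int n}" using n by simp
      then have "hgt x k0 \<le> hgt x (m mod int n)" unfolding k0(2) by (intro Min_le) auto
      also have "\<dots> = hgt x m" using hper[of "m mod int n" "m div int n"] by simp
      finally show ?thesis .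
    qed
    then show ?thesis using that by blast
  qed
  have Sper: "k + q * int n \<in> ?S \<longleftrightarrow> k \<in> ?S" for k q using hper by simp
  have unb: "unbounded ?S"
    by (rule unbounded_periodic[OF k0, of "int n"]) (use Sper[of _ 1] Sper[of _ "-1"] n in auto)
  have dyckS: "dyck (segment x a b)" if "a \<in> ?S" "b \<in> ?S" "a \<le> b" for a b
    using that by (subst dyck_segment) (auto intro: antisym)
  obtain z y where z: "z \<in> infinite_paths" "act (segment x k0 (k0 + int n)) z = Some y"
    using x unfolding mem_markov_dyck_shift live_def by blast
  have "segment x a b \<in> arch_words {z 0}" if cons: "consecutive ?S a b" for a b
  proof -
    define q where "q = (a - k0) div int n"
    define a' b' where "a' = a - q * int n" and "b' = b - q * int n"
    have "a' = k0 + (a - k0) mod int n"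
      unfolding a'_def q_def by (simp add: minus_mult_div_eq_mod[symmetric] algebra_simps)
    then have a': "k0 \<le> a'" "a' < k0 + int n" using n by simp_all
    have ab: "a \<in> ?S" "b \<in> ?S" "a < b" and no: "\<And>m. a < m \<Longrightarrow> m < b \<Longrightarrow> m \<notin> ?S"
      using cons by (auto simp: consecutive_def)
    have S': "a' \<in> ?S" "b' \<in> ?S" using Sper[of a "- q"] Sper[of b "- q"] ab by (auto simp: a'_def b'_def)
    \<comment> \<open>The end of the window is again a minimum and thus a cut, so the translated
      block stays inside the window.\<close>
    have "k0 + int n \<in> ?S" "k0 + int n + q * int n \<in> ?S"
      using Sper[of k0 1] Sper[of k0 "1 + q"] k0 by (auto simp: algebra_simps)
    then have "\<not> (a < k0 + int n + q * int n \<and> k0 + int n + q * int n < b)" using no by blast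
    then have b': "b' \<le> k0 + int n" "a' < b'" using a' ab(3) by (auto simp: a'_def b'_def)
    have "segment x k0 (k0 + int n) = segment x k0 a' @ segment x a' b' @ segment x b' (k0 + int n)"
      using segment_append[of k0 a' "k0 + int n" x] segment_append[of a' b' "k0 + int n" x] a' b' by simp
    then obtain z1 z2 where z1: "act (segment x b' (k0 + int n)) z = Some z1" "act (segment x a' b') z1 = Some z2"
      using z(2) by (auto simp: act_append bind_eq_Some_conv)
    have "z1 = z" using dyck_act[OF dyckS[OF S'(2) \<open>k0 + int n \<in> ?S\<close> b'(1)] z(1) z1(1)] by simp
    then have "dyck_at (z 0) (segment x a' b')"
      using dyck_act[OF dyckS[OF S' less_imp_le[OF b'(2)]] z(1)] z1(2) by simp
    moreover have "segment x a' b' = segment x a b"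
      using segment_shift[of x "- q * int n" a b] periodic_mult[of x "int n" _ "- q"] per
      by (simp add: a'_def b'_def)
    ultimately have "dyck_at (z 0) (segment x a b)" by simp
    moreover have "hgt x a < hgt x m" if m: "a < m" "m < b" for m
    proof -
      obtain l where "hgt x l < hgt x m" using no[OF m] by (auto simp: not_le)
      moreover have "hgt x a \<le> hgt x l" using ab(1) by blast
      ultimately show ?thesis by linarith
    qed
    ultimately show ?thesis by (intro prime_dyck_at ab)
  qed
  then have "x \<in> arch_shift {z 0}" unfolding mem_arch_shift decomposes_def using unb by blast
  then show ?thesis by blast
qed

lemma balanced_periodic_points:
  assumes "n > 0"
  shows "{x \<in> periodic_points n (markov_dyck_shift A). height (segment x 0 (int n)) = 0}
    = periodic_points n (dyck_code_union A)"
proof (intro equalityI subsetI)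
  fix x assume "x \<in> {x \<in> periodic_points n (markov_dyck_shift A). height (segment x 0 (int n)) = 0}"
  then show "x \<in> periodic_points n (dyck_code_union A)"
    using balanced_periodic_in_arch_shift[of x n] assms by (auto simp: periodic_points_iff dyck_code_union_eq)
next
  fix x assume "x \<in> periodic_points n (dyck_code_union A)"
  then obtain j where j: "x \<in> arch_shift {j}" and per: "\<And>k. x (k + int n) = x k"
    by (auto simp: periodic_points_iff dyck_code_union_eq)
  then show "x \<in> {x \<in> periodic_points n (markov_dyck_shift A). height (segment x 0 (int n)) = 0}"
    using arch_shift_subset[of j] arch_shift_balanced[OF j per] by (auto simp: periodic_points_iff)
qed

end

section \<open>Periodic points with nontrivial multiplier\<close>

fun vertex :: "'n letter \<Rightarrow> 'n" where
  "vertex (Alpha i) = i"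
| "vertex (Beta i) = i"

context transition_matrix
begin

text \<open>Blocks of the periodic points with negative multiplier, cut behind each unmatched \<open>Beta\<close>.\<close>

definition descent_words :: "'n \<Rightarrow> 'n \<Rightarrow> 'n letter list set" where
  "descent_words i j = {w @ [Beta j] | w. A $ i $ j \<noteq> 0 \<and> dyck_at j w}"

lemma descent_segment:
  assumes "segment x a b \<in> descent_words i j" "a < b"
  shows "hgt x b = hgt x a - 1" "a \<le> m \<Longrightarrow> m < b \<Longrightarrow> hgt x a \<le> hgt x m"
proof -
  obtain w where w: "segment x a b = w @ [Beta j]" "dyck_at j w"
    using assms(1) by (auto simp: descent_words_def)
  have "segment x a b = segment x a (b - 1) @ [x (b - 1)]"
    using assms(2) segment_append[of a "b - 1" b x] segment_Suc[of x "b - 1"] by simp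
  then have eq: "segment x a (b - 1) = w" "x (b - 1) = Beta j" using w(1) by auto
  then have "dyck (segment x a (b - 1))" using dyck_at_imp_dyck w(2) by simp
  then have h: "\<And>k. a \<le> k \<Longrightarrow> k \<le> b - 1 \<Longrightarrow> hgt x a \<le> hgt x k" "hgt x (b - 1) = hgt x a"
    using dyck_segment[of a "b - 1" x] assms(2) by auto
  show "hgt x b = hgt x a - 1"
    using h(2) hgt_Suc[of x "b - 1"] eq by simp
  show "hgt x a \<le> hgt x m" if "a \<le> m" "m < b" using h(1)[of m] that by simp
qed

lemma decomposes_descent_decreasing:
  assumes "decomposes descent_words vertex x S" "s \<in> S" "t \<in> S" "s < t"
  shows "hgt x t < hgt x s"
proof -
  have block: "segment x k k' \<in> descent_words (vertex (x (k - 1))) (vertex (x (k' - 1)))" "k < k'"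
    if "consecutive S k k'" for k k'
    using assms that by (auto simp: decomposes_def consecutive_def)
  have step: "hgt x k' = hgt x k - 1" if "consecutive S k k'" for k k'
    using descent_segment(1) block[OF that] by blast
  obtain s' where s': "consecutive S s s'" "s' \<le> t"
    using ex_consecutive_from assms by blast
  have "hgt x t \<le> hgt x s'"
    by (rule consecutive_chain[of S "\<lambda>s t. hgt x t \<le> hgt x s"])
      (use step s' assms(3) in \<open>auto simp: consecutive_def\<close>)
  then show ?thesis using step[OF s'(1)] by simp
qed

text \<open>Within a block the height never falls below its initial value, and the closing letter
  takes it exactly one lower. The cuts are therefore the positions lower than everything before
  them.\<close>

lemma decomposes_descent_cuts:
  assumes "decomposes descent_words vertex x S"
  shows "S = {k. \<forall>m<k. hgt x k < hgt x m}"
proof -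
  have around: "\<exists>a b. consecutive S a b \<and> a \<le> m \<and> m < b \<and> hgt x a \<le> hgt x m" for m
  proof -
    obtain a b where ab: "consecutive S a b" "a \<le> m" "m < b"
      using ex_consecutive_around assms unfolding decomposes_def by blast
    then have "segment x a b \<in> descent_words (vertex (x (a - 1))) (vertex (x (b - 1)))" "a < b"
      using assms by (auto simp: decomposes_def)
    then show ?thesis using descent_segment(2) ab by blast
  qed
  show ?thesis
  proof (intro equalityI subsetI CollectI allI impI)
    fix k m assume k: "k \<in> S" "m < k"
    obtain a b where ab: "consecutive S a b" "a \<le> m" "m < b" "hgt x a \<le> hgt x m" using around by blast
    then have "a \<in> S" "a < k" using k by (auto simp: consecutive_def)
    then show "hgt x k < hgt x m" using decomposes_descent_decreasing[OF assms _ k(1)] ab(4) by force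
  next
    fix k assume k: "k \<in> {k. \<forall>m<k. hgt x k < hgt x m}"
    obtain a b where ab: "consecutive S a b" "a \<le> k" "hgt x a \<le> hgt x k" using around by blast
    have "a = k"
    proof (rule ccontr)
      assume "a \<noteq> k"
      then have "a < k" using ab(2) by simp
      then have "hgt x k < hgt x a" using k by blast
      then show False using ab(3) by simp
    qed
    then show "k \<in> S" using ab(1) by (simp add: consecutive_def)
  qed
qed

lemma block_graph_descent: "block_graph descent_words vertex"
proof
  fix b i j b' j' u u' assume b: "b \<in> descent_words i j" "b' \<in> descent_words i j'" "b @ u = b' @ u'"
  then obtain w w' where w: "b = w @ [Beta j]" "dyck_at j w" "b' = w' @ [Beta j']" "dyck_at j' w'"
    by (auto simp: descent_words_def)
  have "w @ Beta j # u = w' @ Beta j' # u'" using b(3) by (simp add: w(1,3))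
  then have "w = w' \<and> j = j'"
    using dyck_first_passage_unique[of w j u w' j' u'] w(2,4) dyck_at_imp_dyck by blast
  then show "b = b'" by (simp add: w(1,3))
next
  fix x :: "int \<Rightarrow> 'n letter" and S S'
  assume S: "decomposes descent_words vertex x S" "decomposes descent_words vertex x S'"
  show "S = S'"
    by (rule trans[OF decomposes_descent_cuts[OF S(1)] sym[OF decomposes_descent_cuts[OF S(2)]]])
qed (auto simp: descent_words_def)

lemma card_descent_words:
  "card {b \<in> descent_words i j. length b = l}
    = (if A $ i $ j \<noteq> 0 \<and> 1 \<le> l then card (dyck_set (l - 1) j) else 0)"
proof (cases "A $ i $ j \<noteq> 0 \<and> 1 \<le> l")
  case True
  then have "{b \<in> descent_words i j. length b = l} = (\<lambda>w. w @ [Beta j]) ` dyck_set (l - 1) j"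
    by (auto simp: descent_words_def dyck_set_def)
  then show ?thesis using True by (simp add: card_image inj_on_def)
next
  case False
  then have "{b \<in> descent_words i j. length b = l} = {}" by (auto simp: descent_words_def)
  then show ?thesis by (simp only: False card.empty if_False)
qed

definition weight_matrix :: "real fps^'n^'n" where
  "weight_matrix = (\<chi> i j. if i = j then dyck_fps_sq A i else 0)"

definition edge_matrix :: "real fps^'n^'n" where
  "edge_matrix = (\<chi> i j. fps_X * of_nat (A $ i $ j))"

definition descent_shift :: "(int \<Rightarrow> 'n letter) set" where
  "descent_shift = coded_shift descent_words vertex"

text \<open>The blocks give the matrix \<open>edge_matrix ** weight_matrix\<close>, in the other
  order. Conjugating by the diagonal factor exchanges the order inside the determinant; its
  determinant can be cancelled because every f_i^A has constant term 1.\<close>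

lemma zeta_descent_shift: "zeta_fps descent_shift * det (mat 1 - weight_matrix ** edge_matrix) = 1"
proof -
  interpret block_graph descent_words vertex by (rule block_graph_descent)
  let ?B = edge_matrix and ?D = weight_matrix
  have "block_matrix $ i $ j = (?B ** ?D) $ i $ j" for i j
  proof -
    have "(?B ** ?D) $ i $ j = (\<Sum>k\<in>UNIV. if k = j then fps_X * of_nat (A $ i $ j) * dyck_fps_sq A j else 0)"
      unfolding matrix_matrix_mult_def by (simp add: edge_matrix_def weight_matrix_def if_distrib cong: if_cong)
    also have "\<dots> = fps_X * of_nat (A $ i $ j) * dyck_fps_sq A j" by simp
    finally have BD: "(?B ** ?D) $ i $ j = fps_X * of_nat (A $ i $ j) * dyck_fps_sq A j" .
    show ?thesis
      unfolding BD
    proof (rule fps_ext)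
      fix l
      have "A $ i $ j = 0 \<or> A $ i $ j = 1" using zero_one[of i j] by simp
      then show "fps_nth (block_matrix $ i $ j) l = fps_nth (fps_X * of_nat (A $ i $ j) * dyck_fps_sq A j) l"
        by (auto simp: block_matrix_def blocks_def card_descent_words fps_nth_dyck_fps_sq)
    qed
  qed
  then have M: "block_matrix = ?B ** ?D" by (simp add: vec_eq_iff)
  have "det ?D = (\<Prod>i\<in>UNIV. dyck_fps_sq A i)"
    by (subst det_diagonal) (auto simp: weight_matrix_def)
  moreover have "dyck_fps_sq A i \<noteq> 0" for i
  proof -
    have "fps_nth (dyck_fps_sq A i) 0 = 1" by (simp add: fps_nth_dyck_fps_sq dyck_set_0)
    then show ?thesis by auto
  qed
  ultimately have nz: "det ?D \<noteq> 0" by simp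
  have "?D ** (mat 1 - ?B ** ?D) = (mat 1 - ?D ** ?B) ** ?D"
  proof -
    have 1: "X ** (mat 1 - Y) = X - X ** Y" for X Y :: "real fps^'n^'n"
      by (simp add: vec_eq_iff matrix_matrix_mult_def mat_def right_diff_distrib sum_subtractf
          if_distrib[where f = "\<lambda>a. _ * a"] cong: if_cong)
    have 2: "(mat 1 - Y) ** X = X - Y ** X" for X Y :: "real fps^'n^'n"
      by (simp add: vec_eq_iff matrix_matrix_mult_def mat_def left_diff_distrib sum_subtractf
          if_distrib[where f = "\<lambda>a. a * _"] cong: if_cong)
    show ?thesis by (simp add: 1 2 matrix_mul_assoc)
  qed
  then have "det ?D * det (mat 1 - ?B ** ?D) = det ?D * det (mat 1 - ?D ** ?B)"
    by (metis det_mul mult.commute)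
  then have "det (mat 1 - ?B ** ?D) = det (mat 1 - ?D ** ?B)" using nz by simp
  then show ?thesis using zeta_coded_shift by (simp add: M descent_shift_def)
qed

section \<open>Descent sequences and periodic points whose period has negative height\<close>

lemma act_path_word_descent:
  assumes "path_word descent_words i j w" "z \<in> infinite_paths" "A $ j $ z 0 \<noteq> 0"
  shows "\<exists>y. act w z = Some y \<and> A $ i $ y 0 \<noteq> 0"
  using assms
proof (induction rule: path_word.induct)
  case (Append b i j k u)
  then obtain y where y: "act u z = Some y" "A $ j $ y 0 \<noteq> 0" by blast
  obtain w where w: "b = w @ [Beta j]" "A $ i $ j \<noteq> 0" "dyck_at j w"
    using Append.hyps(1) by (auto simp: descent_words_def)
  have "y \<in> infinite_paths" using act_in_paths Append.prems(1) y(1) by blast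
  then have "act w (case_nat j y) = Some (case_nat j y)"
    by (intro act_dyck_at[OF w(3)] case_nat_in_paths y(2)) auto
  then show ?case using y w by (simp add: act_append)
qed simp

lemma descent_shift_subset: "descent_shift \<subseteq> markov_dyck_shift A"
proof
  fix x assume "x \<in> descent_shift"
  then obtain S where S: "decomposes descent_words vertex x S"
    by (auto simp: descent_shift_def coded_shift_def)
  have "live (segment x a b)" if "a \<le> b" for a b
  proof -
    obtain s t where s: "s \<in> S" "s \<le> a" "t \<in> S" "b \<le> t" using S unfolding decomposes_def unbounded_def by meson
    let ?j = "vertex (x (t - 1))"
    obtain k where k: "A $ ?j $ k \<noteq> 0" using essential by (auto simp: essential_def)
    obtain z where z: "z \<in> infinite_paths" "z 0 = k" using infinite_path_from by blast
    have "s \<le> t" using s that by simp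
    then obtain y where "act (segment x s t) z = Some y"
      using act_path_word_descent[OF path_word_segment[OF S s(1,3)] z(1)] k z(2) by blast
    then have "live (segment x s t)" using z(1) by (auto simp: live_def)
    moreover have "segment x s t = segment x s a @ segment x a b @ segment x b t"
      using segment_append[of s a t x] segment_append[of a b t x] s that by simp
    ultimately show ?thesis using live_infix by metis
  qed
  moreover have "live (segment x a b)" if "b < a" for a b
    using that live_dyck_at[OF dyck_at.Nil] by simp
  ultimately show "x \<in> markov_dyck_shift A" unfolding mem_markov_dyck_shift by (meson linorder_not_less)
qed

lemma descent_shift_negative:
  assumes "x \<in> descent_shift" "\<And>k. x (k + int n) = x k" "n > 0"
  shows "height (segment x 0 (int n)) < 0"
proof -
  interpret block_graph descent_words vertex by (rule block_graph_descent)
  obtain S where S: "decomposes descent_words vertex x S"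
    using assms(1) by (auto simp: descent_shift_def coded_shift_def)
  then obtain k where k: "k \<in> S" unfolding decomposes_def unbounded_def by blast
  have "k + int n \<in> S" using decomposes_periodic[OF S, of "int n" k] assms(2) k by simp
  then have "hgt x (k + int n) < hgt x k"
    using decomposes_descent_decreasing[OF S k] assms(3) by simp
  moreover have "hgt x (k + int n) = hgt x k + height (segment x 0 (int n))"
    by (rule hgt_periodic) (rule assms(2))
  ultimately show ?thesis by simp
qed

lemma negative_periodic_in_descent_shift:
  assumes x: "x \<in> markov_dyck_shift A" and per: "\<And>k. x (k + int n) = x k" and n: "n > 0"
    and neg: "height (segment x 0 (int n)) < 0"
  shows "x \<in> descent_shift"
proof -
  let ?S = "{k. \<forall>m<k. hgt x k < hgt x m}"
  let ?c = "height (segment x 0 (int n))"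
  have hper: "hgt x (k + q * int n) = hgt x k + q * ?c" for k q
    using hgt_periodic_mult[of x n k q] per by simp
  \<comment> \<open>Take the first position in one period where the minimum over that period is
    attained. Positions in earlier periods are higher because the drift is negative.\<close>
  obtain k0 where k0: "k0 \<in> ?S"
  proof -
    let ?W = "{0..<int n}"
    define M where "M = Min (hgt x ` ?W)"
    have fin: "finite (hgt x ` ?W)" "hgt x ` ?W \<noteq> {}" using n by auto
    have M: "M \<in> hgt x ` ?W" unfolding M_def by (rule Min_in[OF fin])
    have M_le: "M \<le> hgt x m" if "m \<in> ?W" for m unfolding M_def using fin(1) that by (intro Min_le) auto
    define T where "T = {k \<in> ?W. hgt x k = M}"
    have T: "finite T" "T \<noteq> {}" using M by (auto simp: T_def intro: finite_subset[of _ ?W])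
    define k0 where "k0 = Min T"
    have "k0 \<in> T" unfolding k0_def using T by (rule Min_in)
    then have k0: "k0 \<in> ?W" "hgt x k0 = M" by (auto simp: T_def)
    have least: "k0 \<le> k" if "k \<in> ?W" "hgt x k = M" for k
      unfolding k0_def using T(1) that by (intro Min_le) (auto simp: T_def)
    have "hgt x k0 < hgt x m" if m: "m < k0" for m
    proof (cases "0 \<le> m")
      case True
      then have W: "m \<in> ?W" using m k0(1) by auto
      have "hgt x m \<noteq> M" using least[OF W] m by auto
      then show ?thesis using M_le[OF W] k0(2) by simp
    next
      case False
      have "m mod int n \<in> ?W" using n by simp
      then have "M \<le> hgt x (m mod int n)" by (rule M_le)
      moreover have "hgt x m = hgt x (m mod int n) + (m div int n) * ?c"
        using hper[of "m mod int n" "m div int n"] by simp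
      moreover have "0 < (m div int n) * ?c"
        using False n neg by (intro mult_neg_neg) (auto simp: pos_imp_zdiv_neg_iff)
      ultimately show ?thesis using k0(2) by linarith
    qed
    then show ?thesis using that by blast
  qed
  have up: "k + q * int n \<in> ?S" if "k \<in> ?S" for k q
  proof (intro CollectI allI impI)
    fix m assume "m < k + q * int n"
    then have "hgt x k < hgt x (m + (- q) * int n)" using that by simp
    then show "hgt x (k + q * int n) < hgt x m" using hper[of k q] hper[of m "- q"] by simp
  qed
  have unb: "unbounded ?S"
    by (rule unbounded_periodic[OF k0, of "int n"]) (use up[of _ 1] up[of _ "-1"] n in auto)
  have "segment x a b \<in> descent_words (vertex (x (a - 1))) (vertex (x (b - 1)))" if cons: "consecutive ?S a b" for a b
  proof -
    have ab: "a \<in> ?S" "b \<in> ?S" "a < b" and no: "\<And>m. a < m \<Longrightarrow> m < b \<Longrightarrow> m \<notin> ?S"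
      using cons by (auto simp: consecutive_def)
    \<comment> \<open>The first position after \<open>a\<close> below the height of \<open>a\<close>
      would be a record minimum, hence a cut inside the gap.\<close>
    have ge: "hgt x a \<le> hgt x (a + int d)" if "a + int d < b" for d
      using that
    proof (induction d rule: less_induct)
      case (less d)
      show ?case
      proof (rule ccontr)
        assume lt: "\<not> hgt x a \<le> hgt x (a + int d)"
        have "a + int d \<in> ?S"
        proof (intro CollectI allI impI)
          fix m assume m: "m < a + int d"
          show "hgt x (a + int d) < hgt x m"
          proof (cases "m < a")
            case True
            then have "hgt x a < hgt x m" using ab(1) by blast
            then show ?thesis using lt by simp
          next
            case False
            then have "hgt x a \<le> hgt x (a + int (nat (m - a)))"
              using less m by (intro less.IH) auto
            then show ?thesis using lt False by simp
          qed
        qed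
        moreover have "d \<noteq> 0" using lt by (cases d) auto
        ultimately show False using no[of "a + int d"] less.prems by auto
      qed
    qed
    have ge': "hgt x a \<le> hgt x m" if "a \<le> m" "m < b" for m
      using ge[of "nat (m - a)"] that by simp
    have lt: "hgt x b < hgt x a" using ab by blast
    have step: "hgt x b = hgt x (b - 1) + height_letter (x (b - 1))" using hgt_Suc[of x "b - 1"] by simp
    have "hgt x a \<le> hgt x (b - 1)" using ge' ab(3) by simp
    then obtain j where j: "x (b - 1) = Beta j" "hgt x (b - 1) = hgt x a"
      using step lt by (cases "x (b - 1)") auto
    have dyck: "dyck (segment x a (b - 1))"
      using ab(3) ge' j(2) by (subst dyck_segment) auto
    have seg: "segment x a b = segment x a (b - 1) @ [Beta j]"
      using ab(3) segment_append[of a "b - 1" b x] segment_Suc[of x "b - 1"] j(1) by simp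
    \<comment> \<open>A record minimum is entered by a descending letter.\<close>
    obtain i where i: "x (a - 1) = Beta i"
    proof (cases "x (a - 1)")
      case (Alpha i)
      have "hgt x a < hgt x (a - 1)" using ab(1) by simp
      then show ?thesis using hgt_Suc[of x "a - 1"] Alpha by simp
    qed (use that in blast)
    \<comment> \<open>The segment is extended by the letter before the cut, since the edge from
      \<open>i\<close> to \<open>j\<close> shows only when that letter acts as well.\<close>
    have "segment x (a - 1) b = Beta i # segment x a (b - 1) @ [Beta j]"
      using ab(3) segment_append[of "a - 1" a b x] segment_Suc[of x "a - 1"] i seg by simp
    moreover have "live (segment x (a - 1) b)" using x by (simp add: mem_markov_dyck_shift)
    ultimately obtain z y where z: "z \<in> infinite_paths" "act (Beta i # segment x a (b - 1) @ [Beta j]) z = Some y"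
      by (auto simp: live_def)
    then obtain y' where edge: "A $ j $ z 0 \<noteq> 0" and y': "act (segment x a (b - 1)) (case_nat j z) = Some y'"
      "act_letter (Beta i) y' = Some y"
      by (auto simp: act_append bind_eq_Some_conv split: if_splits)
    have "y' = case_nat j z \<and> dyck_at (case_nat j z 0) (segment x a (b - 1))"
      by (rule dyck_act[OF dyck case_nat_in_paths[OF z(1) edge] y'(1)])
    then have "dyck_at j (segment x a (b - 1))" "A $ i $ j \<noteq> 0" using y'(2) by (auto split: if_splits)
    then show ?thesis using i j(1) seg by (auto simp: descent_words_def)
  qed
  then have "decomposes descent_words vertex x ?S" using unb by (simp add: decomposes_def)
  then show ?thesis by (auto simp: descent_shift_def coded_shift_def)
qed

lemma negative_periodic_points:
  assumes "n > 0"
  shows "{x \<in> periodic_points n (markov_dyck_shift A). height (segment x 0 (int n)) < 0}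
    = periodic_points n descent_shift"
proof (intro equalityI subsetI)
  fix x assume "x \<in> {x \<in> periodic_points n (markov_dyck_shift A). height (segment x 0 (int n)) < 0}"
  then show "x \<in> periodic_points n descent_shift"
    using negative_periodic_in_descent_shift[of x n] assms by (simp add: periodic_points_iff)
next
  fix x assume "x \<in> periodic_points n descent_shift"
  then show "x \<in> {x \<in> periodic_points n (markov_dyck_shift A). height (segment x 0 (int n)) < 0}"
    using descent_shift_subset descent_shift_negative[of x n] assms by (auto simp: periodic_points_iff)
qed

text \<open>Reversing a sequence and taking adjoints exchanges the signs of the multipliers.\<close>

definition reversal :: "(int \<Rightarrow> 'n letter) \<Rightarrow> int \<Rightarrow> 'n letter" where
  "reversal x k = adj_letter (x (- k))"

lemma reversal_reversal: "reversal (reversal x) = x"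
  by (simp add: reversal_def fun_eq_iff)

lemma segment_reversal: "segment (reversal x) a b = adj_list (segment x (1 - b) (1 - a))"
  by (rule nth_equalityI)
    (auto simp: nth_segment adj_list_def rev_nth reversal_def algebra_simps)

lemma reversal_in_shift: "x \<in> markov_dyck_shift A \<Longrightarrow> reversal x \<in> markov_dyck_shift A"
  by (simp add: mem_markov_dyck_shift segment_reversal)

lemma height_reversal:
  assumes "\<And>k. x (k + int n) = x k"
  shows "height (segment (reversal x) 0 (int n)) = - height (segment x 0 (int n))"
proof -
  \<comment> \<open>Reflection carries the positions 0 to n - 1 to the positions 1 - n to 0, another
    full period of the sequence.\<close>
  have "hgt x (1 - int n + int n) = hgt x (1 - int n) + height (segment x 0 (int n))"
    by (rule hgt_periodic) (rule assms)
  then show ?thesis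
    using height_segment[of "1 - int n" 1 x] by (simp add: segment_reversal)
qed

lemma reversal_periodic:
  assumes "\<And>k. x (k + int n) = x k"
  shows "reversal x (k + int n) = reversal x k"
  using assms[of "- (k + int n)"] by (simp add: reversal_def)

lemma card_positive_periodic_points:
  assumes "n > 0"
  shows "card {x \<in> periodic_points n (markov_dyck_shift A). 0 < height (segment x 0 (int n))}
    = card (periodic_points n descent_shift)"
proof -
  have "bij_betw reversal {x \<in> periodic_points n (markov_dyck_shift A). 0 < height (segment x 0 (int n))}
    {x \<in> periodic_points n (markov_dyck_shift A). height (segment x 0 (int n)) < 0}"
    by (rule bij_betwI[where g = reversal])
      (auto simp: periodic_points_iff reversal_in_shift height_reversal reversal_periodic reversal_reversal)
  then show ?thesis by (simp add: bij_betw_same_card negative_periodic_points[OF assms])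
qed

lemma card_periodic_markov_dyck:
  assumes "n > 0"
  shows "card (periodic_points n (markov_dyck_shift A)) =
    card (periodic_points n (dyck_code_union A)) + 2 * card (periodic_points n descent_shift)"
proof -
  let ?P = "periodic_points n (markov_dyck_shift A)"
  let ?h = "\<lambda>x. height (segment x 0 (int n))"
  have fin: "finite ?P" by (rule finite_periodic_points[OF assms])
  have "card ?P = card ({x \<in> ?P. ?h x = 0} \<union> ({x \<in> ?P. ?h x < 0} \<union> {x \<in> ?P. 0 < ?h x}))"
    by (rule arg_cong[of _ _ card]) auto
  also have "\<dots> = card {x \<in> ?P. ?h x = 0} + card ({x \<in> ?P. ?h x < 0} \<union> {x \<in> ?P. 0 < ?h x})"
    using fin by (intro card_Un_disjoint) auto
  also have "card ({x \<in> ?P. ?h x < 0} \<union> {x \<in> ?P. 0 < ?h x}) = card {x \<in> ?P. ?h x < 0} + card {x \<in> ?P. 0 < ?h x}"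
    using fin by (intro card_Un_disjoint) auto
  finally show ?thesis
    by (simp add: balanced_periodic_points negative_periodic_points card_positive_periodic_points assms)
qed

lemma zeta_markov_dyck:
  "zeta_fps (markov_dyck_shift A) = zeta_fps (dyck_code_union A) * (zeta_fps descent_shift) ^ 2"
proof -
  have "zeta_fps (markov_dyck_shift A) = zeta_of_counts (\<lambda>n. real (card (periodic_points n (dyck_code_union A)))
      + (real (card (periodic_points n descent_shift)) + real (card (periodic_points n descent_shift))))"
    unfolding zeta_fps_eq by (rule zeta_of_counts_cong) (simp add: card_periodic_markov_dyck)
  then show ?thesis by (simp only: zeta_of_counts_add zeta_fps_eq power2_eq_square)
qed

end

theorem theorem3p9:
  fixes A :: "nat^'n::finite^'n"
  assumes "CARD('n) \<ge> 2"
    and "\<forall>i j. A $ i $ j \<in> {0, 1}"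
    and "essential A"
  shows "zeta_fps (markov_dyck_shift A) =
           zeta_fps (dyck_code_union A) /
             (det (mat 1 - (\<chi> i j. if i = j then dyck_fps_sq A i else 0)
                             ** (\<chi> i j. fps_X * of_nat (A $ i $ j)))) ^ 2
    \<and> zeta_fps (dyck_code_union A) =
           (\<Prod>J\<in>{J. J \<noteq> {}}.
              zeta_fps (bi_infinite_concats (dyck_code A J)) powi ((-1) ^ (card J + 1)))
    \<and> (\<forall>J. J \<noteq> {} \<longrightarrow>
           zeta_fps (bi_infinite_concats (dyck_code A J)) =
             1 / (1 - fps_X ^ 2 * (\<Sum>i\<in>UNIV. (\<Prod>j\<in>J. of_nat (A $ i $ j)) * dyck_fps_sq A i)))
    \<and> (\<forall>i. dyck_fps A i =
           1 + fps_X * dyck_fps A i * (\<Sum>j\<in>UNIV. of_nat (A $ j $ i) * dyck_fps A j))"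
proof -
  interpret transition_matrix A
    by unfold_locales (use assms in auto)
  have cancel: "u * y = 1 \<Longrightarrow> x * u = x / y" for u x y :: "real fps"
  proof -
    assume *: "u * y = 1"
    then have "y \<noteq> 0" by auto
    have "x / y = x * u * y / y" using * by (simp add: mult.assoc)
    also have "\<dots> = x * u" using \<open>y \<noteq> 0\<close> by (rule nonzero_mult_div_cancel_right)
    finally show "x * u = x / y" ..
  qed
  have "zeta_fps (markov_dyck_shift A)
      = zeta_fps (dyck_code_union A) / (det (mat 1 - weight_matrix ** edge_matrix)) ^ 2"
    unfolding zeta_markov_dyck
    by (rule cancel) (simp flip: power_mult_distrib add: zeta_descent_shift)
  moreover have "zeta_fps (arch_shift J) = 1 / (1 - arch_fps J)" for J
    using cancel[OF zeta_arch_shift[of J], of 1] by simp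
  ultimately show ?thesis
    using zeta_dyck_code_union dyck_fps_relation
    unfolding weight_matrix_def edge_matrix_def arch_shift_def arch_fps_def by blast
qed

end
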